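(* Let $r\ge2$ and let $F$ be an $r$-graph with vertex set $\{1,\dots,f\}$, at least one edge and no isolated vertices. Suppose that a family of $F$-coloured $r$-graphs (the coloured case) or a family of $r$-graphs (the uncoloured case) is $F$-abundant with constants $c,C>0$. Then one can choose a member $(H_0,\sigma)$ of the family in the coloured case, or a member $H_0$ of the family in the uncoloured case, and an $F$-colouring $\sigma_0$ of $H_0^\circ$, with $\sigma_0=\sigma|_{V(H_0^\circ)}$ in the coloured case, such that the following hold. (i) $v(H_0^\circ)\le\lfloor2r(C+1)\rfloor$, and $(H_0^\circ,\sigma_0)$ is $F$-abundant. (ii) The linear system $Bx=0$ associated with $(H_0^\circ,\sigma_0)$ (for any pairwise distinct integers $\theta_1,\dots,\theta_f$ and any choice of $B$) is translation-invariant, i.e. $B\mathbf 1=0$. It has $m=e(H_0^\circ)\le\binom{\lfloor2r(C+1)\rfloor}{r}$ variables. Moreover, whenever $c',C'>0$ are constants witnessing that $(H_0^\circ,\sigma_0)$ is $F$-abundant, there is a constant $c_0>0$ such that for every $\delta>0$: there is $p_0(\delta)$ such that for every prime $p\ge p_0(\delta)$ and every $A\subseteq\mathbb F_p$ with $|A|\ge\delta p$, $$|\ker(B\bmod p)\cap A^m|\ge c_0\delta^{C'}p^s;$$ and there is $N_0(\delta)$ such that for every $N\ge N_0(\delta)$ and every $A\subseteq\{1,\dots,N\}$ with $|A|\ge\delta N$, $$|\{x\in A^m:Bx=0\text{ over }\mathbb Z\}|\ge c_0\delta^{C'}N^s.$$ If $m\ge2$, the same bounds hold when only proper solutions are counted.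 (iii) If $e(H_0^\circ)\ge v(H_0^\circ)-q(r-1)+1$, where $q$ is the number of components of $H_0^\circ$, then the system contains a nonzero equation (that is, $B$ has a nonzero row).
   Context: An $r$-graph is a finite simple $r$-uniform hypergraph $H$; $v(H)$ and $e(H)$ are its numbers of vertices and edges. A vertex is isolated if it lies in no edge; $H^\circ$ is obtained from $H$ by deleting all isolated vertices. Two vertices $x,y$ are in the same component if $x=y$ or there are edges $e_1,\dots,e_d$ with $x\in e_1$, $y\in e_d$ and $e_i\cap e_{i+1}\ne\varnothing$ for all $1\le i<d$. A homomorphism $H\to G$ is a map $\phi:V(H)\to V(G)$ with $\phi(e)\in E(G)$ for every $e\in E(H)$; an embedding is an injective homomorphism; $\mathrm{Emb}(H,G)$ counts embeddings. An $n$-vertex $r$-graph $G$ is $\varepsilon$-far from being $F$-free if at least $\varepsilon n^r$ edges must be deleted to destroy every (not necessarily induced) copy of $F$. An $F$-colouring of $G$ is a homomorphism $\kappa_G:G\to F$; an $r$-graph with a fixed $F$-colouring is $F$-partite. An $F$-coloured $r$-graph is a pair $(H,\sigma)$ with $\sigma:H\to F$ an $F$-colouring. For $G$ $F$-partite, $\mathrm{Emb}_\sigma(H,G)$ counts embeddings $\phi$ with $\kappa_G\circ\phi=\sigma$. An $n$-vertex $F$-partite $r$-graph $G$ is uniformly $\varepsilon$-far from being $F$-free if there is a collection $\mathcal C$ of embeddings $\psi:F\to G$ such that the sets $\psi(E(F))$ are pairwise disjoint, $\kappa_G\circ\psi=\mathrm{id}_{V(F)}$ for every $\psi\in\mathcal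 C$, and every vertex of $G$ belongs to $\psi(V(F))$ for at least $\varepsilon n^{r-1}$ members $\psi\in\mathcal C$. An $F$-coloured $(H,\sigma)$ is $F$-abundant, witnessed by constants $c',C'>0$, if for every $0<\varepsilon\le1$ there is $n_0(\varepsilon)$ such that every uniformly $\varepsilon$-far $n$-vertex $F$-partite $G$ with $n\ge n_0(\varepsilon)$ satisfies $\mathrm{Emb}_\sigma(H,G)\ge c'\varepsilon^{C'}n^{v(H)}$. A (possibly infinite) family of $r$-graphs is $F$-abundant with constants $c,C>0$ if for every $0<\varepsilon\le1$ there is $n_0(\varepsilon)$ such that every $n$-vertex $G$ with $n\ge n_0(\varepsilon)$ that is $\varepsilon$-far from being $F$-free admits some member $H$ (depending possibly on $G,\varepsilon$) with $\mathrm{Emb}(H,G)\ge c\varepsilon^Cn^{v(H)}$. A family of $F$-coloured $r$-graphs is $F$-abundant with constants $c,C>0$ if for every $0<\varepsilon\le1$ there is $n_0(\varepsilon)$ such that every uniformly $\varepsilon$-far $n$-vertex $F$-partite $G$ with $n\ge n_0(\varepsilon)$ admits some member $(H,\sigma)$ with $\mathrm{Emb}_\sigma(H,G)\ge c\varepsilon^Cn^{v(H)}$. Associated system. For an $F$-coloured $r$-graph $(H,\sigma)$ without isolated vertices and pairwise distinct integers $\theta_1,\dots,\theta_f$, with $m=e(H)$, define $D:\mathbb Q^{V(H)}\to\mathbb Q^{E(H)}$ by $(Dy)_e=\sum_{u\in e}y_u/\prod_{v\in e\setminus\{u\}}(\theta_{\sigma(u)}-\theta_{\sigma(v)})$, let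 $\mathcal S=\operatorname{im}_{\mathbb Q}(D)$, $s=\dim_{\mathbb Q}\mathcal S$, and let $B\in\mathbb Z^{(m-s)\times m}$ be a full-row-rank matrix with $\ker_{\mathbb Q}(B)=\mathcal S$ (with zero rows if $s=m$). The associated system is $Bx=0$, in $m$ variables. $B\bmod p$ is the entrywise reduction modulo $p$; $\mathbf 1$ is the all-one vector. A solution is proper if its coordinates are pairwise distinct. *)

theory Defs
  imports
    Complex_Main
    "HOL-Library.FuncSet"
    "HOL-Library.Disjoint_Sets"
    "HOL-Library.Function_Algebras"
    "HOL-Computational_Algebra.Primes"
begin

section \<open>Hypergraphs, homomorphisms and embeddings\<close>

record 'a hypergraph =
  verts :: "'a set"
  edges :: "'a set set"

text \<open>The empty vertex set is allowed: deleting the isolated vertices may leave nothing.\<close>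

definition r_graph :: "nat \<Rightarrow> 'a hypergraph \<Rightarrow> bool" where
  "r_graph r H \<longleftrightarrow> finite (verts H) \<and> (\<forall>e\<in>edges H. e \<subseteq> verts H \<and> card e = r)"

definition isolated :: "'a hypergraph \<Rightarrow> 'a \<Rightarrow> bool" where
  "isolated H v \<longleftrightarrow> v \<in> verts H \<and> (\<forall>e\<in>edges H. v \<notin> e)"

definition del_isolated :: "'a hypergraph \<Rightarrow> 'a hypergraph" where
  "del_isolated H = H\<lparr>verts := {v \<in> verts H. \<not> isolated H v}\<rparr>"

definition same_component :: "'a hypergraph \<Rightarrow> 'a \<Rightarrow> 'a \<Rightarrow> bool" where
  "same_component H x y \<longleftrightarrow>
     x = y \<or>
     (\<exists>es. es \<noteq> [] \<and> set es \<subseteq> edges H \<and> x \<in> hd es \<and> y \<in> last es \<and>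
           (\<forall>i. Suc i < length es \<longrightarrow> es ! i \<inter> es ! Suc i \<noteq> {}))"

definition num_components :: "'a hypergraph \<Rightarrow> nat" where
  "num_components H =
     card (verts H // {(x, y). x \<in> verts H \<and> y \<in> verts H \<and> same_component H x y})"

definition homomorphism :: "'a hypergraph \<Rightarrow> 'b hypergraph \<Rightarrow> ('a \<Rightarrow> 'b) \<Rightarrow> bool" where
  "homomorphism H G \<phi> \<longleftrightarrow> \<phi> \<in> verts H \<rightarrow> verts G \<and> (\<forall>e\<in>edges H. \<phi> ` e \<in> edges G)"

text \<open>Embeddings are taken extensional, so that each map on the vertex set is counted once.\<close>

definition embeddings :: "'a hypergraph \<Rightarrow> 'b hypergraph \<Rightarrow> ('a \<Rightarrow> 'b) set" where
  "embeddings H G = {\<phi> \<in> extensional (verts H). homomorphism H G \<phi> \<and> inj_on \<phi> (verts H)}"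

definition coloured_embeddings ::
    "'a hypergraph \<Rightarrow> ('a \<Rightarrow> 'c) \<Rightarrow> 'b hypergraph \<Rightarrow> ('b \<Rightarrow> 'c) \<Rightarrow> ('a \<Rightarrow> 'b) set" where
  "coloured_embeddings H \<sigma> G \<kappa> = {\<phi> \<in> embeddings H G. \<forall>v\<in>verts H. \<kappa> (\<phi> v) = \<sigma> v}"

section \<open>Farness and abundance\<close>

definition far_from_free :: "nat \<Rightarrow> 'c hypergraph \<Rightarrow> real \<Rightarrow> 'b hypergraph \<Rightarrow> bool" where
  "far_from_free r F \<epsilon> G \<longleftrightarrow>
     (\<forall>D \<subseteq> edges G. embeddings F (G\<lparr>edges := edges G - D\<rparr>) = {} \<longrightarrow>
        real (card D) \<ge> \<epsilon> * real (card (verts G)) ^ r)"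

definition uniformly_far_from_free ::
    "nat \<Rightarrow> 'c hypergraph \<Rightarrow> real \<Rightarrow> 'b hypergraph \<Rightarrow> ('b \<Rightarrow> 'c) \<Rightarrow> bool" where
  "uniformly_far_from_free r F \<epsilon> G \<kappa> \<longleftrightarrow>
     (\<exists>\<C> \<subseteq> embeddings F G.
        disjoint_family_on (\<lambda>\<psi>. (`) \<psi> ` edges F) \<C> \<and>
        (\<forall>\<psi>\<in>\<C>. \<forall>v\<in>verts F. \<kappa> (\<psi> v) = v) \<and>
        (\<forall>w\<in>verts G. real (card {\<psi> \<in> \<C>. w \<in> \<psi> ` verts F})
                        \<ge> \<epsilon> * real (card (verts G)) ^ (r - 1)))"

text \<open>
  Every finite hypergraph is isomorphic to one with vertices in \<^typ>\<open>nat\<close>, so in the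
  notions of abundance below the host \<open>G\<close> ranges over hypergraphs on \<^typ>\<open>nat\<close>.
\<close>

definition abundance_witness ::
    "nat \<Rightarrow> nat hypergraph \<Rightarrow> 'a hypergraph \<Rightarrow> ('a \<Rightarrow> nat) \<Rightarrow> real \<Rightarrow> real \<Rightarrow> bool" where
  "abundance_witness r F H \<sigma> c C \<longleftrightarrow>
     c > 0 \<and> C > 0 \<and>
     (\<forall>\<epsilon>. 0 < \<epsilon> \<and> \<epsilon> \<le> 1 \<longrightarrow>
       (\<exists>n0. \<forall>(G :: nat hypergraph) \<kappa>.
          r_graph r G \<and> homomorphism G F \<kappa> \<and> card (verts G) \<ge> n0 \<and>
          uniformly_far_from_free r F \<epsilon> G \<kappa> \<longrightarrow>
            real (card (coloured_embeddings H \<sigma> G \<kappa>))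
              \<ge> c * \<epsilon> powr C * real (card (verts G)) ^ card (verts H)))"

definition abundant :: "nat \<Rightarrow> nat hypergraph \<Rightarrow> 'a hypergraph \<Rightarrow> ('a \<Rightarrow> nat) \<Rightarrow> bool" where
  "abundant r F H \<sigma> \<longleftrightarrow> (\<exists>c C. abundance_witness r F H \<sigma> c C)"

definition family_abundant ::
    "nat \<Rightarrow> nat hypergraph \<Rightarrow> 'a hypergraph set \<Rightarrow> real \<Rightarrow> real \<Rightarrow> bool" where
  "family_abundant r F \<H> c C \<longleftrightarrow>
     c > 0 \<and> C > 0 \<and>
     (\<forall>\<epsilon>. 0 < \<epsilon> \<and> \<epsilon> \<le> 1 \<longrightarrow>
       (\<exists>n0. \<forall>G :: nat hypergraph.
          r_graph r G \<and> card (verts G) \<ge> n0 \<and> far_from_free r F \<epsilon> G \<longrightarrow>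
            (\<exists>H\<in>\<H>. real (card (embeddings H G))
                       \<ge> c * \<epsilon> powr C * real (card (verts G)) ^ card (verts H))))"

definition coloured_family_abundant ::
    "nat \<Rightarrow> nat hypergraph \<Rightarrow> ('a hypergraph \<times> ('a \<Rightarrow> nat)) set \<Rightarrow> real \<Rightarrow> real \<Rightarrow> bool" where
  "coloured_family_abundant r F \<K> c C \<longleftrightarrow>
     c > 0 \<and> C > 0 \<and>
     (\<forall>\<epsilon>. 0 < \<epsilon> \<and> \<epsilon> \<le> 1 \<longrightarrow>
       (\<exists>n0. \<forall>(G :: nat hypergraph) \<kappa>.
          r_graph r G \<and> homomorphism G F \<kappa> \<and> card (verts G) \<ge> n0 \<and>
          uniformly_far_from_free r F \<epsilon> G \<kappa> \<longrightarrow>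
            (\<exists>(H, \<sigma>)\<in>\<K>. real (card (coloured_embeddings H \<sigma> G \<kappa>))
                            \<ge> c * \<epsilon> powr C * real (card (verts G)) ^ card (verts H))))"

section \<open>The associated linear system\<close>

definition scale_rat_fun :: "rat \<Rightarrow> ('i \<Rightarrow> rat) \<Rightarrow> 'i \<Rightarrow> rat" where
  "scale_rat_fun a x = (\<lambda>i. a * x i)"

global_interpretation rat_fun: vector_space scale_rat_fun
  by unfold_locales (auto simp: scale_rat_fun_def fun_eq_iff algebra_simps)

text \<open>The space of rational vectors indexed by \<open>I\<close>, as functions vanishing outside \<open>I\<close>.\<close>

definition rat_vectors :: "'i set \<Rightarrow> ('i \<Rightarrow> rat) set" where
  "rat_vectors I = {x. \<forall>i. i \<notin> I \<longrightarrow> x i = 0}"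

definition assoc_map ::
    "('c \<Rightarrow> int) \<Rightarrow> 'a hypergraph \<Rightarrow> ('a \<Rightarrow> 'c) \<Rightarrow> ('a \<Rightarrow> rat) \<Rightarrow> 'a set \<Rightarrow> rat" where
  "assoc_map \<theta> H \<sigma> y = (\<lambda>e.
     if e \<in> edges H
     then \<Sum>u\<in>e. y u / (\<Prod>v\<in>e - {u}. of_int (\<theta> (\<sigma> u) - \<theta> (\<sigma> v)))
     else 0)"

definition assoc_space ::
    "('c \<Rightarrow> int) \<Rightarrow> 'a hypergraph \<Rightarrow> ('a \<Rightarrow> 'c) \<Rightarrow> ('a set \<Rightarrow> rat) set" where
  "assoc_space \<theta> H \<sigma> = assoc_map \<theta> H \<sigma> ` rat_vectors (verts H)"

definition assoc_dim :: "('c \<Rightarrow> int) \<Rightarrow> 'a hypergraph \<Rightarrow> ('a \<Rightarrow> 'c) \<Rightarrow> nat" where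
  "assoc_dim \<theta> H \<sigma> = rat_fun.dim (assoc_space \<theta> H \<sigma>)"

text \<open>
  An integer matrix with \<open>k\<close> rows and columns indexed by \<open>I\<close> is a function
  \<open>B :: nat \<Rightarrow> 'i \<Rightarrow> int\<close> of which only the entries \<open>B i j\<close> with \<open>i < k\<close> and \<open>j \<in> I\<close> matter.
\<close>

definition rat_kernel :: "nat \<Rightarrow> 'i set \<Rightarrow> (nat \<Rightarrow> 'i \<Rightarrow> int) \<Rightarrow> ('i \<Rightarrow> rat) set" where
  "rat_kernel k I B = {x \<in> rat_vectors I. \<forall>i<k. (\<Sum>j\<in>I. of_int (B i j) * x j) = 0}"

definition mat_rank :: "nat \<Rightarrow> 'i set \<Rightarrow> (nat \<Rightarrow> 'i \<Rightarrow> int) \<Rightarrow> nat" where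
  "mat_rank k I B = rat_fun.dim ((\<lambda>i j. if j \<in> I then of_int (B i j) else 0) ` {..<k})"

definition assoc_rows :: "('c \<Rightarrow> int) \<Rightarrow> 'a hypergraph \<Rightarrow> ('a \<Rightarrow> 'c) \<Rightarrow> nat" where
  "assoc_rows \<theta> H \<sigma> = card (edges H) - assoc_dim \<theta> H \<sigma>"

definition associated_matrix ::
    "('c \<Rightarrow> int) \<Rightarrow> 'a hypergraph \<Rightarrow> ('a \<Rightarrow> 'c) \<Rightarrow> (nat \<Rightarrow> 'a set \<Rightarrow> int) \<Rightarrow> bool" where
  "associated_matrix \<theta> H \<sigma> B \<longleftrightarrow>
     mat_rank (assoc_rows \<theta> H \<sigma>) (edges H) B = assoc_rows \<theta> H \<sigma> \<and>
     rat_kernel (assoc_rows \<theta> H \<sigma>) (edges H) B = assoc_space \<theta> H \<sigma>"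

text \<open>The prime field of order \<open>p\<close> is represented by the residues \<open>{0..<int p}\<close>.\<close>

definition mod_solutions ::
    "nat \<Rightarrow> nat \<Rightarrow> 'i set \<Rightarrow> (nat \<Rightarrow> 'i \<Rightarrow> int) \<Rightarrow> int set \<Rightarrow> ('i \<Rightarrow> int) set" where
  "mod_solutions p k I B A =
     {x \<in> I \<rightarrow>\<^sub>E A. \<forall>i<k. (\<Sum>j\<in>I. (B i j mod int p) * x j) mod int p = 0}"

definition int_solutions ::
    "nat \<Rightarrow> 'i set \<Rightarrow> (nat \<Rightarrow> 'i \<Rightarrow> int) \<Rightarrow> int set \<Rightarrow> ('i \<Rightarrow> int) set" where
  "int_solutions k I B A = {x \<in> I \<rightarrow>\<^sub>E A. \<forall>i<k. (\<Sum>j\<in>I. B i j * x j) = 0}"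

definition proper_solution :: "'i set \<Rightarrow> ('i \<Rightarrow> int) \<Rightarrow> bool" where
  "proper_solution I x \<longleftrightarrow> inj_on x I"

end

theory Submission
  imports Defs "HOL-Computational_Algebra.Polynomial" "HOL-Number_Theory.Cong"
begin

text \<open>
The argument has two halves: choosing the member of the family, and reading its associated
system off a host built from polynomials.

\<^bold>\<open>Choosing the member.\<close> Suppose that no small coloured graph \<open>(H, \<sigma>)\<close> obtained from the family, small
meaning at most \<open>2 r (C + 1)\<close> vertices, is abundant. Up to isomorphism there are finitely many of them,
and each has a uniformly far host in which its homomorphism density is below any prescribed power
of the farness parameter of that host. Fibre products over \<open>F\<close> multiply farness parameters and
homomorphism densities. Hence suitable powers of these hosts have comparable parameters
(\<open>ex_power_between\<close>), and one product is bad for all small \<open>H\<close> at once (\<open>simultaneously_bad_host\<close>).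
Large \<open>H\<close> are handled by one more factor, a sparse host in which each edge that covers a new vertex
of \<open>H\<close> costs a factor of order \<open>\<delta>\<close>, so that the density is at most \<open>(2 \<delta>)\<close> to the power
\<open>v(H) / r > 2 (C + 1)\<close> (\<open>alg_host_sparse\<close>). If \<open>\<delta>\<close> is a large enough power of the other parameters, then
the product is \<open>\<epsilon>\<close>-far with all densities below \<open>c (\<epsilon> / f) powr C\<close>, which contradicts the
abundance of the family (\<open>simultaneously_sparse_hosts\<close>). In the uncoloured case a uniformly far host is far, and the
embeddings of \<open>H\<close> are sorted by the colouring that they induce on \<open>H\<close>.

\<^bold>\<open>The associated system.\<close> For a modulus \<open>M\<close> prime to the differences of the \<open>\<theta>\<close>'s and a set
\<open>A\<close> of residues, let the host have the vertices \<open>(a, y)\<close> with \<open>a\<close> a vertex of \<open>F\<close> and \<open>y\<close> a residue,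
and let \<open>{(a, y a) | a \<in> T}\<close> be an edge when the divided difference of \<open>y\<close> at the nodes \<open>\<theta> a\<close>, \<open>a \<in> T\<close>, lies in
\<open>A\<close>. A polynomial of degree less than \<open>r\<close> with leading coefficient in \<open>A\<close> gives a copy of \<open>F\<close>, and it
is determined by its values at any \<open>r\<close> nodes, so these copies are edge-disjoint and the host is uniformly
far (\<open>host_alg_host\<close>). A coloured homomorphism from \<open>H\<close> is exactly a vector \<open>y\<close> with all
coordinates of \<open>D y\<close> in \<open>A\<close>, and then \<open>x = D y\<close> solves \<open>B x = 0\<close> modulo \<open>M\<close>. If \<open>M\<close> is
also prime to a constant that depends on the system (\<open>kernel_mod_free_coordinates\<close>), each solution comes from at
most \<open>M ^ (v - s)\<close> homomorphisms. Only \<open>O(M ^ (v - 1))\<close> of them give a solution with two equal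
coordinates. So abundance of \<open>(H, \<sigma>)\<close> yields many proper solutions (\<open>many_proper_solutions\<close>). A modulus
\<open>M = L N + 1\<close> with \<open>L\<close> large turns solutions modulo \<open>M\<close> with entries in \<open>{1..N}\<close> into integer solutions.

Translation invariance holds because \<open>D\<close> maps the vector of powers \<open>\<theta> ^ (r - 1)\<close> to the all-one
vector. Polynomials of degree less than \<open>r - 1\<close>, taken separately on each component, lie in the
kernel of \<open>D\<close>; this bounds \<open>s\<close> by \<open>v - q (r - 1)\<close> and gives a nonzero row of \<open>B\<close> when \<open>H\<close> has more edges
than that.
\<close>

section \<open>Coloured homomorphisms\<close>

definition coloured_homs ::
    "'a hypergraph \<Rightarrow> ('a \<Rightarrow> 'c) \<Rightarrow> 'b hypergraph \<Rightarrow> ('b \<Rightarrow> 'c) \<Rightarrow> ('a \<Rightarrow> 'b) set" where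
  "coloured_homs H \<sigma> G \<kappa> =
     {\<phi> \<in> extensional (verts H). homomorphism H G \<phi> \<and> (\<forall>v\<in>verts H. \<kappa> (\<phi> v) = \<sigma> v)}"

definition colour_class :: "'b hypergraph \<Rightarrow> ('b \<Rightarrow> 'c) \<Rightarrow> 'c \<Rightarrow> 'b set" where
  "colour_class G \<kappa> x = {w \<in> verts G. \<kappa> w = x}"

text \<open>
The number of colour-preserving maps from the vertices of \<open>H\<close> to those of \<open>G\<close>. It is the normalisation for
which homomorphism densities are exactly multiplicative under fibre products, whatever the sizes of
the colour classes.
\<close>

definition colour_box ::
    "'a hypergraph \<Rightarrow> ('a \<Rightarrow> 'c) \<Rightarrow> 'b hypergraph \<Rightarrow> ('b \<Rightarrow> 'c) \<Rightarrow> real" where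
  "colour_box H \<sigma> G \<kappa> = (\<Prod>v\<in>verts H. real (card (colour_class G \<kappa> (\<sigma> v))))"

lemma r_graph_finite_edges: "r_graph r H \<Longrightarrow> finite (edges H)"
  by (rule finite_subset[of _ "Pow (verts H)"]) (auto simp: r_graph_def)

lemma coloured_homs_subset_PiE:
  "coloured_homs H \<sigma> G \<kappa> \<subseteq> (\<Pi>\<^sub>E v\<in>verts H. colour_class G \<kappa> (\<sigma> v))"
  by (auto simp: coloured_homs_def homomorphism_def colour_class_def PiE_def)

lemma finite_coloured_homs:
  assumes "finite (verts H)" "finite (verts G)"
  shows "finite (coloured_homs H \<sigma> G \<kappa>)"
  by (rule finite_subset[OF coloured_homs_subset_PiE])
     (use assms in \<open>auto intro!: finite_PiE simp: colour_class_def\<close>)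

lemma colour_box_nonneg: "colour_box H \<sigma> G \<kappa> \<ge> 0"
  by (auto simp: colour_box_def intro!: prod_nonneg)

lemma card_coloured_homs_le_box:
  assumes "finite (verts H)" "finite (verts G)"
  shows "real (card (coloured_homs H \<sigma> G \<kappa>)) \<le> colour_box H \<sigma> G \<kappa>"
proof -
  have "card (coloured_homs H \<sigma> G \<kappa>) \<le> card (\<Pi>\<^sub>E v\<in>verts H. colour_class G \<kappa> (\<sigma> v))"
    by (rule card_mono[OF _ coloured_homs_subset_PiE])
       (use assms in \<open>auto intro!: finite_PiE simp: colour_class_def\<close>)
  also have "\<dots> = (\<Prod>v\<in>verts H. card (colour_class G \<kappa> (\<sigma> v)))"
    using assms by (simp add: card_PiE)
  finally show ?thesis unfolding colour_box_def by (metis of_nat_le_iff of_nat_prod)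
qed

lemma colour_box_le_power:
  assumes "finite (verts G)"
  shows "colour_box H \<sigma> G \<kappa> \<le> real (card (verts G)) ^ card (verts H)"
proof -
  have "colour_box H \<sigma> G \<kappa> \<le> (\<Prod>v\<in>verts H. real (card (verts G)))"
    unfolding colour_box_def
    by (rule prod_mono) (auto intro!: card_mono assms simp: colour_class_def)
  thus ?thesis by simp
qed

lemma coloured_embeddings_subset_homs: "coloured_embeddings H \<sigma> G \<kappa> \<subseteq> coloured_homs H \<sigma> G \<kappa>"
  by (auto simp: coloured_embeddings_def coloured_homs_def embeddings_def)

text \<open>
Composition with an injective colour-preserving homomorphism of hosts is injective on homomorphisms.
\<close>

lemma card_coloured_homs_target:
  assumes "r_graph r H" "finite (verts G)" "homomorphism G' G h" "inj_on h (verts G')"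
    and col: "\<And>w. w \<in> verts G' \<Longrightarrow> \<kappa> (h w) = \<kappa>' w"
  shows "card (coloured_homs H \<sigma> G' \<kappa>') \<le> card (coloured_homs H \<sigma> G \<kappa>)"
proof (rule card_inj_on_le[where f = "\<lambda>\<phi>. restrict (h \<circ> \<phi>) (verts H)"])
  have sub: "e \<subseteq> verts H" if "e \<in> edges H" for e using that assms(1) by (auto simp: r_graph_def)
  show "finite (coloured_homs H \<sigma> G \<kappa>)"
    using assms by (auto simp: r_graph_def intro!: finite_coloured_homs)
  show "inj_on (\<lambda>\<phi>. restrict (h \<circ> \<phi>) (verts H)) (coloured_homs H \<sigma> G' \<kappa>')"
  proof (rule inj_onI)
    fix \<phi> \<psi> assume a: "\<phi> \<in> coloured_homs H \<sigma> G' \<kappa>'" "\<psi> \<in> coloured_homs H \<sigma> G' \<kappa>'"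
      and eq: "restrict (h \<circ> \<phi>) (verts H) = restrict (h \<circ> \<psi>) (verts H)"
    have "\<phi> v = \<psi> v" if v: "v \<in> verts H" for v
    proof -
      have "h (\<phi> v) = h (\<psi> v)" using fun_cong[OF eq, of v] v by simp
      moreover have "\<phi> v \<in> verts G'" "\<psi> v \<in> verts G'"
        using a v by (auto simp: coloured_homs_def homomorphism_def)
      ultimately show ?thesis using assms(4) by (auto dest: inj_onD)
    qed
    thus "\<phi> = \<psi>" using a by (auto simp: coloured_homs_def intro: extensionalityI)
  qed
  show "(\<lambda>\<phi>. restrict (h \<circ> \<phi>) (verts H)) ` coloured_homs H \<sigma> G' \<kappa>' \<subseteq> coloured_homs H \<sigma> G \<kappa>"
  proof safe
    fix \<phi> assume a: "\<phi> \<in> coloured_homs H \<sigma> G' \<kappa>'"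
    have "restrict (h \<circ> \<phi>) (verts H) ` e = h ` (\<phi> ` e)" if "e \<in> edges H" for e
      using sub[OF that] by (auto simp: image_iff)
    moreover have "\<kappa> (h (\<phi> v)) = \<sigma> v" "h (\<phi> v) \<in> verts G" if "v \<in> verts H" for v
      using a assms(3) col[of "\<phi> v"] that by (auto simp: coloured_homs_def homomorphism_def Pi_iff)
    ultimately show "restrict (h \<circ> \<phi>) (verts H) \<in> coloured_homs H \<sigma> G \<kappa>"
      using a assms(3) by (auto simp: coloured_homs_def homomorphism_def)
  qed
qed

text \<open>
Precomposition with a bijective homomorphism \<open>H' \<rightarrow> H\<close> transfers counts between isomorphic coloured graphs.
\<close>

lemma card_coloured_homs_source:
  assumes "r_graph r H'" "finite (verts G)" "bij_betw h (verts H') (verts H)" "homomorphism H' H h"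
    and col: "\<And>v. v \<in> verts H' \<Longrightarrow> \<sigma> (h v) = \<sigma>' v"
  shows "card (coloured_homs H \<sigma> G \<kappa>) \<le> card (coloured_homs H' \<sigma>' G \<kappa>)"
    and "colour_box H \<sigma> G \<kappa> = colour_box H' \<sigma>' G \<kappa>"
proof -
  have sub: "e \<subseteq> verts H'" if "e \<in> edges H'" for e using that assms(1) by (auto simp: r_graph_def)
  have him: "h ` verts H' = verts H" using assms(3) by (auto simp: bij_betw_def)
  show "card (coloured_homs H \<sigma> G \<kappa>) \<le> card (coloured_homs H' \<sigma>' G \<kappa>)"
  proof (rule card_inj_on_le[where f = "\<lambda>\<phi>. restrict (\<phi> \<circ> h) (verts H')"])
    show "finite (coloured_homs H' \<sigma>' G \<kappa>)"
      using assms by (auto simp: r_graph_def intro!: finite_coloured_homs)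
    show "inj_on (\<lambda>\<phi>. restrict (\<phi> \<circ> h) (verts H')) (coloured_homs H \<sigma> G \<kappa>)"
    proof (rule inj_onI)
      fix \<phi> \<psi> assume a: "\<phi> \<in> coloured_homs H \<sigma> G \<kappa>" "\<psi> \<in> coloured_homs H \<sigma> G \<kappa>"
        and eq: "restrict (\<phi> \<circ> h) (verts H') = restrict (\<psi> \<circ> h) (verts H')"
      have "\<phi> (h v) = \<psi> (h v)" if "v \<in> verts H'" for v using fun_cong[OF eq, of v] that by simp
      hence "\<forall>v\<in>h ` verts H'. \<phi> v = \<psi> v" by blast
      hence "\<phi> v = \<psi> v" if "v \<in> verts H" for v using that by (simp add: him)
      thus "\<phi> = \<psi>" using a by (auto simp: coloured_homs_def intro: extensionalityI)
    qed
    show "(\<lambda>\<phi>. restrict (\<phi> \<circ> h) (verts H')) ` coloured_homs H \<sigma> G \<kappa> \<subseteq> coloured_homs H' \<sigma>' G \<kappa>"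
    proof safe
      fix \<phi> assume a: "\<phi> \<in> coloured_homs H \<sigma> G \<kappa>"
      have "restrict (\<phi> \<circ> h) (verts H') ` e = \<phi> ` (h ` e)" if "e \<in> edges H'" for e
        using sub[OF that] by (auto simp: image_iff)
      moreover have "\<kappa> (\<phi> (h v)) = \<sigma>' v" "\<phi> (h v) \<in> verts G" if "v \<in> verts H'" for v
        using a assms(4) col[of v] that by (auto simp: coloured_homs_def homomorphism_def Pi_iff)
      ultimately show "restrict (\<phi> \<circ> h) (verts H') \<in> coloured_homs H' \<sigma>' G \<kappa>"
        using a assms(4) by (auto simp: coloured_homs_def homomorphism_def)
    qed
  qed
  show "colour_box H \<sigma> G \<kappa> = colour_box H' \<sigma>' G \<kappa>"
    unfolding colour_box_def
    by (subst prod.reindex_bij_betw[OF assms(3), symmetric]) (auto simp: col)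
qed

text \<open>
The form in which edge-disjointness of a family of copies is used: a common edge identifies two copies.
\<close>

lemma copies_sharing_edge_eq:
  assumes "disjoint_family_on (\<lambda>\<psi>. (`) \<psi> ` E) \<C>" "\<phi> \<in> \<C>" "\<psi> \<in> \<C>"
    "S \<in> E" "T \<in> E" "\<phi> ` S = \<psi> ` T"
  shows "\<phi> = \<psi>"
proof (rule ccontr)
  assume "\<phi> \<noteq> \<psi>"
  hence "((`) \<phi> ` E) \<inter> ((`) \<psi> ` E) = {}" using assms(1-3) by (simp add: disjoint_family_on_def)
  moreover have "\<phi> ` S \<in> (`) \<phi> ` E" "\<psi> ` T \<in> (`) \<psi> ` E" using assms(4,5) by blast+
  ultimately show False using assms(6) by auto
qed

section \<open>Uniformly far hosts\<close>

locale pattern =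
  fixes r f :: nat and F :: "nat hypergraph"
  assumes r_ge_2: "r \<ge> 2" and F_graph: "r_graph r F" and verts_F: "verts F = {1..f}"
    and F_nonempty: "edges F \<noteq> {}" and F_no_isolated: "\<not> (\<exists>v. isolated F v)"
begin

lemma edge_F: "T \<in> edges F \<Longrightarrow> T \<subseteq> {1..f} \<and> card T = r \<and> finite T"
  using F_graph by (auto simp: r_graph_def verts_F intro: finite_subset)

lemma r_le_f: "r \<le> f"
proof -
  obtain T where "T \<in> edges F" using F_nonempty by auto
  thus ?thesis using edge_F[of T] card_mono[of "{1..f}" T] by auto
qed

lemma f_pos: "f \<ge> 1" using r_le_f r_ge_2 by simp

lemma colouring_inj_on_edge:
  assumes "r_graph r H" "homomorphism H F \<sigma>" "e \<in> edges H"
  shows "inj_on \<sigma> e" "\<sigma> ` e \<in> edges F" "finite e" "card e = r"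
proof -
  show 1: "\<sigma> ` e \<in> edges F" using assms by (auto simp: homomorphism_def)
  show 3: "finite e" "card e = r" using assms by (auto simp: r_graph_def intro: finite_subset)
  show "inj_on \<sigma> e" using edge_F[OF 1] 3 by (auto intro: eq_card_imp_inj_on)
qed

definition host :: "real \<Rightarrow> 'b hypergraph \<Rightarrow> ('b \<Rightarrow> nat) \<Rightarrow> bool" where
  "host \<epsilon> G \<kappa> \<longleftrightarrow> r_graph r G \<and> homomorphism G F \<kappa> \<and> uniformly_far_from_free r F \<epsilon> G \<kappa>"

lemma host_finite: "host \<epsilon> G \<kappa> \<Longrightarrow> finite (verts G)"
  by (auto simp: host_def r_graph_def)

lemma host_mono:
  assumes "host \<epsilon> G \<kappa>" "\<epsilon>' \<le> \<epsilon>" shows "host \<epsilon>' G \<kappa>"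
proof -
  have *: "\<epsilon>' * real (card (verts G)) ^ (r-1) \<le> \<epsilon> * real (card (verts G)) ^ (r-1)"
    by (rule mult_right_mono) (use assms in auto)
  obtain \<C> where C: "\<C> \<subseteq> embeddings F G" "disjoint_family_on (\<lambda>\<psi>. (`) \<psi> ` edges F) \<C>"
    "\<forall>\<psi>\<in>\<C>. \<forall>v\<in>verts F. \<kappa> (\<psi> v) = v"
    "\<forall>w\<in>verts G. real (card {\<psi> \<in> \<C>. w \<in> \<psi> ` verts F}) \<ge> \<epsilon> * real (card (verts G)) ^ (r - 1)"
    using assms(1) unfolding host_def uniformly_far_from_free_def by (elim exE conjE) (rule that)
  have "\<forall>w\<in>verts G. real (card {\<psi> \<in> \<C>. w \<in> \<psi> ` verts F}) \<ge> \<epsilon>' * real (card (verts G)) ^ (r - 1)"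
    using C(4) order.trans[OF *] by (intro ballI) simp
  thus ?thesis using assms(1) C(1-3) unfolding host_def uniformly_far_from_free_def
    by (intro conjI exI[of _ \<C>]) simp_all
qed

lemma card_verts_host:
  assumes "host \<epsilon> G \<kappa>" shows "card (verts G) = (\<Sum>x\<in>{1..f}. card (colour_class G \<kappa> x))"
proof -
  have "verts G = (\<Union>x\<in>{1..f}. colour_class G \<kappa> x)"
    using assms by (auto simp: host_def homomorphism_def colour_class_def verts_F)
  hence "card (verts G) = card (\<Union>x\<in>{1..f}. colour_class G \<kappa> x)" by simp
  also have "\<dots> = (\<Sum>x\<in>{1..f}. card (colour_class G \<kappa> x))"
    by (rule card_UN_disjoint) (use host_finite[OF assms] in \<open>auto simp: colour_class_def\<close>)
  finally show ?thesis .
qed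

text \<open>
Every vertex lies in many copies and a copy has \<open>f\<close> vertices, so double counting bounds the number of
copies from below.
\<close>

lemma host_copies:
  assumes "host \<epsilon> G \<kappa>"
  shows "\<exists>\<C>. \<C> \<subseteq> embeddings F G \<and> finite \<C> \<and>
    disjoint_family_on (\<lambda>\<psi>. (`) \<psi> ` edges F) \<C> \<and>
    (\<forall>\<psi>\<in>\<C>. \<forall>v\<in>verts F. \<kappa> (\<psi> v) = v) \<and>
    (\<forall>w\<in>verts G. real (card {\<psi> \<in> \<C>. w \<in> \<psi> ` verts F}) \<ge> \<epsilon> * real (card (verts G)) ^ (r - 1)) \<and>
    real f * real (card \<C>) \<ge> \<epsilon> * real (card (verts G)) ^ r"
proof -
  have fin: "finite (verts G)" by (rule host_finite[OF assms])
  obtain \<C> where C: "\<C> \<subseteq> embeddings F G" 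
    "disjoint_family_on (\<lambda>\<psi>. (`) \<psi> ` edges F) \<C>"
    "\<And>\<psi> v. \<psi> \<in> \<C> \<Longrightarrow> v \<in> verts F \<Longrightarrow> \<kappa> (\<psi> v) = v"
    "\<And>w. w \<in> verts G \<Longrightarrow> real (card {\<psi> \<in> \<C>. w \<in> \<psi> ` verts F}) \<ge> \<epsilon> * real (card (verts G)) ^ (r - 1)"
    using assms unfolding host_def uniformly_far_from_free_def by blast
  have "\<C> \<subseteq> (\<Pi>\<^sub>E v\<in>verts F. verts G)"
    using C(1) by (auto simp: embeddings_def homomorphism_def PiE_def)
  hence finC: "finite \<C>" by (rule finite_subset) (auto intro!: finite_PiE fin simp: verts_F)
  have "\<epsilon> * real (card (verts G)) ^ r = (\<Sum>w\<in>verts G. \<epsilon> * real (card (verts G)) ^ (r-1))"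
    using r_ge_2 by (simp add: power_eq_if)
  also have "\<dots> \<le> (\<Sum>w\<in>verts G. real (card {\<psi> \<in> \<C>. w \<in> \<psi> ` verts F}))"
    by (rule sum_mono) (rule C(4))
  also have "\<dots> = real (\<Sum>w\<in>verts G. card {\<psi> \<in> \<C>. w \<in> \<psi> ` verts F})" by simp
  also have "(\<Sum>w\<in>verts G. card {\<psi> \<in> \<C>. w \<in> \<psi> ` verts F}) = (\<Sum>\<psi>\<in>\<C>. card {w \<in> verts G. w \<in> \<psi> ` verts F})"
    using sum.swap_restrict[OF fin finC, of "\<lambda>_ _. 1::nat" "\<lambda>w \<psi>. w \<in> \<psi> ` verts F"] by simp
  also have "\<dots> = (\<Sum>\<psi>\<in>\<C>. f)"
  proof (rule sum.cong[OF refl])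
    fix \<psi> assume p: "\<psi> \<in> \<C>"
    hence "{w \<in> verts G. w \<in> \<psi> ` verts F} = \<psi> ` verts F" "inj_on \<psi> (verts F)"
      using C(1) by (auto simp: embeddings_def homomorphism_def)
    thus "card {w \<in> verts G. w \<in> \<psi> ` verts F} = f" by (simp add: card_image verts_F)
  qed
  finally have "\<epsilon> * real (card (verts G)) ^ r \<le> real f * real (card \<C>)" by (simp add: mult.commute)
  thus ?thesis using C finC by (intro exI[of _ \<C>]) simp
qed

text \<open>
No colour class of a far host is much smaller than the others: a colour \<open>x\<close> lies in an edge of \<open>F\<close>, the
edge-disjoint copies are determined by their images of this edge, and there are at most
\<open>n ^ (r - 1)\<close> such images for each choice of the vertex of colour \<open>x\<close>.
\<close>

lemma colour_class_large:
  assumes "host \<epsilon> G \<kappa>" "x \<in> {1..f}" "verts G \<noteq> {}"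
  shows "real f * real (card (colour_class G \<kappa> x)) \<ge> \<epsilon> * real (card (verts G))"
proof -
  have fin: "finite (verts G)" by (rule host_finite[OF assms(1)])
  obtain \<C> where C: "\<C> \<subseteq> embeddings F G" "finite \<C>"
    "disjoint_family_on (\<lambda>\<psi>. (`) \<psi> ` edges F) \<C>"
    "\<forall>\<psi>\<in>\<C>. \<forall>v\<in>verts F. \<kappa> (\<psi> v) = v"
    "\<forall>w\<in>verts G. real (card {\<psi> \<in> \<C>. w \<in> \<psi> ` verts F}) \<ge> \<epsilon> * real (card (verts G)) ^ (r - 1)"
    "real f * real (card \<C>) \<ge> \<epsilon> * real (card (verts G)) ^ r"
    using host_copies[OF assms(1)] by (elim exE conjE) (rule that)
  obtain T where T: "T \<in> edges F" "x \<in> T"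
    using F_no_isolated assms(2) by (auto simp: isolated_def verts_F)
  note eT = edge_F[OF T(1)]
  have "card \<C> \<le> card (\<Pi>\<^sub>E z\<in>T. if z = x then colour_class G \<kappa> x else verts G)"
  proof (rule card_inj_on_le[where f = "\<lambda>\<psi>. restrict \<psi> T"])
    show "finite (\<Pi>\<^sub>E z\<in>T. if z = x then colour_class G \<kappa> x else verts G)"
      using fin eT by (auto intro!: finite_PiE simp: colour_class_def)
    show "(\<lambda>\<psi>. restrict \<psi> T) ` \<C> \<subseteq> (\<Pi>\<^sub>E z\<in>T. if z = x then colour_class G \<kappa> x else verts G)"
    proof (rule image_subsetI)
      fix \<psi> assume p: "\<psi> \<in> \<C>"
      have "\<psi> \<in> verts F \<rightarrow> verts G" using C(1) p by (auto simp: embeddings_def homomorphism_def)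
      hence "\<psi> z \<in> verts G" "\<kappa> (\<psi> z) = z" if "z \<in> T" for z
        using C(4) p that eT by (auto simp: verts_F)
      thus "restrict \<psi> T \<in> (\<Pi>\<^sub>E z\<in>T. if z = x then colour_class G \<kappa> x else verts G)"
        by (auto simp: colour_class_def)
    qed
    show "inj_on (\<lambda>\<psi>. restrict \<psi> T) \<C>"
    proof (rule inj_onI)
      fix \<phi> \<psi> assume a: "\<phi> \<in> \<C>" "\<psi> \<in> \<C>" "restrict \<phi> T = restrict \<psi> T"
      have "\<phi> ` T = \<psi> ` T" using arg_cong[OF a(3), of "\<lambda>g. g ` T"] by simp
      thus "\<phi> = \<psi>" using copies_sharing_edge_eq[OF C(3) a(1,2) T(1) T(1)] by simp
    qed
  qed
  also have "\<dots> = (\<Prod>z\<in>T. card (if z = x then colour_class G \<kappa> x else verts G))"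
    using eT by (simp add: card_PiE)
  also have "\<dots> = card (colour_class G \<kappa> x) * (\<Prod>z\<in>T-{x}. card (if z = x then colour_class G \<kappa> x else verts G))"
    using eT T by (simp add: prod.remove[of T x])
  also have "(\<Prod>z\<in>T-{x}. card (if z = x then colour_class G \<kappa> x else verts G)) = (\<Prod>z\<in>T-{x}. card (verts G))"
    by (rule prod.cong) auto
  also have "\<dots> = card (verts G) ^ (r-1)" using eT T by (simp add: card_Diff_singleton)
  finally have "real (card \<C>) \<le> real (card (colour_class G \<kappa> x)) * real (card (verts G)) ^ (r-1)"
    by (metis of_nat_le_iff of_nat_mult of_nat_power)
  hence "real f * real (card \<C>) \<le> real f * (real (card (colour_class G \<kappa> x)) * real (card (verts G)) ^ (r-1))"
    by (intro mult_left_mono) auto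
  hence "\<epsilon> * real (card (verts G)) * real (card (verts G)) ^ (r-1)
     \<le> real f * real (card (colour_class G \<kappa> x)) * real (card (verts G)) ^ (r-1)"
    using C(6) r_ge_2 by (simp add: power_eq_if mult_ac)
  thus ?thesis using assms(3) fin by (subst (asm) mult_le_cancel_right_pos) (auto simp: card_gt_0_iff)
qed

text \<open>
Destroying all copies of \<open>F\<close> requires one deleted edge for each member of the edge-disjoint family.
\<close>

lemma host_far_from_free:
  assumes "host \<epsilon> G \<kappa>"
  shows "far_from_free r F (\<epsilon> / real f) G"
  unfolding far_from_free_def
proof safe
  fix D assume D: "D \<subseteq> edges G" "embeddings F (G\<lparr>edges := edges G - D\<rparr>) = {}"
  obtain \<C> where C: "\<C> \<subseteq> embeddings F G" "finite \<C>"
    "disjoint_family_on (\<lambda>\<psi>. (`) \<psi> ` edges F) \<C>"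
    "\<forall>\<psi>\<in>\<C>. \<forall>v\<in>verts F. \<kappa> (\<psi> v) = v"
    "\<forall>w\<in>verts G. real (card {\<psi> \<in> \<C>. w \<in> \<psi> ` verts F}) \<ge> \<epsilon> * real (card (verts G)) ^ (r - 1)"
    "real f * real (card \<C>) \<ge> \<epsilon> * real (card (verts G)) ^ r"
    using host_copies[OF assms] by (elim exE conjE) (rule that)
  have "\<exists>T\<in>edges F. \<psi> ` T \<in> D" if "\<psi> \<in> \<C>" for \<psi>
  proof (rule ccontr)
    assume "\<not> ?thesis"
    hence "\<psi> \<in> embeddings F (G\<lparr>edges := edges G - D\<rparr>)"
      using C(1) that by (auto simp: embeddings_def homomorphism_def)
    thus False using D(2) by auto
  qed
  then obtain t where t: "\<And>\<psi>. \<psi> \<in> \<C> \<Longrightarrow> t \<psi> \<in> edges F \<and> \<psi> ` t \<psi> \<in> D" by metis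
  have "card \<C> \<le> card D"
  proof (rule card_inj_on_le[where f = "\<lambda>\<psi>. \<psi> ` t \<psi>"])
    show "finite D" using D(1) assms r_graph_finite_edges by (auto simp: host_def intro: finite_subset)
    show "(\<lambda>\<psi>. \<psi> ` t \<psi>) ` \<C> \<subseteq> D" using t by auto
    show "inj_on (\<lambda>\<psi>. \<psi> ` t \<psi>) \<C>"
      proof (rule inj_onI)
      fix \<phi> \<psi> assume a: "\<phi> \<in> \<C>" "\<psi> \<in> \<C>" "\<phi> ` t \<phi> = \<psi> ` t \<psi>"
      thus "\<phi> = \<psi>" using copies_sharing_edge_eq[OF C(3) a(1,2)] t by blast
    qed
  qed
  hence "real f * real (card \<C>) \<le> real f * real (card D)" by (intro mult_left_mono) auto
  hence "\<epsilon> * real (card (verts G)) ^ r \<le> real f * real (card D)" using C(6) by linarith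
  thus "\<epsilon> / real f * real (card (verts G)) ^ r \<le> real (card D)"
    using f_pos by (simp add: field_simps)
qed

text \<open>
Abundance speaks of hosts on the natural numbers; this moves any other host there.
\<close>

lemma host_relabel:
  fixes G :: "'b hypergraph"
  assumes "host \<epsilon> G \<kappa>"
  shows "\<exists>(G' :: nat hypergraph) \<kappa>' h. host \<epsilon> G' \<kappa>' \<and> bij_betw h (verts G') (verts G) \<and>
    homomorphism G' G h \<and> (\<forall>w\<in>verts G'. \<kappa> (h w) = \<kappa>' w)"
proof -
  have fin: "finite (verts G)" by (rule host_finite[OF assms])
  have sub: "e \<subseteq> verts G" if "e \<in> edges G" for e using that assms by (auto simp: host_def r_graph_def)
  obtain g :: "'b \<Rightarrow> nat" where g: "inj_on g (verts G)"
    using fin by (metis finite_imp_inj_to_nat_seg)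
  define h where "h = inv_into (verts G) g"
  define G' where "G' = \<lparr>verts = g ` verts G, edges = (`) g ` edges G\<rparr>"
  define \<kappa>' where "\<kappa>' = \<kappa> \<circ> h"
  have hg: "h (g w) = w" if "w \<in> verts G" for w using g that by (simp add: h_def)
  have hge: "h ` g ` e = e" if "e \<in> edges G" for e
    using sub[OF that] hg by (force simp: image_iff)
  have bij: "bij_betw h (verts G') (verts G)"
    using bij_betw_inv_into[OF inj_on_imp_bij_betw[OF g]] by (simp add: h_def G'_def)
  have hom: "homomorphism G' G h" using hg hge by (auto simp: homomorphism_def G'_def)
  obtain \<C> where C: "\<C> \<subseteq> embeddings F G" "finite \<C>"
    "disjoint_family_on (\<lambda>\<psi>. (`) \<psi> ` edges F) \<C>"
    "\<forall>\<psi>\<in>\<C>. \<forall>v\<in>verts F. \<kappa> (\<psi> v) = v"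
    "\<forall>w\<in>verts G. real (card {\<psi> \<in> \<C>. w \<in> \<psi> ` verts F}) \<ge> \<epsilon> * real (card (verts G)) ^ (r - 1)"
    "real f * real (card \<C>) \<ge> \<epsilon> * real (card (verts G)) ^ r"
    using host_copies[OF assms] by (elim exE conjE) (rule that)
  define R where "R = (\<lambda>\<psi>. restrict (g \<circ> \<psi>) (verts F))"
  have Fsub: "T \<subseteq> verts F" if "T \<in> edges F" for T using edge_F[OF that] by (simp add: verts_F)
  have inG: "\<psi> v \<in> verts G" if "\<psi> \<in> \<C>" "v \<in> verts F" for \<psi> v
    using C(1) that by (auto simp: embeddings_def homomorphism_def)
  have Rim: "R \<psi> ` T = g ` \<psi> ` T" if "T \<subseteq> verts F" for \<psi> T
    using that by (auto simp: R_def image_iff)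
  have hR: "h ` R \<psi> ` T = \<psi> ` T" if "\<psi> \<in> \<C>" "T \<subseteq> verts F" for \<psi> T
    unfolding Rim[OF that(2)] using inG[OF that(1)] that(2) hg by (force simp: image_iff)
  have Rinj: "inj_on R \<C>"
  proof (rule inj_onI)
    fix \<phi> \<psi> assume a: "\<phi> \<in> \<C>" "\<psi> \<in> \<C>" "R \<phi> = R \<psi>"
    have "\<phi> v = \<psi> v" if v: "v \<in> verts F" for v
    proof -
      have "g (\<phi> v) = g (\<psi> v)" using fun_cong[OF a(3), of v] v by (simp add: R_def)
      thus ?thesis using inG a v g by (auto dest: inj_onD)
    qed
    thus "\<phi> = \<psi>" using a C(1) by (auto simp: embeddings_def intro: extensionalityI)
  qed
  have "host \<epsilon> G' \<kappa>'"
    unfolding host_def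
  proof (intro conjI)
    show "r_graph r G'" using assms sub g unfolding host_def r_graph_def G'_def
      by (auto simp: card_image inj_on_subset)
    show "homomorphism G' F \<kappa>'"
    proof -
      have "\<kappa>' ` g ` e = \<kappa> ` e" if "e \<in> edges G" for e
        unfolding \<kappa>'_def image_comp[symmetric] hge[OF that] ..
      thus ?thesis using assms hg by (auto simp: host_def homomorphism_def G'_def \<kappa>'_def)
    qed
    show "uniformly_far_from_free r F \<epsilon> G' \<kappa>'"
      unfolding uniformly_far_from_free_def
    proof (intro exI[of _ "R ` \<C>"] conjI ballI)
      show "R ` \<C> \<subseteq> embeddings F G'"
      proof safe
        fix \<psi> assume p: "\<psi> \<in> \<C>"
        hence e: "\<psi> \<in> embeddings F G" using C(1) by auto
        have "R \<psi> ` T \<in> edges G'" if "T \<in> edges F" for T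
          using Rim[OF Fsub[OF that]] e that by (auto simp: embeddings_def homomorphism_def G'_def)
        moreover have "inj_on (R \<psi>) (verts F)"
        proof (rule inj_onI)
          fix v w assume b: "v \<in> verts F" "w \<in> verts F" "R \<psi> v = R \<psi> w"
          hence "g (\<psi> v) = g (\<psi> w)" by (simp add: R_def)
          hence "\<psi> v = \<psi> w" using inG[OF p] b g by (auto dest: inj_onD)
          thus "v = w" using e b by (auto simp: embeddings_def dest: inj_onD)
        qed
        ultimately show "R \<psi> \<in> embeddings F G'"
          using inG[OF p] by (auto simp: embeddings_def homomorphism_def G'_def R_def)
      qed
      show "disjoint_family_on (\<lambda>\<psi>. (`) \<psi> ` edges F) (R ` \<C>)"
        unfolding disjoint_family_on_def
      proof safe
        fix \<phi> \<psi> S T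
        assume a: "\<phi> \<in> \<C>" "\<psi> \<in> \<C>" "R \<phi> \<noteq> R \<psi>" "S \<in> edges F" "T \<in> edges F" "R \<phi> ` S = R \<psi> ` T"
        have "\<phi> ` S = \<psi> ` T" using hR a Fsub by metis
        hence "\<phi> = \<psi>" using copies_sharing_edge_eq[OF C(3) a(1,2,4,5)] by simp
        thus "R \<phi> ` S \<in> {}" using a by auto
      qed
      show "\<kappa>' (\<psi> v) = v" if "\<psi> \<in> R ` \<C>" "v \<in> verts F" for \<psi> v
        using that C(4) inG hg by (auto simp: R_def \<kappa>'_def)
      show "\<epsilon> * real (card (verts G')) ^ (r - 1) \<le> real (card {\<psi> \<in> R ` \<C>. w \<in> \<psi> ` verts F})"
        if w: "w \<in> verts G'" for w
      proof -
        obtain w' where w': "w' \<in> verts G" "w = g w'" using w by (auto simp: G'_def)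
        have "R ` {\<psi> \<in> \<C>. w' \<in> \<psi> ` verts F} \<subseteq> {\<psi> \<in> R ` \<C>. w \<in> \<psi> ` verts F}"
          using Rim[of "verts F"] w' by auto
        hence "card (R ` {\<psi> \<in> \<C>. w' \<in> \<psi> ` verts F}) \<le> card {\<psi> \<in> R ` \<C>. w \<in> \<psi> ` verts F}"
          using C(2) by (intro card_mono) auto
        moreover have "card (R ` {\<psi> \<in> \<C>. w' \<in> \<psi> ` verts F}) = card {\<psi> \<in> \<C>. w' \<in> \<psi> ` verts F}"
          by (rule card_image) (use Rinj in \<open>auto intro: inj_on_subset\<close>)
        moreover have "card (verts G') = card (verts G)" using g by (simp add: G'_def card_image)
        ultimately show ?thesis using bspec[OF C(5) w'(1)] by simp
      qed
    qed
  qed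
  thus ?thesis using bij hom by (intro exI[of _ G'] exI[of _ \<kappa>'] exI[of _ h]) (simp add: \<kappa>'_def)
qed

end

section \<open>Fibre products of hosts\<close>

text \<open>
A homomorphism that identifies two given vertices is determined by its values off one of them.
\<close>

lemma card_noninjective_homs:
  assumes "finite (verts H)" "finite (verts G)"
  shows "card {\<phi> \<in> coloured_homs H \<sigma> G \<kappa>. \<not> inj_on \<phi> (verts H)}
         \<le> card (verts H) ^ 2 * card (verts G) ^ (card (verts H) - 1)"
proof -
  define V where "V = verts H"
  define P where "P = {(u, w) \<in> V \<times> V. u \<noteq> w}"
  define X where "X = (\<lambda>(u, w). {\<phi> \<in> coloured_homs H \<sigma> G \<kappa>. \<phi> u = \<phi> w})"
  have finH: "finite (coloured_homs H \<sigma> G \<kappa>)" by (rule finite_coloured_homs[OF assms])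
  have finV: "finite V" using assms by (simp add: V_def)
  have finP: "finite P" unfolding P_def by (rule finite_subset[of _ "V \<times> V"]) (use finV in auto)
  have cX: "card (X q) \<le> card (verts G) ^ (card V - 1)" if q0: "q \<in> P" for q
  proof -
    obtain u w where q: "q = (u, w)" "u \<in> V" "w \<in> V" "u \<noteq> w" using q0 by (auto simp: P_def)
    have "card (X q) \<le> card (\<Pi>\<^sub>E v\<in>V - {u}. verts G)"
    proof (rule card_inj_on_le[where f = "\<lambda>\<phi>. restrict \<phi> (V - {u})"])
      show "finite (\<Pi>\<^sub>E v\<in>V - {u}. verts G)" using finV assms by (auto intro!: finite_PiE)
      show "(\<lambda>\<phi>. restrict \<phi> (V - {u})) ` X q \<subseteq> (\<Pi>\<^sub>E v\<in>V - {u}. verts G)"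
      proof (rule image_subsetI)
        fix \<phi> assume "\<phi> \<in> X q"
        hence "\<phi> \<in> V \<rightarrow> verts G" by (simp add: X_def q V_def coloured_homs_def homomorphism_def)
        thus "restrict \<phi> (V - {u}) \<in> (\<Pi>\<^sub>E v\<in>V - {u}. verts G)" by auto
      qed
      show "inj_on (\<lambda>\<phi>. restrict \<phi> (V - {u})) (X q)"
      proof (rule inj_onI)
        fix \<phi> \<psi> assume a: "\<phi> \<in> X q" "\<psi> \<in> X q" "restrict \<phi> (V - {u}) = restrict \<psi> (V - {u})"
        have o: "\<phi> v = \<psi> v" if "v \<in> V" "v \<noteq> u" for v
          using fun_cong[OF a(3), of v] that by simp
        have "\<phi> u = \<psi> u" using a(1,2) o[of w] q by (simp add: X_def)
        hence "\<phi> v = \<psi> v" if "v \<in> V" for v using o that by (cases "v = u") auto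
        thus "\<phi> = \<psi>" using a(1,2) by (auto simp: X_def q V_def coloured_homs_def intro: extensionalityI)
      qed
    qed
    also have "\<dots> = card (verts G) ^ (card V - 1)"
      using finV q by (simp add: card_PiE card_Diff_singleton)
    finally show ?thesis .
  qed
  have "{\<phi> \<in> coloured_homs H \<sigma> G \<kappa>. \<not> inj_on \<phi> (verts H)} \<subseteq> (\<Union>q\<in>P. X q)"
    unfolding inj_on_def by (auto simp: P_def X_def V_def)
  hence "card {\<phi> \<in> coloured_homs H \<sigma> G \<kappa>. \<not> inj_on \<phi> (verts H)} \<le> card (\<Union>q\<in>P. X q)"
    by (rule card_mono[rotated]) (use finP finH in \<open>simp add: X_def split_def\<close>)
  also have "\<dots> \<le> (\<Sum>q\<in>P. card (X q))" by (rule card_UN_le[OF finP])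
  also have "\<dots> \<le> (\<Sum>q\<in>P. card (verts G) ^ (card V - 1))" by (rule sum_mono[OF cX])
  also have "\<dots> = card P * card (verts G) ^ (card V - 1)" by simp
  also have "card P \<le> card (V \<times> V)" by (rule card_mono) (use finV in \<open>auto simp: P_def\<close>)
  hence "card P * card (verts G) ^ (card V - 1) \<le> card V ^ 2 * card (verts G) ^ (card V - 1)"
    by (simp add: power2_eq_square card_cartesian_product)
  finally show ?thesis by (simp add: V_def)
qed

context pattern begin

text \<open>
The size condition keeps the product uniform: a set of more than \<open>r\<close> pairs can still have edges as
both projections.
\<close>

definition fibre_product ::
    "'b hypergraph \<Rightarrow> ('b \<Rightarrow> nat) \<Rightarrow> 'd hypergraph \<Rightarrow> ('d \<Rightarrow> nat) \<Rightarrow> ('b \<times> 'd) hypergraph" where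
  "fibre_product G \<kappa> G' \<kappa>' =
     (let V = {(u, w). u \<in> verts G \<and> w \<in> verts G' \<and> \<kappa> u = \<kappa>' w}
      in \<lparr>verts = V, edges = {e. e \<subseteq> V \<and> card e = r \<and> fst ` e \<in> edges G \<and> snd ` e \<in> edges G'}\<rparr>)"

lemma colour_class_fibre_product:
  "colour_class (fibre_product G \<kappa> G' \<kappa>') (\<kappa> \<circ> fst) x = colour_class G \<kappa> x \<times> colour_class G' \<kappa>' x"
  by (auto simp: colour_class_def fibre_product_def Let_def)

lemma coloured_homs_fibre_product:
  assumes "r_graph r H" "finite (verts G)" "finite (verts G')"
  shows "card (coloured_homs H \<sigma> (fibre_product G \<kappa> G' \<kappa>') (\<kappa> \<circ> fst))
         \<le> card (coloured_homs H \<sigma> G \<kappa>) * card (coloured_homs H \<sigma> G' \<kappa>')"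
proof -
  have sub: "e \<subseteq> verts H" if "e \<in> edges H" for e using that assms(1) by (auto simp: r_graph_def)
  have finH: "finite (verts H)" using assms(1) by (auto simp: r_graph_def)
  let ?h = "\<lambda>\<phi>. (restrict (fst \<circ> \<phi>) (verts H), restrict (snd \<circ> \<phi>) (verts H))"
  let ?P = "coloured_homs H \<sigma> (fibre_product G \<kappa> G' \<kappa>') (\<kappa> \<circ> fst)"
  have "card ?P \<le> card (coloured_homs H \<sigma> G \<kappa> \<times> coloured_homs H \<sigma> G' \<kappa>')"
  proof (rule card_inj_on_le[where f = ?h])
    show "inj_on ?h ?P"
    proof (rule inj_onI)
      fix \<phi> \<psi> assume a: "\<phi> \<in> ?P" "\<psi> \<in> ?P" "?h \<phi> = ?h \<psi>"
      have 1: "restrict (fst \<circ> \<phi>) (verts H) = restrict (fst \<circ> \<psi>) (verts H)"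
        and 2: "restrict (snd \<circ> \<phi>) (verts H) = restrict (snd \<circ> \<psi>) (verts H)" using a(3) by auto
      have "\<phi> v = \<psi> v" if "v \<in> verts H" for v
        using fun_cong[OF 1, of v] fun_cong[OF 2, of v] that by (simp add: prod_eq_iff)
      thus "\<phi> = \<psi>" using a(1,2) by (auto simp: coloured_homs_def intro: extensionalityI)
    qed
    show "finite (coloured_homs H \<sigma> G \<kappa> \<times> coloured_homs H \<sigma> G' \<kappa>')"
      by (intro finite_cartesian_product finite_coloured_homs finH assms)
    show "?h ` ?P \<subseteq> coloured_homs H \<sigma> G \<kappa> \<times> coloured_homs H \<sigma> G' \<kappa>'"
    proof (rule image_subsetI)
      fix \<phi> assume a: "\<phi> \<in> ?P"
      have im: "restrict (fst \<circ> \<phi>) (verts H) ` e = fst ` \<phi> ` e" "restrict (snd \<circ> \<phi>) (verts H) ` e = snd ` \<phi> ` e"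
        if "e \<in> edges H" for e
        using sub[OF that] by (auto simp: image_iff)
      have e: "fst ` \<phi> ` e \<in> edges G" "snd ` \<phi> ` e \<in> edges G'" if "e \<in> edges H" for e
        using a that by (auto simp: coloured_homs_def homomorphism_def fibre_product_def Let_def)
      have v: "fst (\<phi> v) \<in> verts G" "snd (\<phi> v) \<in> verts G'" "\<kappa> (fst (\<phi> v)) = \<sigma> v" "\<kappa>' (snd (\<phi> v)) = \<sigma> v"
        if "v \<in> verts H" for v
      proof -
        have "\<phi> v \<in> verts (fibre_product G \<kappa> G' \<kappa>')" "\<kappa> (fst (\<phi> v)) = \<sigma> v"
          using a that by (auto simp: coloured_homs_def homomorphism_def)
        thus "fst (\<phi> v) \<in> verts G" "snd (\<phi> v) \<in> verts G'" "\<kappa> (fst (\<phi> v)) = \<sigma> v" "\<kappa>' (snd (\<phi> v)) = \<sigma> v"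
          by (auto simp: fibre_product_def Let_def)
      qed
      show "?h \<phi> \<in> coloured_homs H \<sigma> G \<kappa> \<times> coloured_homs H \<sigma> G' \<kappa>'"
        unfolding coloured_homs_def homomorphism_def using im e v by simp
    qed
  qed
  thus ?thesis by (simp add: card_cartesian_product)
qed

text \<open>
A pair of copies of \<open>F\<close> combines to a copy in the product because both preserve colours. Its projections
recover both copies from any single edge, so edge-disjointness survives. The parameters multiply because
the product has at most \<open>card (verts G) * card (verts G')\<close> vertices.
\<close>

lemma host_fibre_product:
  assumes "host \<epsilon> G \<kappa>" "host \<epsilon>' G' \<kappa>'" "\<epsilon> \<ge> 0" "\<epsilon>' \<ge> 0"
  shows "host (\<epsilon> * \<epsilon>') (fibre_product G \<kappa> G' \<kappa>') (\<kappa> \<circ> fst)"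
proof -
  let ?P = "fibre_product G \<kappa> G' \<kappa>'"
  have fin: "finite (verts G)" "finite (verts G')" using assms host_finite by blast+
  have subP: "verts ?P \<subseteq> verts G \<times> verts G'" by (auto simp: fibre_product_def Let_def)
  have finP: "finite (verts ?P)" using fin by (intro finite_subset[OF subP]) auto
  obtain \<C> where C: "\<C> \<subseteq> embeddings F G" "finite \<C>"
    "disjoint_family_on (\<lambda>\<psi>. (`) \<psi> ` edges F) \<C>"
    "\<forall>\<psi>\<in>\<C>. \<forall>v\<in>verts F. \<kappa> (\<psi> v) = v"
    "\<forall>w\<in>verts G. real (card {\<psi> \<in> \<C>. w \<in> \<psi> ` verts F}) \<ge> \<epsilon> * real (card (verts G)) ^ (r - 1)"
    "real f * real (card \<C>) \<ge> \<epsilon> * real (card (verts G)) ^ r"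
    using host_copies[OF assms(1)] by (elim exE conjE) (rule that)
  obtain \<C>' where C': "\<C>' \<subseteq> embeddings F G'" "finite \<C>'"
    "disjoint_family_on (\<lambda>\<psi>. (`) \<psi> ` edges F) \<C>'"
    "\<forall>\<psi>\<in>\<C>'. \<forall>v\<in>verts F. \<kappa>' (\<psi> v) = v"
    "\<forall>w\<in>verts G'. real (card {\<psi> \<in> \<C>'. w \<in> \<psi> ` verts F}) \<ge> \<epsilon>' * real (card (verts G')) ^ (r - 1)"
    "real f * real (card \<C>') \<ge> \<epsilon>' * real (card (verts G')) ^ r"
    using host_copies[OF assms(2)] by (elim exE conjE) (rule that)
  define R where "R = (\<lambda>(\<psi>, \<psi>'). restrict (\<lambda>x. (\<psi> x, \<psi>' x)) (verts F) :: nat \<Rightarrow> 'a \<times> 'b)"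
  have Fsub: "T \<subseteq> verts F" if "T \<in> edges F" for T using edge_F[OF that] by (simp add: verts_F)
  have fstR: "fst ` R (\<psi>, \<psi>') ` T = \<psi> ` T" and sndR: "snd ` R (\<psi>, \<psi>') ` T = \<psi>' ` T"
    if "T \<subseteq> verts F" for \<psi> \<psi>' T
    using that by (force simp: R_def image_iff)+
  have Rinj: "inj_on R (\<C> \<times> \<C>')"
  proof (rule inj_onI)
    fix p q assume a: "p \<in> \<C> \<times> \<C>'" "q \<in> \<C> \<times> \<C>'" "R p = R q"
    obtain p1 p2 q1 q2 where pq: "p = (p1, p2)" "q = (q1, q2)" by (cases p, cases q) auto
    have eq: "p1 x = q1 x \<and> p2 x = q2 x" if "x \<in> verts F" for x
      using fun_cong[OF a(3), of x] that by (simp add: R_def pq)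
    have "p1 = q1"
      by (rule extensionalityI[of _ "verts F"]) (use a(1,2) C(1) eq in \<open>auto simp: embeddings_def pq\<close>)
    moreover have "p2 = q2"
      by (rule extensionalityI[of _ "verts F"]) (use a(1,2) C'(1) eq in \<open>auto simp: embeddings_def pq\<close>)
    ultimately show "p = q" by (simp add: pq)
  qed
  have inG: "\<psi> v \<in> verts G" if "\<psi> \<in> \<C>" "v \<in> verts F" for \<psi> v
    using C(1) that by (auto simp: embeddings_def homomorphism_def)
  have inG': "\<psi> v \<in> verts G'" if "\<psi> \<in> \<C>'" "v \<in> verts F" for \<psi> v
    using C'(1) that by (auto simp: embeddings_def homomorphism_def)
  have inP: "R (\<psi>, \<psi>') v \<in> verts ?P" if "\<psi> \<in> \<C>" "\<psi>' \<in> \<C>'" "v \<in> verts F" for \<psi> \<psi>' v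
    using inG[OF that(1,3)] inG'[OF that(2,3)] C(4) C'(4) that by (simp add: R_def fibre_product_def Let_def)
  show ?thesis unfolding host_def
  proof (intro conjI)
    show "r_graph r ?P" using finP by (auto simp: r_graph_def fibre_product_def Let_def)
    have h: "\<kappa> \<in> verts G \<rightarrow> verts F" "\<forall>e\<in>edges G. \<kappa> ` e \<in> edges F"
      using assms(1) by (auto simp: host_def homomorphism_def)
    show "homomorphism ?P F (\<kappa> \<circ> fst)"
    proof -
      have "\<kappa> (fst p) \<in> verts F" if "p \<in> verts ?P" for p
        using subP that Pi_mem[OF h(1), of "fst p"] by auto
      moreover have "\<kappa> ` fst ` e \<in> edges F" if "e \<in> edges ?P" for e
        using that h(2) by (simp add: fibre_product_def Let_def)
      ultimately show ?thesis by (simp add: homomorphism_def image_comp)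
    qed
    show "uniformly_far_from_free r F (\<epsilon> * \<epsilon>') ?P (\<kappa> \<circ> fst)"
      unfolding uniformly_far_from_free_def
    proof (intro exI[of _ "R ` (\<C> \<times> \<C>')"] conjI ballI)
      show "R ` (\<C> \<times> \<C>') \<subseteq> embeddings F ?P"
      proof (rule image_subsetI)
        fix p assume "p \<in> \<C> \<times> \<C>'"
        then obtain \<psi> \<psi>' where p: "p = (\<psi>, \<psi>')" "\<psi> \<in> \<C>" "\<psi>' \<in> \<C>'" by auto
        have e: "\<psi> \<in> embeddings F G" "\<psi>' \<in> embeddings F G'" using C(1) C'(1) p by auto
        have inj: "inj_on (R p) (verts F)"
          using e by (auto simp: embeddings_def p R_def inj_on_def)
        have "R p ` T \<in> edges ?P" if "T \<in> edges F" for T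
        proof -
          have "R p ` T \<subseteq> verts ?P" using inP[OF p(2,3)] Fsub[OF that] p by auto
          moreover have "card (R p ` T) = r"
            using card_image[OF inj_on_subset[OF inj Fsub[OF that]]] edge_F[OF that] by simp
          moreover have "fst ` R p ` T \<in> edges G" "snd ` R p ` T \<in> edges G'"
            unfolding p fstR[OF Fsub[OF that]] sndR[OF Fsub[OF that]]
            using e that by (auto simp: embeddings_def homomorphism_def)
          ultimately show ?thesis by (simp add: fibre_product_def Let_def)
        qed
        moreover have "R p \<in> verts F \<rightarrow> verts ?P" using inP[OF p(2,3)] p by auto
        moreover have "R p \<in> extensional (verts F)" by (simp add: R_def p)
        ultimately show "R p \<in> embeddings F ?P"
          using inj by (simp add: embeddings_def homomorphism_def)
      qed
      show "disjoint_family_on (\<lambda>\<psi>. (`) \<psi> ` edges F) (R ` (\<C> \<times> \<C>'))"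
      proof (unfold disjoint_family_on_def, intro ballI impI)
        fix P Q assume a: "P \<in> R ` (\<C> \<times> \<C>')" "Q \<in> R ` (\<C> \<times> \<C>')" "P \<noteq> Q"
        obtain p1 p2 q1 q2 where pq: "P = R (p1, p2)" "p1 \<in> \<C>" "p2 \<in> \<C>'"
          "Q = R (q1, q2)" "q1 \<in> \<C>" "q2 \<in> \<C>'" using a(1,2) by auto
        have False if st: "S \<in> edges F" "T \<in> edges F" "P ` S = Q ` T" for S T
        proof -
          have "fst ` P ` S = fst ` Q ` T" "snd ` P ` S = snd ` Q ` T" using st(3) by simp_all
          hence "p1 ` S = q1 ` T" "p2 ` S = q2 ` T"
            unfolding pq fstR[OF Fsub[OF st(1)]] fstR[OF Fsub[OF st(2)]]
              sndR[OF Fsub[OF st(1)]] sndR[OF Fsub[OF st(2)]] .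
          hence "p1 = q1" "p2 = q2"
            using copies_sharing_edge_eq[OF C(3) pq(2,5) st(1,2)]
              copies_sharing_edge_eq[OF C'(3) pq(3,6) st(1,2)] by auto
          thus False using a(3) pq by simp
        qed
        thus "(`) P ` edges F \<inter> (`) Q ` edges F = {}" by blast
      qed
      show "(\<kappa> \<circ> fst) (\<psi> v) = v" if "\<psi> \<in> R ` (\<C> \<times> \<C>')" "v \<in> verts F" for \<psi> v
        using that C(4) by (auto simp: R_def)
      show "\<epsilon> * \<epsilon>' * real (card (verts ?P)) ^ (r - 1)
            \<le> real (card {\<psi> \<in> R ` (\<C> \<times> \<C>'). p \<in> \<psi> ` verts F})" if p: "p \<in> verts ?P" for p
      proof -
        obtain w w' where w: "p = (w, w')" "w \<in> verts G" "w' \<in> verts G'" "\<kappa> w = \<kappa>' w'"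
          using p by (auto simp: fibre_product_def Let_def)
        let ?A = "{\<psi> \<in> \<C>. w \<in> \<psi> ` verts F}" and ?B = "{\<psi> \<in> \<C>'. w' \<in> \<psi> ` verts F}"
        have "R ` (?A \<times> ?B) \<subseteq> {\<psi> \<in> R ` (\<C> \<times> \<C>'). p \<in> \<psi> ` verts F}"
        proof (rule image_subsetI)
          fix q assume "q \<in> ?A \<times> ?B"
          then obtain \<psi> \<psi>' x x' where q: "q = (\<psi>, \<psi>')" "\<psi> \<in> \<C>" "\<psi>' \<in> \<C>'"
            "x \<in> verts F" "w = \<psi> x" "x' \<in> verts F" "w' = \<psi>' x'" by auto
          have "x = x'" using C(4) C'(4) q w(4) by simp
          hence "p = R q x" using q w(1) by (simp add: R_def)
          thus "R q \<in> {\<psi> \<in> R ` (\<C> \<times> \<C>'). p \<in> \<psi> ` verts F}" using q by auto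
        qed
        hence "card (R ` (?A \<times> ?B)) \<le> card {\<psi> \<in> R ` (\<C> \<times> \<C>'). p \<in> \<psi> ` verts F}"
          using C(2) C'(2) by (intro card_mono) auto
        moreover have "card (R ` (?A \<times> ?B)) = card ?A * card ?B"
          by (subst card_image[OF inj_on_subset[OF Rinj]]) (auto simp: card_cartesian_product)
        ultimately have le: "real (card ?A) * real (card ?B) \<le> real (card {\<psi> \<in> R ` (\<C> \<times> \<C>'). p \<in> \<psi> ` verts F})"
          unfolding of_nat_mult[symmetric] by (simp only: of_nat_le_iff)
        have "card (verts ?P) \<le> card (verts G) * card (verts G')"
          using card_mono[OF _ subP] fin by (simp add: card_cartesian_product)
        hence "real (card (verts ?P)) ^ (r-1) \<le> (real (card (verts G)) * real (card (verts G'))) ^ (r-1)"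
          unfolding of_nat_mult[symmetric] by (intro power_mono of_nat_mono) simp_all
        hence "\<epsilon> * \<epsilon>' * real (card (verts ?P)) ^ (r-1)
          \<le> \<epsilon> * \<epsilon>' * (real (card (verts G)) * real (card (verts G'))) ^ (r-1)"
          using assms(3,4) by (intro mult_left_mono) auto
        also have "\<dots> = (\<epsilon> * real (card (verts G)) ^ (r-1)) * (\<epsilon>' * real (card (verts G')) ^ (r-1))"
          by (simp add: power_mult_distrib mult_ac)
        also have "\<dots> \<le> real (card ?A) * real (card ?B)"
          using C(5) C'(5) w assms(3,4) by (intro mult_mono) auto
        finally show ?thesis using le by linarith
      qed
    qed
  qed
qed

lemma card_colour_class_bij:
  assumes "bij_betw h (verts G') (verts G)" "\<And>w. w \<in> verts G' \<Longrightarrow> \<kappa> (h w) = \<kappa>' w"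
  shows "card (colour_class G' \<kappa>' x) = card (colour_class G \<kappa> x)"
proof (rule bij_betw_same_card[of h])
  show "bij_betw h (colour_class G' \<kappa>' x) (colour_class G \<kappa> x)"
  proof (rule bij_betw_imageI)
    show "inj_on h (colour_class G' \<kappa>' x)"
      by (rule inj_on_subset[OF bij_betw_imp_inj_on[OF assms(1)]]) (auto simp: colour_class_def)
    show "h ` colour_class G' \<kappa>' x = colour_class G \<kappa> x"
      unfolding colour_class_def bij_betw_imp_surj_on[OF assms(1), symmetric] using assms(2) by force
  qed
qed

lemma ex_product_host:
  fixes G1 G2 :: "nat hypergraph"
  assumes "host \<epsilon> G1 \<kappa>1" "host \<epsilon>' G2 \<kappa>2" "\<epsilon> \<ge> 0" "\<epsilon>' \<ge> 0"
  shows "\<exists>(G :: nat hypergraph) \<kappa>. host (\<epsilon> * \<epsilon>') G \<kappa> \<and>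
    (\<forall>x. card (colour_class G \<kappa> x) = card (colour_class G1 \<kappa>1 x) * card (colour_class G2 \<kappa>2 x)) \<and>
    (\<forall>(H :: 'a hypergraph) \<sigma>. r_graph r H \<longrightarrow> card (coloured_homs H \<sigma> G \<kappa>)
        \<le> card (coloured_homs H \<sigma> G1 \<kappa>1) * card (coloured_homs H \<sigma> G2 \<kappa>2))"
proof -
  let ?P = "fibre_product G1 \<kappa>1 G2 \<kappa>2"
  note hP = host_fibre_product[OF assms]
  obtain G' :: "nat hypergraph" and \<kappa>' h where G': "host (\<epsilon> * \<epsilon>') G' \<kappa>'" "bij_betw h (verts G') (verts ?P)"
    "homomorphism G' ?P h" and col: "\<forall>w\<in>verts G'. (\<kappa>1 \<circ> fst) (h w) = \<kappa>' w"
    using host_relabel[OF hP] by (elim exE conjE) (rule that)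
  note col' = bspec[OF col]
  have "card (colour_class G' \<kappa>' x) = card (colour_class G1 \<kappa>1 x) * card (colour_class G2 \<kappa>2 x)" for x
    using card_colour_class_bij[OF G'(2), where \<kappa> = "\<kappa>1 \<circ> fst" and \<kappa>' = \<kappa>', OF col'] by (simp add: colour_class_fibre_product card_cartesian_product)
  moreover have "card (coloured_homs H \<sigma> G' \<kappa>')
        \<le> card (coloured_homs H \<sigma> G1 \<kappa>1) * card (coloured_homs H \<sigma> G2 \<kappa>2)"
    if "r_graph r H" for H :: "'a hypergraph" and \<sigma>
  proof -
    have "card (coloured_homs H \<sigma> G' \<kappa>') \<le> card (coloured_homs H \<sigma> ?P (\<kappa>1 \<circ> fst))"
      by (rule card_coloured_homs_target[OF that host_finite[OF hP] G'(3) bij_betw_imp_inj_on[OF G'(2)]])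
        (rule col')
    also have "\<dots> \<le> card (coloured_homs H \<sigma> G1 \<kappa>1) * card (coloured_homs H \<sigma> G2 \<kappa>2)"
      by (rule coloured_homs_fibre_product[OF that]) (use assms host_finite in blast)+
    finally show ?thesis .
  qed
  ultimately show ?thesis using G'(1) by blast
qed

lemma ex_power_host:
  fixes G :: "nat hypergraph"
  assumes "host \<epsilon> G \<kappa>" "\<epsilon> \<ge> 0"
  shows "\<exists>(P :: nat hypergraph) \<kappa>'. host (\<epsilon> ^ Suc k) P \<kappa>' \<and>
    (\<forall>x. card (colour_class P \<kappa>' x) = card (colour_class G \<kappa> x) ^ Suc k) \<and>
    (\<forall>(H :: 'a hypergraph) \<sigma>. r_graph r H \<longrightarrow> card (coloured_homs H \<sigma> P \<kappa>')
        \<le> card (coloured_homs H \<sigma> G \<kappa>) ^ Suc k)"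
proof (induction k)
  case 0
  show ?case by (rule exI[of _ G], rule exI[of _ \<kappa>]) (use assms in simp)
next
  case (Suc k)
  then obtain P :: "nat hypergraph" and \<kappa>' where P: "host (\<epsilon> ^ Suc k) P \<kappa>'"
    "\<And>x. card (colour_class P \<kappa>' x) = card (colour_class G \<kappa> x) ^ Suc k"
    "\<And>(H :: 'a hypergraph) \<sigma>. r_graph r H \<Longrightarrow> card (coloured_homs H \<sigma> P \<kappa>')
        \<le> card (coloured_homs H \<sigma> G \<kappa>) ^ Suc k" by blast
  obtain Q :: "nat hypergraph" and \<mu> where Q: "host (\<epsilon> * \<epsilon> ^ Suc k) Q \<mu>"
    "\<And>x. card (colour_class Q \<mu> x) = card (colour_class G \<kappa> x) * card (colour_class P \<kappa>' x)"
    "\<And>(H :: 'a hypergraph) \<sigma>. r_graph r H \<Longrightarrow> card (coloured_homs H \<sigma> Q \<mu>)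
        \<le> card (coloured_homs H \<sigma> G \<kappa>) * card (coloured_homs H \<sigma> P \<kappa>')"
    using ex_product_host[OF assms(1) P(1) assms(2), where 'a='a] assms(2) by auto
  have "card (coloured_homs H \<sigma> Q \<mu>) \<le> card (coloured_homs H \<sigma> G \<kappa>) ^ Suc (Suc k)"
    if "r_graph r H" for H :: "'a hypergraph" and \<sigma>
    using order.trans[OF Q(3)[OF that] mult_left_mono[OF P(3)[OF that]]] by simp
  thus ?case using Q(1,2) P(2) by (intro exI[of _ Q] exI[of _ \<mu>]) simp
qed

end

section \<open>Hosts that are bad for non-abundant graphs\<close>

context pattern begin

lemma colour_class_pos:
  assumes "host \<epsilon> G \<kappa>" "\<epsilon> > 0" "verts G \<noteq> {}" "x \<in> {1..f}"
  shows "card (colour_class G \<kappa> x) > 0"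
proof -
  have "0 < \<epsilon> * real (card (verts G))"
    using assms host_finite[OF assms(1)] by (simp add: card_gt_0_iff)
  also have "\<dots> \<le> real f * real (card (colour_class G \<kappa> x))"
    by (rule colour_class_large[OF assms(1,4,3)])
  finally show ?thesis by (auto intro: Nat.gr0I)
qed

text \<open>
Failure of abundance is used with the constants \<open>(1/2) powr C'\<close> and \<open>C'\<close>, so that the first one is absorbed when \<open>\<epsilon>\<close>
is halved. Passing from embeddings to homomorphisms, and from powers of the number of vertices to the box of
colour classes, costs only fixed powers of \<open>\<epsilon>\<close>, which the choice of \<open>C'\<close> pays for.
\<close>

lemma not_abundant_imp_bad_host:
  fixes H :: "'a hypergraph"
  assumes H: "r_graph r H" "homomorphism H F \<sigma>" and na: "\<not> abundant r F H \<sigma>" and D: "D > 0"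
  shows "\<exists>\<epsilon> (G :: nat hypergraph) \<kappa>. 0 < \<epsilon> \<and> \<epsilon> \<le> 1/2 \<and> host \<epsilon> G \<kappa> \<and> verts G \<noteq> {} \<and>
    real (card (coloured_homs H \<sigma> G \<kappa>)) \<le> \<epsilon> powr D * colour_box H \<sigma> G \<kappa>"
proof -
  define v where "v = card (verts H)"
  \<comment> \<open>The summand 1 absorbs a factor 2, and the last one absorbs \<open>(f / \<epsilon>) ^ v\<close>, the loss from passing to colour classes.\<close>
  define C' where "C' = D + 1 + (real f + 1) * real v"
  define c' :: real where "c' = (1/2) powr C'"
  have C': "C' > 0" using D by (simp add: C'_def add_pos_nonneg)
  have finH: "finite (verts H)" using H by (auto simp: r_graph_def)
  have "\<not> abundance_witness r F H \<sigma> c' C'" using na by (auto simp: abundant_def)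
  moreover have "c' > 0" by (simp add: c'_def)
  ultimately obtain \<epsilon>0 where e0: "0 < \<epsilon>0" "\<epsilon>0 \<le> 1" and ex: "\<And>n0. \<exists>(G :: nat hypergraph) \<kappa>.
      host \<epsilon>0 G \<kappa> \<and> card (verts G) \<ge> n0 \<and>
      real (card (coloured_embeddings H \<sigma> G \<kappa>)) < c' * \<epsilon>0 powr C' * real (card (verts G)) ^ v"
    using C' unfolding abundance_witness_def host_def v_def by (auto simp: not_le) blast
  define \<epsilon> where "\<epsilon> = \<epsilon>0 / 2"
  have e: "0 < \<epsilon>" "\<epsilon> \<le> 1/2" "\<epsilon> \<le> \<epsilon>0" using e0 by (auto simp: \<epsilon>_def)
  have ce: "c' * \<epsilon>0 powr C' = \<epsilon> powr C'"
    using e0 powr_mult[of "1/2" \<epsilon>0 C'] by (simp add: c'_def \<epsilon>_def)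
  define n0 where "n0 = max 1 (nat \<lceil>real v ^ 2 / \<epsilon> powr C'\<rceil>)"
  obtain G :: "nat hypergraph" and \<kappa> where G: "host \<epsilon>0 G \<kappa>" "card (verts G) \<ge> n0"
    "real (card (coloured_embeddings H \<sigma> G \<kappa>)) < \<epsilon> powr C' * real (card (verts G)) ^ v"
    using ex[of n0] unfolding ce by blast
  have hG: "host \<epsilon> G \<kappa>" by (rule host_mono[OF G(1) e(3)])
  have finG: "finite (verts G)" by (rule host_finite[OF hG])
  define n where "n = real (card (verts G))"
  have n1: "n \<ge> 1" using G(2) by (simp add: n_def n0_def)
  have nonempty: "verts G \<noteq> {}" using n1 by (auto simp: n_def)
  have "real v ^ 2 / \<epsilon> powr C' \<le> real n0" unfolding n0_def by linarith
  also have "\<dots> \<le> n" using G(2) by (simp add: n_def)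
  finally have nbig: "real v ^ 2 \<le> \<epsilon> powr C' * n" using e by (simp add: field_simps)
  have "coloured_homs H \<sigma> G \<kappa> \<subseteq> coloured_embeddings H \<sigma> G \<kappa> \<union>
          {\<phi> \<in> coloured_homs H \<sigma> G \<kappa>. \<not> inj_on \<phi> (verts H)}"
    by (auto simp: coloured_homs_def coloured_embeddings_def embeddings_def)
  moreover have "finite (coloured_homs H \<sigma> G \<kappa>)" by (rule finite_coloured_homs[OF finH finG])
  ultimately have "card (coloured_homs H \<sigma> G \<kappa>) \<le> card (coloured_embeddings H \<sigma> G \<kappa> \<union>
          {\<phi> \<in> coloured_homs H \<sigma> G \<kappa>. \<not> inj_on \<phi> (verts H)})"
    by (intro card_mono) (auto intro: finite_subset[OF coloured_embeddings_subset_homs])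
  also have "\<dots> \<le> card (coloured_embeddings H \<sigma> G \<kappa>) + card {\<phi> \<in> coloured_homs H \<sigma> G \<kappa>. \<not> inj_on \<phi> (verts H)}"
    by (rule card_Un_le)
  also have "\<dots> \<le> card (coloured_embeddings H \<sigma> G \<kappa>) + v ^ 2 * card (verts G) ^ (v - 1)"
    using card_noninjective_homs[OF finH finG] by (simp add: v_def)
  finally have "real (card (coloured_homs H \<sigma> G \<kappa>))
      \<le> real (card (coloured_embeddings H \<sigma> G \<kappa>) + v ^ 2 * card (verts G) ^ (v - 1))"
    by (rule of_nat_mono)
  also have "\<dots> = real (card (coloured_embeddings H \<sigma> G \<kappa>)) + real v ^ 2 * n ^ (v - 1)"
    by (simp add: n_def)
  also have "real v ^ 2 * n ^ (v - 1) \<le> \<epsilon> powr C' * n ^ v"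
  proof (cases "v = 0")
    case False
    have "real v ^ 2 * n ^ (v - 1) \<le> \<epsilon> powr C' * n * n ^ (v - 1)"
      using nbig n1 by (intro mult_right_mono) auto
    thus ?thesis using False by (simp add: power_eq_if)
  qed simp
  also have "real (card (coloured_embeddings H \<sigma> G \<kappa>)) + \<epsilon> powr C' * n ^ v \<le> 2 * \<epsilon> powr C' * n ^ v"
    using G(3) by (simp add: n_def)
  also have "n ^ v \<le> (real f / \<epsilon>) ^ v * colour_box H \<sigma> G \<kappa>"
  proof -
    have "n ^ v = (\<Prod>u\<in>verts H. n)" by (simp add: v_def)
    also have "\<dots> \<le> (\<Prod>u\<in>verts H. real f / \<epsilon> * real (card (colour_class G \<kappa> (\<sigma> u))))"
    proof (rule prod_mono)
      fix u assume "u \<in> verts H"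
      hence "\<sigma> u \<in> {1..f}" using H(2) by (auto simp: homomorphism_def verts_F)
      from colour_class_large[OF hG this nonempty]
      show "0 \<le> n \<and> n \<le> real f / \<epsilon> * real (card (colour_class G \<kappa> (\<sigma> u)))"
        using e n1 by (simp add: n_def field_simps)
    qed
    also have "\<dots> = (real f / \<epsilon>) ^ v * colour_box H \<sigma> G \<kappa>"
      by (simp only: prod.distrib colour_box_def v_def prod_constant)
    finally show ?thesis .
  qed
  also have "(real f / \<epsilon>) ^ v \<le> (\<epsilon> powr - (real f + 1)) ^ v"
  proof (rule power_mono)
    have "real f \<le> 2 ^ f" using less_exp[of f] by (metis less_imp_le of_nat_le_iff of_nat_numeral of_nat_power)
    also have "\<dots> = 2 powr real f" by (simp add: powr_realpow)
    also have "\<dots> \<le> (1 / \<epsilon>) powr real f" using e by (intro powr_mono2) (auto simp: field_simps)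
    also have "\<dots> = \<epsilon> powr - real f" using e by (simp add: powr_divide powr_minus_divide)
    finally have "real f / \<epsilon> \<le> \<epsilon> powr - real f / \<epsilon>" using e by (intro divide_right_mono) auto
    also have "\<dots> = \<epsilon> powr - (real f + 1)"
      using e powr_diff[of \<epsilon> "- real f" 1] by simp
    finally show "real f / \<epsilon> \<le> \<epsilon> powr - (real f + 1)" .
  qed (use e in auto)
  also have "(\<epsilon> powr - (real f + 1)) ^ v = \<epsilon> powr (- (real f + 1) * real v)"
    using e by (simp add: powr_power mult.commute)
  also have "2 * \<epsilon> powr C' * (\<epsilon> powr (- (real f + 1) * real v) * colour_box H \<sigma> G \<kappa>)
     \<le> \<epsilon> powr -1 * \<epsilon> powr C' * (\<epsilon> powr (- (real f + 1) * real v) * colour_box H \<sigma> G \<kappa>)"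
    using e by (intro mult_right_mono mult_nonneg_nonneg colour_box_nonneg)
      (auto simp: powr_minus_divide field_simps)
  also have "\<dots> = \<epsilon> powr (-1 + C' + (- (real f + 1) * real v)) * colour_box H \<sigma> G \<kappa>"
    by (simp only: powr_add mult.assoc)
  also have "-1 + C' + (- (real f + 1) * real v) = D" by (simp add: C'_def algebra_simps)
  finally have "real (card (coloured_homs H \<sigma> G \<kappa>)) \<le> \<epsilon> powr D * colour_box H \<sigma> G \<kappa>"
    using e by (simp add: colour_box_nonneg mult_left_mono mult_right_mono)
  thus ?thesis using e hG nonempty by blast
qed

text \<open>
A power of \<open>\<epsilon>\<close> lies between \<open>\<eta>\<close> and its square root. This is what makes hosts with unrelated farness
parameters comparable.
\<close>

lemma ex_power_between:
  fixes \<epsilon> \<eta> :: real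
  assumes "0 < \<epsilon>" "\<epsilon> \<le> 1/2" "0 < \<eta>" "\<eta> \<le> \<epsilon>"
  obtains k where "\<eta> \<le> \<epsilon> ^ Suc k" "\<epsilon> ^ Suc k \<le> \<eta> powr (1/2)"
proof -
  \<comment> \<open>The exponent wanted is the last one for which the power of \<open>\<epsilon>\<close> is still at least \<open>\<eta>\<close>.\<close>
  define P where "P = (\<lambda>k. \<epsilon> ^ Suc (Suc k) < \<eta>)"
  obtain m where "\<epsilon> ^ m < \<eta>" using real_arch_pow_inv[of \<eta> \<epsilon>] assms by auto
  moreover have "\<epsilon> ^ Suc (Suc m) \<le> \<epsilon> ^ m" using assms by (intro power_decreasing) auto
  ultimately have Pm: "P m" by (simp add: P_def)
  define k where "k = (LEAST k. P k)"
  have Pk: "P k" unfolding k_def using LeastI[of P m] Pm by simp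
  have 1: "\<eta> \<le> \<epsilon> ^ Suc k"
  proof (cases k)
    case 0
    thus ?thesis using assms by simp
  next
    case (Suc j)
    hence "\<not> P j" using not_less_Least[of j P] by (simp add: k_def)
    thus ?thesis by (simp add: P_def Suc)
  qed
  have "(\<epsilon> ^ Suc k) ^ 2 \<le> \<epsilon> ^ Suc (Suc k)"
    unfolding power_mult[symmetric] using assms by (intro power_decreasing) auto
  also have "\<dots> \<le> \<eta>" using Pk by (simp add: P_def)
  finally have "\<epsilon> ^ Suc k \<le> sqrt \<eta>" by (rule real_le_rsqrt)
  thus ?thesis using that 1 assms by (simp add: powr_half_sqrt)
qed

text \<open>
The host \<open>G\<close> is bad for all members of \<open>J\<close>, while it is not denser than \<open>S\<close> for any coloured graph and has classes at least as large. The
exponent is \<open>D / 2\<close> instead of \<open>D\<close> because bringing the farness parameters to a common value costs a square root.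
\<close>

definition has_bad_extension ::
    "('a hypergraph \<times> ('a \<Rightarrow> nat)) set \<Rightarrow> real \<Rightarrow> real \<Rightarrow> real \<Rightarrow> nat hypergraph \<Rightarrow> (nat \<Rightarrow> nat) \<Rightarrow> bool" where
  "has_bad_extension J D \<eta> \<epsilon> S \<kappa>S \<longleftrightarrow>
    (\<exists>(G :: nat hypergraph) \<kappa>. host (\<eta> ^ card J * \<epsilon>) G \<kappa> \<and>
      (\<forall>x\<in>{1..f}. card (colour_class G \<kappa> x) \<ge> card (colour_class S \<kappa>S x)) \<and>
      (\<forall>(H, \<sigma>)\<in>J. real (card (coloured_homs H \<sigma> G \<kappa>)) \<le> \<eta> powr (D/2) * colour_box H \<sigma> G \<kappa>) \<and>
      (\<forall>(H :: 'a hypergraph) \<sigma> \<tau>. r_graph r H \<longrightarrow> \<tau> \<ge> 0 \<longrightarrow>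
         real (card (coloured_homs H \<sigma> S \<kappa>S)) \<le> \<tau> * colour_box H \<sigma> S \<kappa>S \<longrightarrow>
         real (card (coloured_homs H \<sigma> G \<kappa>)) \<le> \<tau> * colour_box H \<sigma> G \<kappa>))"

text \<open>
Induction over the finite set \<open>J\<close>: the bad host of the new member is raised to the power for which its
parameter is about \<open>\<eta>\<close>, and is multiplied with the host found so far. The other densities do not increase, since
every density is at most 1. The arbitrary initial factor \<open>S\<close> leaves room for the sparse host.
\<close>

lemma simultaneously_bad_host:
  fixes J :: "('a hypergraph \<times> ('a \<Rightarrow> nat)) set"
  assumes "finite J" and D: "D > 0"
    and J: "\<forall>(H, \<sigma>)\<in>J. r_graph r H \<and> homomorphism H F \<sigma> \<and> \<not> abundant r F H \<sigma>"
  shows "\<exists>\<eta>0>0. \<forall>\<eta> S \<kappa>S \<epsilon>S. 0 < \<eta> \<longrightarrow> \<eta> \<le> \<eta>0 \<longrightarrow> host \<epsilon>S S \<kappa>S \<longrightarrow> \<epsilon>S \<ge> 0 \<longrightarrow>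
    has_bad_extension J D \<eta> \<epsilon>S S \<kappa>S"
  using assms(1) J
proof (induction J rule: finite_induct)
  case empty
  show ?case by (intro exI[of _ 1]) (auto simp: has_bad_extension_def)
next
  case (insert j J)
  obtain H\<^sub>j \<sigma>\<^sub>j where j: "j = (H\<^sub>j, \<sigma>\<^sub>j)" by (cases j)
  have Hj: "r_graph r H\<^sub>j" "homomorphism H\<^sub>j F \<sigma>\<^sub>j" "\<not> abundant r F H\<^sub>j \<sigma>\<^sub>j"
    using insert.prems j by auto
  have "\<forall>(H, \<sigma>)\<in>J. r_graph r H \<and> homomorphism H F \<sigma> \<and> \<not> abundant r F H \<sigma>"
    using insert.prems by simp
  from insert.IH[OF this] obtain \<eta>1 where e1: "\<eta>1 > 0" and IH: "\<forall>\<eta> S \<kappa>S \<epsilon>S.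
    0 < \<eta> \<longrightarrow> \<eta> \<le> \<eta>1 \<longrightarrow> host \<epsilon>S S \<kappa>S \<longrightarrow> \<epsilon>S \<ge> 0 \<longrightarrow> has_bad_extension J D \<eta> \<epsilon>S S \<kappa>S"
    by (elim exE conjE) (rule that)
  obtain \<epsilon> and B :: "nat hypergraph" and \<beta> where B: "0 < \<epsilon>" "\<epsilon> \<le> 1/2" "host \<epsilon> B \<beta>" "verts B \<noteq> {}"
    "real (card (coloured_homs H\<^sub>j \<sigma>\<^sub>j B \<beta>)) \<le> \<epsilon> powr D * colour_box H\<^sub>j \<sigma>\<^sub>j B \<beta>"
    using not_abundant_imp_bad_host[OF Hj D] by blast
  show ?case
  proof (intro exI[of _ "min \<eta>1 \<epsilon>"] conjI allI impI)
    show "0 < min \<eta>1 \<epsilon>" using e1 B by simp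
    fix \<eta> \<epsilon>S and S :: "nat hypergraph" and \<kappa>S
    assume \<eta>: "0 < \<eta>" "\<eta> \<le> min \<eta>1 \<epsilon>" and S: "host \<epsilon>S S \<kappa>S" "\<epsilon>S \<ge> 0"
    have "\<eta> \<le> \<eta>1" using \<eta> by simp
    from IH[rule_format, OF \<eta>(1) this S] obtain G :: "nat hypergraph" and \<kappa> where G: "host (\<eta> ^ card J * \<epsilon>S) G \<kappa>"
      "\<And>x. x\<in>{1..f} \<Longrightarrow> card (colour_class G \<kappa> x) \<ge> card (colour_class S \<kappa>S x)"
      "\<And>H \<sigma>. (H, \<sigma>) \<in> J \<Longrightarrow> real (card (coloured_homs H \<sigma> G \<kappa>)) \<le> \<eta> powr (D/2) * colour_box H \<sigma> G \<kappa>"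
      "\<And>(H :: 'a hypergraph) \<sigma> \<tau>. r_graph r H \<Longrightarrow> \<tau> \<ge> 0 \<Longrightarrow>
         real (card (coloured_homs H \<sigma> S \<kappa>S)) \<le> \<tau> * colour_box H \<sigma> S \<kappa>S \<Longrightarrow>
         real (card (coloured_homs H \<sigma> G \<kappa>)) \<le> \<tau> * colour_box H \<sigma> G \<kappa>"
      unfolding has_bad_extension_def by blast
    have "\<eta> \<le> \<epsilon>" using \<eta> by simp
    then obtain k where k: "\<eta> \<le> \<epsilon> ^ Suc k" "\<epsilon> ^ Suc k \<le> \<eta> powr (1/2)"
      using ex_power_between[OF B(1,2) \<eta>(1)] by blast
    obtain P :: "nat hypergraph" and \<pi> where P: "host (\<epsilon> ^ Suc k) P \<pi>"
      "\<And>x. card (colour_class P \<pi> x) = card (colour_class B \<beta> x) ^ Suc k"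
      "\<And>(H :: 'a hypergraph) \<sigma>. r_graph r H \<Longrightarrow> card (coloured_homs H \<sigma> P \<pi>)
        \<le> card (coloured_homs H \<sigma> B \<beta>) ^ Suc k"
      using ex_power_host[OF B(3), where 'a='a and k=k] B(1) by (auto simp del: power_Suc)
    have hP: "host \<eta> P \<pi>" by (rule host_mono[OF P(1) k(1)])
    have nn: "\<eta> \<ge> 0" "\<eta> ^ card J * \<epsilon>S \<ge> 0" using \<eta> S by auto
    obtain Q :: "nat hypergraph" and \<mu> where Q: "host (\<eta> * (\<eta> ^ card J * \<epsilon>S)) Q \<mu>"
      "\<And>x. card (colour_class Q \<mu> x) = card (colour_class P \<pi> x) * card (colour_class G \<kappa> x)"
      "\<And>(H :: 'a hypergraph) \<sigma>. r_graph r H \<Longrightarrow> card (coloured_homs H \<sigma> Q \<mu>)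
        \<le> card (coloured_homs H \<sigma> P \<pi>) * card (coloured_homs H \<sigma> G \<kappa>)"
      using ex_product_host[OF hP G(1) nn, where 'a='a] by blast
    have boxQ: "colour_box H \<sigma> Q \<mu> = colour_box H \<sigma> P \<pi> * colour_box H \<sigma> G \<kappa>" for H :: "'a hypergraph" and \<sigma>
      by (simp add: colour_box_def Q(2) prod.distrib)
    have boxP: "colour_box H \<sigma> P \<pi> = colour_box H \<sigma> B \<beta> ^ Suc k" for H :: "'a hypergraph" and \<sigma>
      unfolding colour_box_def P(2) of_nat_power by (rule prod_power_distrib[symmetric])
    have finP: "finite (verts P)" "finite (verts G)" using hP G(1) host_finite by auto
    have mul: "real (card (coloured_homs H \<sigma> Q \<mu>)) \<le> (a * b) * colour_box H \<sigma> Q \<mu>"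
      if "r_graph r H" "real (card (coloured_homs H \<sigma> P \<pi>)) \<le> a * colour_box H \<sigma> P \<pi>"
        "real (card (coloured_homs H \<sigma> G \<kappa>)) \<le> b * colour_box H \<sigma> G \<kappa>" "a \<ge> 0"
      for H :: "'a hypergraph" and \<sigma> a b
    proof -
      have "real (card (coloured_homs H \<sigma> Q \<mu>)) \<le> real (card (coloured_homs H \<sigma> P \<pi>)) * real (card (coloured_homs H \<sigma> G \<kappa>))"
        using Q(3)[OF that(1)] by (metis of_nat_le_iff of_nat_mult)
      also have "\<dots> \<le> (a * colour_box H \<sigma> P \<pi>) * (b * colour_box H \<sigma> G \<kappa>)"
        using that by (intro mult_mono mult_nonneg_nonneg) (auto simp: colour_box_nonneg)
      finally show ?thesis by (simp add: boxQ mult_ac)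
    qed
    have triv: "real (card (coloured_homs H \<sigma> K \<rho>)) \<le> 1 * colour_box H \<sigma> K \<rho>"
      if "r_graph r H" "finite (verts K)" for H :: "'a hypergraph" and \<sigma> and K :: "nat hypergraph" and \<rho>
      using card_coloured_homs_le_box[of H K \<sigma> \<rho>] that by (auto simp: r_graph_def)
    have new: "real (card (coloured_homs H\<^sub>j \<sigma>\<^sub>j Q \<mu>)) \<le> \<eta> powr (D/2) * colour_box H\<^sub>j \<sigma>\<^sub>j Q \<mu>"
    proof -
      have "real (card (coloured_homs H\<^sub>j \<sigma>\<^sub>j P \<pi>)) \<le> real (card (coloured_homs H\<^sub>j \<sigma>\<^sub>j B \<beta>)) ^ Suc k"
        using P(3)[OF Hj(1)] by (metis of_nat_le_iff of_nat_power)
      also have "\<dots> \<le> (\<epsilon> powr D * colour_box H\<^sub>j \<sigma>\<^sub>j B \<beta>) ^ Suc k"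
        by (intro power_mono B(5)) auto
      also have "\<dots> = (\<epsilon> powr D) ^ Suc k * colour_box H\<^sub>j \<sigma>\<^sub>j P \<pi>"
        by (simp only: power_mult_distrib boxP)
      also have "(\<epsilon> powr D) ^ Suc k = (\<epsilon> ^ Suc k) powr D"
        using B(1) by (simp only: powr_realpow[symmetric] powr_powr powr_gt_zero zero_less_power) (simp add: mult.commute)
      also have "(\<epsilon> ^ Suc k) powr D \<le> (\<eta> powr (1/2)) powr D"
        using k(2) B(1) D by (intro powr_mono2) auto
      also have "\<dots> = \<eta> powr (D/2)" by (simp add: powr_powr)
      finally have "real (card (coloured_homs H\<^sub>j \<sigma>\<^sub>j P \<pi>)) \<le> \<eta> powr (D/2) * colour_box H\<^sub>j \<sigma>\<^sub>j P \<pi>"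
        by (simp add: colour_box_nonneg mult_right_mono)
      from mul[OF Hj(1) this triv[OF Hj(1) finP(2)]] show ?thesis by simp
    qed
    show "has_bad_extension (insert j J) D \<eta> \<epsilon>S S \<kappa>S"
      unfolding has_bad_extension_def
    proof (intro exI[of _ Q] exI[of _ \<mu>] conjI ballI allI impI)
      show "host (\<eta> ^ card (insert j J) * \<epsilon>S) Q \<mu>"
        using Q(1) insert.hyps by (simp add: mult.assoc)
      show "card (colour_class Q \<mu> x) \<ge> card (colour_class S \<kappa>S x)" if x: "x \<in> {1..f}" for x
      proof -
        have "card (colour_class P \<pi> x) \<ge> 1"
          using colour_class_pos[OF B(3,1,4) x] by (simp add: P(2) Suc_le_eq)
        thus ?thesis using G(2)[OF x] Q(2)[of x]
          by (metis mult_le_mono nat_mult_1)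
      qed
      show "case p of (H, \<sigma>) \<Rightarrow> real (card (coloured_homs H \<sigma> Q \<mu>)) \<le> \<eta> powr (D/2) * colour_box H \<sigma> Q \<mu>"
        if p: "p \<in> insert j J" for p
      proof (cases "p = j")
        case True
        thus ?thesis using new j by simp
      next
        case False
        obtain H \<sigma> where H: "p = (H, \<sigma>)" by (cases p)
        hence in_J: "(H, \<sigma>) \<in> J" using p False by simp
        hence "r_graph r H" using insert.prems by blast
        from mul[OF this triv[OF this finP(1)] G(3)[OF in_J]] show ?thesis by (simp add: H)
      qed
      show "real (card (coloured_homs H \<sigma> Q \<mu>)) \<le> \<tau> * colour_box H \<sigma> Q \<mu>"
        if "r_graph r H" "\<tau> \<ge> 0" "real (card (coloured_homs H \<sigma> S \<kappa>S)) \<le> \<tau> * colour_box H \<sigma> S \<kappa>S"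
        for H :: "'a hypergraph" and \<sigma> \<tau>
        using mul[OF that(1) triv[OF that(1) finP(1)] G(4)[OF that]] by simp
    qed
  qed
qed

end

section \<open>Divided differences\<close>

text \<open>
The sum is the divided difference of the monomial. It is the top coefficient of its Lagrange
interpolation polynomial, and the monomial is its own interpolation polynomial.
\<close>

lemma divided_difference_power:
  fixes X :: "'a::field set"
  assumes fin: "finite X" and i: "i < card X"
  shows "(\<Sum>x\<in>X. x ^ i / (\<Prod>y\<in>X - {x}. x - y)) = (if Suc i = card X then 1 else 0)"
proof -
  define N where "N = (\<lambda>x. \<Prod>y\<in>X - {x}. [:- y, 1:])"
  define D where "D = (\<lambda>x. \<Prod>y\<in>X - {x}. x - y)"
  define q where "q = (\<Sum>x\<in>X. smult (x ^ i / D x) (N x))"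
  have degN: "degree (N x) = card X - 1" if "x \<in> X" for x
    unfolding N_def using that fin by (subst degree_prod_sum_eq) (auto simp: card_Diff_singleton)
  have leadN: "coeff (N x) (card X - 1) = 1" if "x \<in> X" for x
    using lead_coeff_prod[of "\<lambda>y. [:- y, 1:]" "X - {x}"] degN[OF that] by (simp add: N_def)
  have evN: "poly (N x) z = (if x = z then D x else 0)" if "x \<in> X" "z \<in> X" for x z
  proof -
    have "poly (N x) z = (\<Prod>y\<in>X - {x}. z - y)" by (simp add: N_def poly_prod)
    also have "\<dots> = (if x = z then D x else 0)"
      using that fin by (auto simp: D_def prod_zero_iff)
    finally show ?thesis .
  qed
  have Dnz: "D x \<noteq> 0" if "x \<in> X" for x using fin by (auto simp: D_def prod_zero_iff)
  have "degree q \<le> card X - 1"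
    unfolding q_def by (rule degree_sum_le[OF fin]) (metis degN degree_smult_le)
  hence degq: "degree q < card X" using i by linarith
  have "monom 1 i = q"
  proof (rule poly_eqI_degree[of X])
    fix z assume z: "z \<in> X"
    have "poly q z = (\<Sum>x\<in>X. (x ^ i / D x) * poly (N x) z)" by (simp add: q_def poly_sum)
    also have "\<dots> = (\<Sum>x\<in>X. if x = z then z ^ i else 0)"
      by (rule sum.cong) (use evN z Dnz in auto)
    also have "\<dots> = z ^ i" using z fin by simp
    finally show "poly (monom 1 i) z = poly q z" by (simp add: poly_monom)
  qed (use degq i in \<open>auto simp: degree_monom_eq\<close>)
  hence "coeff (monom 1 i) (card X - 1) = coeff q (card X - 1)" by simp
  also have "coeff q (card X - 1) = (\<Sum>x\<in>X. (x ^ i / D x) * coeff (N x) (card X - 1))"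
    by (simp add: q_def coeff_sum)
  also have "\<dots> = (\<Sum>x\<in>X. x ^ i / D x)" by (rule sum.cong) (use leadN in simp_all)
  finally have "(\<Sum>x\<in>X. x ^ i / D x) = (if i = card X - 1 then 1 else 0)" by simp
  moreover have "i = card X - 1 \<longleftrightarrow> Suc i = card X" using i by linarith
  ultimately show ?thesis by (simp add: D_def)
qed

lemma mod_eq_cancel:
  fixes M w y y' :: int
  assumes "M dvd w * (y - y')" "coprime w M" "y \<in> {0..<M}" "y' \<in> {0..<M}"
  shows "y = y'"
proof -
  have "M dvd y - y'" using assms(1,2) by (metis coprime_commute coprime_dvd_mult_right_iff)
  hence "y mod M = y' mod M" by (simp add: mod_eq_dvd_iff)
  thus ?thesis using assms(3,4) by simp
qed

text \<open>
Greedy choice of edges such that each contains a vertex that no earlier edge contains. An edge covers at most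
\<open>r\<close> vertices, so at least \<open>card R / r\<close> edges are needed.
\<close>

lemma greedy_cover:
  assumes "finite R" "\<forall>e\<in>E. finite e \<and> card e = r" "\<forall>v\<in>R. \<exists>e\<in>E. v \<in> e"
  shows "\<exists>ps. distinct (map fst ps) \<and> fst ` set ps \<subseteq> R \<and> (\<forall>(u, e)\<in>set ps. u \<in> e \<and> e \<in> E) \<and>
           card R \<le> r * length ps \<and> sorted_wrt (\<lambda>p q. fst q \<notin> snd p) ps"
  using assms(1,3)
proof (induction R rule: finite_psubset_induct)
  case (psubset R)
  show ?case
  proof (cases "R = {}")
    case True
    thus ?thesis by (intro exI[of _ "[]"]) auto
  next
    case False
    then obtain u where u: "u \<in> R" by auto
    then obtain e where e: "e \<in> E" "u \<in> e" using psubset.prems by blast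
    have "R - e \<subset> R" using u e by auto
    moreover have "\<forall>v\<in>R - e. \<exists>e\<in>E. v \<in> e" using psubset.prems by blast
    ultimately obtain ps where ps: "distinct (map fst ps)" "fst ` set ps \<subseteq> R - e"
      "\<forall>(u, e)\<in>set ps. u \<in> e \<and> e \<in> E" "card (R - e) \<le> r * length ps"
      "sorted_wrt (\<lambda>p q. fst q \<notin> snd p) ps"
      using psubset.IH[of "R - e"] by blast
    have "card R \<le> card ((R - e) \<union> e)" by (rule card_mono) (use psubset.hyps bspec[OF assms(2) e(1)] in auto)
    also have "\<dots> \<le> card (R - e) + card e" by (rule card_Un_le)
    also have "\<dots> \<le> r * length ((u, e) # ps)" using ps(4) bspec[OF assms(2) e(1)] by simp
    finally have "card R \<le> r * length ((u, e) # ps)" .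
    moreover have "distinct (map fst ((u, e) # ps))" using ps(1,2) e by auto
    moreover have "fst ` set ((u, e) # ps) \<subseteq> R" using ps(2) u by auto
    moreover have "\<forall>(u, e)\<in>set ((u, e) # ps). u \<in> e \<and> e \<in> E" using ps(3) e by auto
    moreover have "sorted_wrt (\<lambda>p q. fst q \<notin> snd p) ((u, e) # ps)" using ps(2,5) by auto
    ultimately show ?thesis by blast
  qed
qed

locale interpolation = pattern +
  fixes \<theta> :: "nat \<Rightarrow> int"
  assumes inj_theta: "inj_on \<theta> {1..f}"
begin

definition node :: "nat set \<Rightarrow> nat \<Rightarrow> int" where
  "node T a = (\<Prod>b\<in>T - {a}. \<theta> a - \<theta> b)"

text \<open>
A nonzero common multiple of all denominators of divided differences at the nodes; scaling by it
makes them integral, and moduli prime to it see all nodes as distinct.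
\<close>

definition \<Delta> :: int where "\<Delta> = (\<Prod>a\<in>{1..f}. node {1..f} a)"

text \<open>
The coefficients of the divided difference on \<open>T\<close>, scaled by \<open>\<Delta>\<close>.
\<close>

definition weight :: "nat set \<Rightarrow> nat \<Rightarrow> int" where "weight T a = \<Delta> div node T a"

lemma node_nonzero: "T \<subseteq> {1..f} \<Longrightarrow> a \<in> T \<Longrightarrow> node T a \<noteq> 0"
  using inj_theta finite_subset[of T "{1..f}"] by (auto simp: node_def prod_zero_iff inj_on_def)

lemma Delta_nonzero: "\<Delta> \<noteq> 0"
  using node_nonzero[of "{1..f}"] by (auto simp: \<Delta>_def prod_zero_iff)

lemma weight_mult_node:
  assumes "T \<subseteq> {1..f}" "a \<in> T" shows "weight T a * node T a = \<Delta>"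
proof -
  have "node T a dvd node {1..f} a"
    unfolding node_def by (rule prod_dvd_prod_subset) (use assms in auto)
  also have "\<dots> dvd \<Delta>" unfolding \<Delta>_def by (rule dvd_prodI) (use assms in auto)
  finally show ?thesis by (simp add: weight_def)
qed

lemma coprime_weight:
  assumes "coprime M \<Delta>" "T \<subseteq> {1..f}" "a \<in> T" shows "coprime (weight T a) M"
  using assms(1) weight_mult_node[OF assms(2,3)] by (metis coprime_commute coprime_mult_right_iff)

lemma rat_weight:
  assumes "T \<subseteq> {1..f}" "a \<in> T"
  shows "of_int (weight T a) = (of_int \<Delta> :: rat) / (\<Prod>b\<in>T - {a}. of_int (\<theta> a - \<theta> b))"
proof -
  have "of_int (weight T a) * of_int (node T a) = (of_int \<Delta> :: rat)"
    unfolding of_int_mult[symmetric] weight_mult_node[OF assms] ..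
  moreover have "of_int (node T a) = (\<Prod>b\<in>T - {a}. of_int (\<theta> a - \<theta> b) :: rat)"
    by (simp add: node_def)
  moreover have "of_int (node T a) \<noteq> (0::rat)" using node_nonzero[OF assms] by simp
  ultimately show ?thesis by (metis nonzero_eq_divide_eq)
qed

lemma rat_power_sum:
  assumes "T \<subseteq> {1..f}" "i < card T"
  shows "(\<Sum>a\<in>T. of_int (\<theta> a) ^ i / (\<Prod>b\<in>T - {a}. of_int (\<theta> a - \<theta> b)))
          = (if Suc i = card T then 1 else (0::rat))"
proof -
  let ?g = "\<lambda>a. of_int (\<theta> a) :: rat"
  have injT: "inj_on \<theta> T" using inj_on_subset[OF inj_theta assms(1)] .
  hence inj: "inj_on ?g T" by (auto simp: inj_on_def)
  have fin: "finite T" using assms(1) by (rule finite_subset) simp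
  have "(\<Sum>x\<in>?g ` T. x ^ i / (\<Prod>y\<in>?g ` T - {x}. x - y)) = (if Suc i = card T then 1 else 0)"
    using divided_difference_power[of "?g ` T" i] fin assms(2) by (simp add: card_image[OF inj])
  also have "(\<Sum>x\<in>?g ` T. x ^ i / (\<Prod>y\<in>?g ` T - {x}. x - y))
     = (\<Sum>a\<in>T. ?g a ^ i / (\<Prod>y\<in>?g ` T - {?g a}. ?g a - y))"
    by (rule sum.reindex[OF inj, unfolded o_def])
  also have "\<dots> = (\<Sum>a\<in>T. ?g a ^ i / (\<Prod>b\<in>T - {a}. of_int (\<theta> a - \<theta> b)))"
  proof (rule sum.cong[OF refl])
    fix a assume a: "a \<in> T"
    have "?g ` T - {?g a} = ?g ` (T - {a})" using inj a by (auto simp: inj_on_def)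
    hence "(\<Prod>y\<in>?g ` T - {?g a}. ?g a - y) = (\<Prod>b\<in>T - {a}. ?g a - ?g b)"
      using prod.reindex[OF inj_on_subset[OF inj, of "T - {a}"], of "\<lambda>y. ?g a - y"] by auto
    thus "?g a ^ i / (\<Prod>y\<in>?g ` T - {?g a}. ?g a - y) = ?g a ^ i / (\<Prod>b\<in>T - {a}. of_int (\<theta> a - \<theta> b))"
      by simp
  qed
  finally show ?thesis .
qed

lemma weighted_power_sum:
  assumes "T \<subseteq> {1..f}" "i < card T"
  shows "(\<Sum>a\<in>T. weight T a * \<theta> a ^ i) = (if Suc i = card T then \<Delta> else 0)"
proof -
  have "(of_int (\<Sum>a\<in>T. weight T a * \<theta> a ^ i) :: rat)
      = (\<Sum>a\<in>T. of_int \<Delta> * (of_int (\<theta> a) ^ i / (\<Prod>b\<in>T - {a}. of_int (\<theta> a - \<theta> b))))"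
    unfolding of_int_sum by (rule sum.cong) (use assms(1) in \<open>simp_all add: rat_weight\<close>)
  also have "\<dots> = of_int (if Suc i = card T then \<Delta> else 0)"
    unfolding sum_distrib_left[symmetric] rat_power_sum[OF assms] by simp
  finally show ?thesis by (simp only: of_int_eq_iff)
qed

lemma weighted_polynomial_sum:
  assumes "T \<subseteq> {1..f}" "card T = Suc n"
  shows "(\<Sum>a\<in>T. weight T a * (\<Sum>i<Suc n. q i * \<theta> a ^ i)) = \<Delta> * q n"
proof -
  have "(\<Sum>a\<in>T. weight T a * (\<Sum>i<Suc n. q i * \<theta> a ^ i)) = (\<Sum>a\<in>T. \<Sum>i<Suc n. q i * (weight T a * \<theta> a ^ i))"
    by (simp add: sum_distrib_left mult_ac del: sum.lessThan_Suc)
  also have "\<dots> = (\<Sum>i<Suc n. q i * (\<Sum>a\<in>T. weight T a * \<theta> a ^ i))"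
    by (subst sum.swap) (simp add: sum_distrib_left del: sum.lessThan_Suc)
  also have "\<dots> = (\<Sum>i<Suc n. q i * (if Suc i = card T then \<Delta> else 0))"
    by (rule sum.cong) (use assms in \<open>auto simp: weighted_power_sum\<close>)
  also have "\<dots> = \<Delta> * q n" using assms(2) by (simp add: if_distrib mult_ac cong: if_cong)
  finally show ?thesis .
qed

text \<open>
Uniqueness of interpolation modulo \<open>M\<close>. Modulo a composite \<open>M\<close> one cannot count roots; instead the divided
difference on \<open>Suc n\<close> of the nodes isolates the top coefficient, which is removed before the induction
hypothesis is applied.
\<close>

lemma vanishing_polynomial:
  assumes "coprime M \<Delta>" "T \<subseteq> {1..f}" "n \<le> card T"
    and "\<And>a. a \<in> T \<Longrightarrow> M dvd (\<Sum>i<n. q i * \<theta> a ^ i)"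
  shows "i < n \<Longrightarrow> M dvd q i"
  using assms(3,4)
proof (induction n arbitrary: i)
  case (Suc n)
  obtain T' where T': "T' \<subseteq> T" "card T' = Suc n" using Suc.prems(2) by (meson obtain_subset_with_card_n)
  have "M dvd (\<Sum>a\<in>T'. weight T' a * (\<Sum>i<Suc n. q i * \<theta> a ^ i))"
    by (rule dvd_sum, rule dvd_mult, rule Suc.prems(3)) (use T' in auto)
  hence "M dvd \<Delta> * q n" using weighted_polynomial_sum[of T' n q] T' assms(2) by auto
  hence qn: "M dvd q n" using assms(1) by (metis coprime_dvd_mult_right_iff)
  have "M dvd (\<Sum>i<n. q i * \<theta> a ^ i)" if "a \<in> T" for a
  proof -
    have "M dvd (\<Sum>i<n. q i * \<theta> a ^ i) + q n * \<theta> a ^ n" using Suc.prems(3)[OF that] by simp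
    thus ?thesis using qn by (metis dvd_add_left_iff dvd_mult2)
  qed
  hence "M dvd q i" if "i < n" for i using Suc.IH[of i] that Suc.prems(2) by simp
  thus ?case using qn Suc.prems(1) by (auto simp: less_Suc_eq)
qed simp

end

section \<open>Hosts from polynomials\<close>

context interpolation begin

text \<open>
A set of pairs with distinct first coordinates is the graph of a function \<open>y\<close> on an edge \<open>T\<close> of \<open>F\<close>; it is an edge
of the host if the divided difference of \<open>y\<close> on \<open>T\<close> is congruent to an element of \<open>A\<close>.
\<close>

definition alg_host :: "int \<Rightarrow> int set \<Rightarrow> (nat \<times> int) hypergraph" where
  "alg_host M A = \<lparr>verts = {1..f} \<times> {0..<M},
     edges = {e. e \<subseteq> {1..f} \<times> {0..<M} \<and> inj_on fst e \<and> fst ` e \<in> edges F \<and>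
       (\<exists>\<alpha>\<in>A. M dvd (\<Sum>p\<in>e. weight (fst ` e) (fst p) * snd p) - \<Delta> * \<alpha>)}\<rparr>"

lemma card_verts_alg_host: "M \<ge> 0 \<Longrightarrow> card (verts (alg_host M A)) = f * nat M"
  by (simp add: alg_host_def card_cartesian_product)

lemma card_colour_class_alg_host:
  assumes "x \<in> {1..f}" shows "card (colour_class (alg_host M A) fst x) = nat M"
proof -
  have "colour_class (alg_host M A) fst x = {x} \<times> {0..<M}"
    using assms by (auto simp: colour_class_def alg_host_def)
  thus ?thesis by (simp add: card_cartesian_product)
qed

text \<open>
The copies of \<open>F\<close> are the graphs of the polynomials of degree less than \<open>r\<close> with leading coefficient in \<open>A\<close>. Prescribing
the value at one node fixes the constant coefficient in terms of the others, so each vertex lies in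
\<open>card A * M ^ (r - 2)\<close> of them. Two copies with a common edge agree at \<open>r\<close> nodes and coincide.
\<close>

lemma host_alg_host:
  assumes M: "M > 0" "coprime M \<Delta>" and A: "A \<subseteq> {0..<M}" "real (card A) \<ge> \<delta> * real_of_int M" and "\<delta> \<ge> 0"
  shows "host (\<delta> / real f ^ (r - 1)) (alg_host M A) fst"
proof -
  let ?G = "alg_host M A"
  define val where "val = (\<lambda>(c :: nat \<Rightarrow> int) a. (\<Sum>i<r. c i * \<theta> a ^ i) mod M)"
  define \<psi> where "\<psi> = (\<lambda>c. restrict (\<lambda>a. (a, val c a)) (verts F))"
  define Cs where "Cs = {c \<in> {..<r} \<rightarrow>\<^sub>E {0..<M}. c (r - 1) \<in> A}"
  have finA: "finite A" using A(1) finite_subset by blast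
  have val: "val c a \<in> {0..<M}" for c a using M by (simp add: val_def)
  have Fsub: "T \<subseteq> verts F" "T \<subseteq> {1..f}" if "T \<in> edges F" for T using edge_F[OF that] by (simp_all add: verts_F)
  have psi: "\<psi> c a = (a, val c a)" if "a \<in> verts F" for c a using that by (simp add: \<psi>_def)
  have fst_psi: "fst ` \<psi> c ` T = T" if "T \<in> edges F" for c T
    using Fsub(1)[OF that] by (force simp: \<psi>_def image_iff)
  have finCs: "finite Cs" unfolding Cs_def by (rule finite_subset[of _ "{..<r} \<rightarrow>\<^sub>E {0..<M}"]) (auto intro!: finite_PiE)
  have unique: "c = c'" if c: "c \<in> Cs" "c' \<in> Cs" and T: "T \<in> edges F" and eq: "\<And>a. a \<in> T \<Longrightarrow> \<psi> c a = \<psi> c' a" for c c' T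
  proof -
    have "M dvd (\<Sum>i<r. (c i - c' i) * \<theta> a ^ i)" if "a \<in> T" for a
    proof -
      have "val c a = val c' a" using eq[OF that] Fsub(1)[OF T] that by (auto simp: psi)
      hence "M dvd (\<Sum>i<r. c i * \<theta> a ^ i) - (\<Sum>i<r. c' i * \<theta> a ^ i)" by (simp add: val_def mod_eq_dvd_iff)
      thus ?thesis by (simp add: sum_subtractf left_diff_distrib)
    qed
    hence "M dvd c i - c' i" if "i < r" for i
      using vanishing_polynomial[OF M(2) Fsub(2)[OF T], of r "\<lambda>i. c i - c' i" i] edge_F[OF T] that by auto
    moreover have "c i \<in> {0..<M}" "c' i \<in> {0..<M}" if "i < r" for i
      using c that unfolding Cs_def by blast+
    ultimately have "c i = c' i" if "i < r" for i
      using mod_eq_cancel[of M 1 "c i" "c' i"] that by simp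
    thus ?thesis using c by (intro PiE_ext[of c "{..<r}" _ c']) (auto simp: Cs_def)
  qed
  obtain T0 where T0: "T0 \<in> edges F" using F_nonempty by auto
  have psi_inj: "inj_on \<psi> Cs"
    by (rule inj_onI) (rule unique[OF _ _ T0], auto)
  have psi_emb: "\<psi> c \<in> embeddings F ?G" if c: "c \<in> Cs" for c
  proof -
    have "\<psi> c ` T \<in> edges ?G" if T: "T \<in> edges F" for T
    proof -
      have inj: "inj_on (\<psi> c) T" using Fsub(1)[OF T] by (auto simp: inj_on_def \<psi>_def)
      have "(\<Sum>p\<in>\<psi> c ` T. weight T (fst p) * snd p) = (\<Sum>a\<in>T. weight T a * val c a)"
        unfolding sum.reindex[OF inj] o_def by (rule sum.cong) (use Fsub(1)[OF T] in \<open>auto simp: psi\<close>)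
      also have "[\<dots> = (\<Sum>a\<in>T. weight T a * (\<Sum>i<r. c i * \<theta> a ^ i))] (mod M)"
        unfolding val_def by (intro cong_sum cong_mult cong_refl) (simp add: cong_def)
      also have "(\<Sum>a\<in>T. weight T a * (\<Sum>i<r. c i * \<theta> a ^ i)) = \<Delta> * c (r - 1)"
        using weighted_polynomial_sum[OF Fsub(2)[OF T], of "r - 1" c] edge_F[OF T] r_ge_2 by simp
      finally have "M dvd (\<Sum>p\<in>\<psi> c ` T. weight T (fst p) * snd p) - \<Delta> * c (r - 1)"
        by (simp add: cong_iff_dvd_diff)
      moreover have "\<psi> c ` T \<subseteq> {1..f} \<times> {0..<M}" using Fsub[OF T] val by (auto simp: \<psi>_def)
      moreover have "inj_on fst (\<psi> c ` T)" using Fsub(1)[OF T] by (auto simp: inj_on_def \<psi>_def)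
      moreover have "c (r - 1) \<in> A" using c by (simp add: Cs_def)
      ultimately show ?thesis using T fst_psi[OF T] by (auto simp: alg_host_def)
    qed
    moreover have "\<psi> c \<in> verts F \<rightarrow> verts ?G" using val by (auto simp: \<psi>_def alg_host_def verts_F)
    moreover have "inj_on (\<psi> c) (verts F)" by (auto simp: inj_on_def \<psi>_def)
    moreover have "\<psi> c \<in> extensional (verts F)" by (simp add: \<psi>_def)
    ultimately show ?thesis by (simp add: embeddings_def homomorphism_def)
  qed
  show ?thesis unfolding host_def
  proof (intro conjI)
    show "r_graph r ?G" unfolding r_graph_def
    proof (intro conjI ballI)
      fix e assume e: "e \<in> edges ?G"
      show "e \<subseteq> verts ?G" using e by (simp add: alg_host_def)
      show "card e = r" using e card_image[of fst e] edge_F[of "fst ` e"] by (simp add: alg_host_def)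
    qed (simp add: alg_host_def)
    show "homomorphism ?G F fst" by (auto simp: homomorphism_def alg_host_def verts_F)
    show "uniformly_far_from_free r F (\<delta> / real f ^ (r - 1)) ?G fst"
      unfolding uniformly_far_from_free_def
    proof (intro exI[of _ "\<psi> ` Cs"] conjI ballI)
      show "\<psi> ` Cs \<subseteq> embeddings F ?G" using psi_emb by blast
      show "disjoint_family_on (\<lambda>\<psi>. (`) \<psi> ` edges F) (\<psi> ` Cs)"
      proof (unfold disjoint_family_on_def, intro ballI impI)
        fix P Q assume a: "P \<in> \<psi> ` Cs" "Q \<in> \<psi> ` Cs" "P \<noteq> Q"
        obtain c c' where c: "P = \<psi> c" "Q = \<psi> c'" "c \<in> Cs" "c' \<in> Cs" using a by blast
        have False if st: "S \<in> edges F" "T \<in> edges F" "P ` S = Q ` T" for S T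
        proof -
          have ST: "S = T" using fst_psi[OF st(1), of c] fst_psi[OF st(2), of c'] st(3) c by simp
          have "\<psi> c x = \<psi> c' x" if x: "x \<in> T" for x
          proof -
            have "\<psi> c x \<in> \<psi> c' ` T" using st(3) c ST x by auto
            then obtain z where "z \<in> T" "\<psi> c x = \<psi> c' z" by auto
            thus ?thesis using Fsub(1)[OF st(2)] x by (auto simp: psi subset_iff)
          qed
          hence "c = c'" by (rule unique[OF c(3,4) st(2)])
          thus False using a(3) c by simp
        qed
        thus "(`) P ` edges F \<inter> (`) Q ` edges F = {}" by blast
      qed
      show "fst (P v) = v" if "P \<in> \<psi> ` Cs" "v \<in> verts F" for P v using that by (auto simp: psi)
      show "\<delta> / real f ^ (r - 1) * real (card (verts ?G)) ^ (r - 1) \<le> real (card {P \<in> \<psi> ` Cs. w \<in> P ` verts F})"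
        if w: "w \<in> verts ?G" for w
      proof -
        obtain a z where az: "w = (a, z)" "a \<in> verts F" "z \<in> {0..<M}"
          using w by (auto simp: alg_host_def verts_F)
        define Y where "Y = (\<Pi>\<^sub>E i\<in>{1..<r}. if i = r - 1 then A else {0..<M})"
        \<comment> \<open>The constant coefficient is solved for, so that the polynomial takes the value \<open>z\<close> at the node of \<open>a\<close>.\<close>
        define ext where "ext = (\<lambda>c :: nat \<Rightarrow> int. c(0 := (z - (\<Sum>i\<in>{1..<r}. c i * \<theta> a ^ i)) mod M))"
        have split: "{..<r} = insert 0 {1..<r}" using r_ge_2 by auto
        have extCs: "ext c \<in> Cs" if c: "c \<in> Y" for c
        proof -
          have "c i \<in> {0..<M}" if "i \<in> {1..<r}" for i
            using PiE_mem[OF c[unfolded Y_def] that] A(1) by (auto split: if_splits)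
          moreover have "c (r - 1) \<in> A"
            using PiE_mem[OF c[unfolded Y_def], of "r - 1"] r_ge_2 by auto
          moreover have "c i = undefined" if "i \<notin> {1..<r}" for i
            using c that by (auto simp: Y_def PiE_def extensional_def)
          ultimately show ?thesis using M r_ge_2
            by (auto simp: Cs_def ext_def PiE_def extensional_def)
        qed
        have ext_val: "\<psi> (ext c) a = w" for c
        proof -
          have "(\<Sum>i<r. ext c i * \<theta> a ^ i) = ext c 0 + (\<Sum>i\<in>{1..<r}. c i * \<theta> a ^ i)"
            unfolding split by (simp add: ext_def)
          also have "\<dots> mod M = z mod M" by (simp add: ext_def mod_simps)
          finally show ?thesis using az by (simp add: psi val_def)
        qed
        have ext_inj: "inj_on ext Y"
        proof (rule inj_onI)
          fix c c' assume c: "c \<in> Y" "c' \<in> Y" "ext c = ext c'"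
          have "c i = c' i" if "i \<in> {1..<r}" for i
            using fun_cong[OF c(3), of i] that by (simp add: ext_def)
          thus "c = c'" by (rule PiE_ext[OF c(1,2)[unfolded Y_def]])
        qed
        have "card Y = (\<Prod>i\<in>{1..<r}. card (if i = r - 1 then A else {0..<M}))"
          unfolding Y_def by (simp add: card_PiE)
        also have "\<dots> = card A * (\<Prod>i\<in>{1..<r} - {r - 1}. card (if i = r - 1 then A else {0..<M}))"
          using r_ge_2 by (subst prod.remove[of _ "r - 1"]) auto
        also have "(\<Prod>i\<in>{1..<r} - {r - 1}. card (if i = r - 1 then A else {0..<M})) = (\<Prod>i\<in>{1..<r} - {r - 1}. nat M)"
          by (rule prod.cong) auto
        also have "\<dots> = nat M ^ (r - 2)" using r_ge_2 by (simp add: card_Diff_singleton numeral_2_eq_2)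
        finally have cY: "card Y = card A * nat M ^ (r - 2)" .
        have im: "(\<psi> \<circ> ext) ` Y \<subseteq> {P \<in> \<psi> ` Cs. w \<in> P ` verts F}"
        proof (rule image_subsetI)
          fix c assume "c \<in> Y"
          thus "(\<psi> \<circ> ext) c \<in> {P \<in> \<psi> ` Cs. w \<in> P ` verts F}"
            using extCs ext_val[of c] az(2) by (auto intro: image_eqI[of _ _ a])
        qed
        have inj: "inj_on (\<psi> \<circ> ext) Y"
          using extCs by (intro comp_inj_on ext_inj inj_on_subset[OF psi_inj]) auto
        have "finite {P \<in> \<psi> ` Cs. w \<in> P ` verts F}" using finCs by simp
        with inj im have "card Y \<le> card {P \<in> \<psi> ` Cs. w \<in> P ` verts F}" by (rule card_inj_on_le)
        hence le: "real (card A) * real (nat M) ^ (r - 2) \<le> real (card {P \<in> \<psi> ` Cs. w \<in> P ` verts F})"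
          unfolding cY of_nat_power[symmetric] of_nat_mult[symmetric] of_nat_le_iff .
        have "\<delta> / real f ^ (r - 1) * real (card (verts ?G)) ^ (r - 1) = \<delta> * real_of_int M ^ (r - 1)"
          using M f_pos by (simp add: card_verts_alg_host power_mult_distrib)
        also have "\<dots> = \<delta> * real_of_int M * real_of_int M ^ (r - 2)"
        proof -
          have e: "r - 1 = Suc (r - 2)" using r_ge_2 by linarith
          show ?thesis unfolding e power_Suc by (simp only: mult.assoc)
        qed
        also have "\<dots> \<le> real (card A) * real_of_int M ^ (r - 2)"
          using A(2) M by (intro mult_right_mono) auto
        also have "\<dots> = real (card A) * real (nat M) ^ (r - 2)" using M by simp
        finally show ?thesis using le by linarith
      qed
    qed
  qed
qed

text \<open>
The scaled divided difference \<open>\<Delta> (D y)\<^sub>e\<close> of an integer vector \<open>y\<close>.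
\<close>

definition form :: "('a \<Rightarrow> nat) \<Rightarrow> 'a set \<Rightarrow> ('a \<Rightarrow> int) \<Rightarrow> int" where
  "form \<sigma> e y = (\<Sum>u\<in>e. weight (\<sigma> ` e) (\<sigma> u) * y u)"

text \<open>
The element of \<open>A\<close> that witnesses that \<open>\<phi>\<close> maps \<open>e\<close> to an edge of the host: the coordinate at \<open>e\<close> of the solution
of the associated system that belongs to \<open>\<phi>\<close>.
\<close>

definition height :: "int \<Rightarrow> int set \<Rightarrow> ('a \<Rightarrow> nat) \<Rightarrow> ('a \<Rightarrow> nat \<times> int) \<Rightarrow> 'a set \<Rightarrow> int" where
  "height M A \<sigma> \<phi> e = (SOME \<alpha>. \<alpha> \<in> A \<and> M dvd form \<sigma> e (snd \<circ> \<phi>) - \<Delta> * \<alpha>)"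

lemma alg_hom:
  assumes H: "r_graph r H" "homomorphism H F \<sigma>" and \<phi>: "\<phi> \<in> coloured_homs H \<sigma> (alg_host M A) fst"
  shows "v \<in> verts H \<Longrightarrow> fst (\<phi> v) = \<sigma> v \<and> snd (\<phi> v) \<in> {0..<M}"
    and "e \<in> edges H \<Longrightarrow> height M A \<sigma> \<phi> e \<in> A \<and> M dvd form \<sigma> e (snd \<circ> \<phi>) - \<Delta> * height M A \<sigma> \<phi> e"
proof -
  show 1: "fst (\<phi> v) = \<sigma> v \<and> snd (\<phi> v) \<in> {0..<M}" if v: "v \<in> verts H" for v
  proof -
    have "\<phi> v \<in> verts (alg_host M A)" "fst (\<phi> v) = \<sigma> v"
      using \<phi> v by (auto simp: coloured_homs_def homomorphism_def)
    thus ?thesis by (auto simp: alg_host_def prod_eq_iff mem_Times_iff)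
  qed
  assume e: "e \<in> edges H"
  have sub: "e \<subseteq> verts H" using e H by (auto simp: r_graph_def)
  note ie = colouring_inj_on_edge[OF H e]
  have inj: "inj_on \<phi> e"
  proof (rule inj_onI)
    fix u v assume "u \<in> e" "v \<in> e" "\<phi> u = \<phi> v"
    thus "u = v" using 1[of u] 1[of v] sub ie(1) by (metis inj_onD subsetD)
  qed
  have im: "fst ` \<phi> ` e = \<sigma> ` e" using 1 sub by (force simp: image_iff)
  have "\<phi> ` e \<in> edges (alg_host M A)" using \<phi> e by (auto simp: coloured_homs_def homomorphism_def)
  then obtain \<alpha> where a: "\<alpha> \<in> A" "M dvd (\<Sum>p\<in>\<phi> ` e. weight (\<sigma> ` e) (fst p) * snd p) - \<Delta> * \<alpha>"
    by (auto simp: alg_host_def im)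
  have "(\<Sum>p\<in>\<phi> ` e. weight (\<sigma> ` e) (fst p) * snd p) = form \<sigma> e (snd \<circ> \<phi>)"
    unfolding sum.reindex[OF inj] form_def o_def
  proof (rule sum.cong[OF refl])
    fix u assume "u \<in> e"
    hence "fst (\<phi> u) = \<sigma> u" using 1[of u] sub by (metis subsetD)
    thus "weight (\<sigma> ` e) (fst (\<phi> u)) * snd (\<phi> u) = weight (\<sigma> ` e) (\<sigma> u) * snd (\<phi> u)" by simp
  qed
  hence "\<exists>\<alpha>. \<alpha> \<in> A \<and> M dvd form \<sigma> e (snd \<circ> \<phi>) - \<Delta> * \<alpha>" using a by auto
  from someI_ex[OF this] show "height M A \<sigma> \<phi> e \<in> A \<and> M dvd form \<sigma> e (snd \<circ> \<phi>) - \<Delta> * height M A \<sigma> \<phi> e"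
    unfolding height_def .
qed

text \<open>
The colouring prescribes first coordinates, so a coloured homomorphism is its vector of second coordinates.
\<close>

lemma alg_hom_eqI:
  assumes H: "r_graph r H" "homomorphism H F \<sigma>"
    and \<phi>: "\<phi> \<in> coloured_homs H \<sigma> (alg_host M A) fst" "\<phi>' \<in> coloured_homs H \<sigma> (alg_host M A) fst"
    and eq: "\<And>v. v \<in> verts H \<Longrightarrow> snd (\<phi> v) = snd (\<phi>' v)"
  shows "\<phi> = \<phi>'"
proof (rule extensionalityI[of _ "verts H"])
  show "\<phi> v = \<phi>' v" if "v \<in> verts H" for v
    using alg_hom(1)[OF H \<phi>(1) that] alg_hom(1)[OF H \<phi>(2) that] eq[OF that] by (simp add: prod_eq_iff)
qed (use \<phi> in \<open>auto simp: coloured_homs_def\<close>)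

text \<open>
The weight of a vertex is prime to \<open>M\<close>, so the divided difference on \<open>e\<close> and all values on \<open>e\<close> but one determine the
remaining value.
\<close>

lemma form_eq_imp_eq:
  assumes M: "coprime M \<Delta>" and H: "r_graph r H" "homomorphism H F \<sigma>" "e \<in> edges H" "u \<in> e"
    and dv: "M dvd form \<sigma> e y - form \<sigma> e y'" and eq: "\<And>v. v \<in> e \<Longrightarrow> v \<noteq> u \<Longrightarrow> y v = y' v"
    and range: "y u \<in> {0..<M}" "y' u \<in> {0..<M}"
  shows "y u = y' u"
proof -
  note ie = colouring_inj_on_edge[OF H(1-3)]
  let ?w = "weight (\<sigma> ` e) (\<sigma> u)"
  have "form \<sigma> e y - form \<sigma> e y' = (\<Sum>v\<in>e. weight (\<sigma> ` e) (\<sigma> v) * (y v - y' v))"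
    by (simp add: form_def sum_subtractf right_diff_distrib)
  also have "\<dots> = (\<Sum>v\<in>{u}. weight (\<sigma> ` e) (\<sigma> v) * (y v - y' v))"
    by (rule sum.mono_neutral_right) (use ie(3) H(4) eq in auto)
  finally have "M dvd ?w * (y u - y' u)" using dv by simp
  moreover have "coprime ?w M"
    using coprime_weight[OF M, of "\<sigma> ` e" "\<sigma> u"] edge_F[OF ie(2)] H(4) by simp
  ultimately show ?thesis using range by (rule mod_eq_cancel)
qed

text \<open>
Process the edges of a greedy cover in order. Once the other values are known, the value at the new vertex of
each edge is determined by the height of that edge, for which there are \<open>card A\<close> instead of \<open>M\<close> possibilities.
\<close>

lemma alg_host_sparse:
  fixes H :: "'a hypergraph"
  assumes M: "M > 0" "coprime M \<Delta>" and A: "A \<subseteq> {0..<M}"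
    and H: "r_graph r H" "homomorphism H F \<sigma>" "\<And>v. v \<in> verts H \<Longrightarrow> \<exists>e\<in>edges H. v \<in> e"
  shows "\<exists>k. card (verts H) \<le> r * k \<and>
    real (card (coloured_homs H \<sigma> (alg_host M A) fst))
      \<le> (real (card A) / real_of_int M) ^ k * colour_box H \<sigma> (alg_host M A) fst"
proof -
  let ?CH = "coloured_homs H \<sigma> (alg_host M A) fst"
  define V where "V = verts H"
  have finV: "finite V" using H by (auto simp: V_def r_graph_def)
  have finA: "finite A" using A finite_subset by blast
  have esub: "e \<subseteq> V" if "e \<in> edges H" for e using that H by (auto simp: r_graph_def V_def)
  have esize: "\<forall>e\<in>edges H. finite e \<and> card e = r" using colouring_inj_on_edge[OF H(1,2)] by blast
  have cover: "\<forall>v\<in>V. \<exists>e\<in>edges H. v \<in> e" using H(3) by (simp add: V_def)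
  obtain ps where ps: "distinct (map fst ps)" "fst ` set ps \<subseteq> V"
      "\<forall>(u, e)\<in>set ps. u \<in> e \<and> e \<in> edges H" "card V \<le> r * length ps"
      "sorted_wrt (\<lambda>p q. fst q \<notin> snd p) ps"
    using greedy_cover[OF finV esize cover]
    by (elim exE conjE) (rule that)
  define k where "k = length ps"
  define U where "U = fst ` set ps"
  have cU: "card U = k" unfolding U_def k_def using distinct_card[OF ps(1)] unfolding set_map length_map .
  have UV: "U \<subseteq> V" using ps(2) by (simp add: U_def)
  hence kV: "k \<le> card V" unfolding cU[symmetric] by (intro card_mono finV)
  define h where "h = (\<lambda>\<phi>. (\<lambda>n\<in>{..<k}. height M A \<sigma> \<phi> (snd (ps ! n)), \<lambda>v\<in>V - U. snd (\<phi> v)))"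
  have "card ?CH \<le> card (({..<k} \<rightarrow>\<^sub>E A) \<times> ((V - U) \<rightarrow>\<^sub>E {0..<M}))"
  proof (rule card_inj_on_le[where f = h])
    show "finite (({..<k} \<rightarrow>\<^sub>E A) \<times> ((V - U) \<rightarrow>\<^sub>E {0..<M}))"
      using finA finV by (intro finite_cartesian_product finite_PiE) auto
    show "h ` ?CH \<subseteq> ({..<k} \<rightarrow>\<^sub>E A) \<times> ((V - U) \<rightarrow>\<^sub>E {0..<M})"
    proof (rule image_subsetI)
      fix \<phi> assume p: "\<phi> \<in> ?CH"
      have "height M A \<sigma> \<phi> (snd (ps ! n)) \<in> A" if "n < k" for n
      proof -
        have "ps ! n \<in> set ps" using that by (simp add: k_def)
        hence "snd (ps ! n) \<in> edges H" using ps(3) by (auto simp: split_beta)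
        thus ?thesis using alg_hom(2)[OF H(1,2) p] by blast
      qed
      moreover have "snd (\<phi> v) \<in> {0..<M}" if "v \<in> V" for v
        using alg_hom(1)[OF H(1,2) p] that by (simp add: V_def)
      ultimately show "h \<phi> \<in> ({..<k} \<rightarrow>\<^sub>E A) \<times> ((V - U) \<rightarrow>\<^sub>E {0..<M})" by (simp add: h_def)
    qed
    show "inj_on h ?CH"
    proof (rule inj_onI)
      fix \<phi> \<phi>' assume p: "\<phi> \<in> ?CH" "\<phi>' \<in> ?CH" and eq: "h \<phi> = h \<phi>'"
      have eqA: "height M A \<sigma> \<phi> (snd (ps ! n)) = height M A \<sigma> \<phi>' (snd (ps ! n))" if "n < k" for n
        using fun_cong[OF arg_cong[OF eq, of fst], of n] that by (simp add: h_def)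
      have eqV: "snd (\<phi> v) = snd (\<phi>' v)" if "v \<in> V - U" for v
        using fun_cong[OF arg_cong[OF eq, of snd], of v] that by (simp add: h_def)
      have eqU: "snd (\<phi> (fst (ps ! n))) = snd (\<phi>' (fst (ps ! n)))" if "n < k" for n
        using that
      proof (induction n rule: less_induct)
        case (less n)
        obtain u e where ue: "ps ! n = (u, e)" by (cases "ps ! n")
        have "(u, e) \<in> set ps" using less.prems ue by (metis k_def nth_mem)
        hence e: "u \<in> e" "e \<in> edges H" using ps(3) by auto
        have "M dvd (form \<sigma> e (snd \<circ> \<phi>) - \<Delta> * height M A \<sigma> \<phi> e) - (form \<sigma> e (snd \<circ> \<phi>') - \<Delta> * height M A \<sigma> \<phi>' e)"
          by (rule dvd_diff[OF conjunct2[OF alg_hom(2)[OF H(1,2) p(1) e(2)]]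
                conjunct2[OF alg_hom(2)[OF H(1,2) p(2) e(2)]]])
        hence "M dvd form \<sigma> e (snd \<circ> \<phi>) - form \<sigma> e (snd \<circ> \<phi>')" using eqA[OF less.prems] ue by simp
        moreover have "(snd \<circ> \<phi>) v = (snd \<circ> \<phi>') v" if v: "v \<in> e" "v \<noteq> u" for v
        proof (cases "v \<in> U")
          case False
          thus ?thesis using eqV esub[OF e(2)] v by auto
        next
          case True
          then obtain m where m: "m < k" "v = fst (ps ! m)"
            unfolding U_def k_def by (metis image_iff in_set_conv_nth)
          have "\<not> n < m" using sorted_wrt_nth_less[OF ps(5), of n m] m ue v by (auto simp: k_def)
          hence "m < n" using m v ue by (metis fst_conv nat_neq_iff)
          thus ?thesis using less.IH[of m] m by simp
        qed
        moreover have "(snd \<circ> \<phi>) u \<in> {0..<M}" "(snd \<circ> \<phi>') u \<in> {0..<M}"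
          using alg_hom(1)[OF H(1,2) p(1)] alg_hom(1)[OF H(1,2) p(2)] esub[OF e(2)] e(1) by (auto simp: V_def)
        ultimately show ?case
          using form_eq_imp_eq[OF M(2) H(1,2) e(2,1), of "snd \<circ> \<phi>" "snd \<circ> \<phi>'"] ue by simp
      qed
      show "\<phi> = \<phi>'"
      proof (rule alg_hom_eqI[OF H(1,2) p])
        fix v assume v: "v \<in> verts H"
        show "snd (\<phi> v) = snd (\<phi>' v)"
        proof (cases "v \<in> U")
          case False
          thus ?thesis using eqV v by (simp add: V_def)
        next
          case True
          then obtain m where "m < k" "v = fst (ps ! m)"
            unfolding U_def k_def by (metis image_iff in_set_conv_nth)
          thus ?thesis using eqU by simp
        qed
      qed
    qed
  qed
  also have "\<dots> = card A ^ k * nat M ^ (card V - k)"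
    using finV cU UV by (simp add: card_cartesian_product card_PiE card_Diff_subset finite_subset)
  finally have "real (card ?CH) \<le> real (card A) ^ k * real (nat M) ^ (card V - k)"
    by (metis of_nat_le_iff of_nat_mult of_nat_power)
  also have "\<dots> = (real (card A) / real_of_int M) ^ k * real_of_int M ^ card V"
    using M kV by (simp add: power_divide power_diff)
  also have "real_of_int M ^ card V = colour_box H \<sigma> (alg_host M A) fst"
  proof -
    have "colour_box H \<sigma> (alg_host M A) fst = (\<Prod>v\<in>V. real_of_int M)"
      unfolding colour_box_def V_def
    proof (rule prod.cong[OF refl])
      fix v assume "v \<in> verts H"
      hence "\<sigma> v \<in> {1..f}" using H(2) by (auto simp: homomorphism_def verts_F)
      thus "real (card (colour_class (alg_host M A) fst (\<sigma> v))) = real_of_int M"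
        using M by (simp add: card_colour_class_alg_host)
    qed
    thus ?thesis by simp
  qed
  finally show ?thesis using ps(4) by (auto simp: V_def k_def)
qed

end

section \<open>Hosts that are sparse for a whole family\<close>

context pattern begin

text \<open>
The polynomial host with \<open>\<theta>\<close> the identity and \<open>A\<close> an interval of density between \<open>\<delta>\<close> and \<open>2 \<delta>\<close>.
\<close>

lemma ex_sparse_host:
  assumes \<delta>: "0 < \<delta>" "\<delta> \<le> 1/2"
  shows "\<exists>(S :: nat hypergraph) \<kappa>. host (\<delta> / real f ^ (r - 1)) S \<kappa> \<and>
    (\<forall>x\<in>{1..f}. card (colour_class S \<kappa> x) \<ge> n0) \<and>
    (\<forall>(H :: 'a hypergraph) \<sigma>. r_graph r H \<longrightarrow> homomorphism H F \<sigma> \<longrightarrow>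
       (\<forall>v\<in>verts H. \<exists>e\<in>edges H. v \<in> e) \<longrightarrow>
       (\<exists>k. card (verts H) \<le> r * k \<and>
          real (card (coloured_homs H \<sigma> S \<kappa>)) \<le> (2 * \<delta>) ^ k * colour_box H \<sigma> S \<kappa>))"
proof -
  interpret interpolation r f F int by unfold_locales (simp add: inj_on_def)
  define K where "K = n0 + nat \<lceil>1 / \<delta>\<rceil>"
  \<comment> \<open>A modulus prime to \<open>\<Delta>\<close> and as large as desired.\<close>
  define M where "M = \<bar>\<Delta>\<bar> * int K + 1"
  have copr: "coprime M \<Delta>"
  proof (rule coprimeI)
    fix d assume d: "d dvd M" "d dvd \<Delta>"
    hence "d dvd \<bar>\<Delta>\<bar> * int K" by simp
    with d(1) have "d dvd M - \<bar>\<Delta>\<bar> * int K" by (rule dvd_diff)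
    thus "is_unit d" by (simp add: M_def)
  qed
  have "1 * int K \<le> \<bar>\<Delta>\<bar> * int K" using Delta_nonzero by (intro mult_right_mono) auto
  hence MK: "M \<ge> int K + 1" by (simp add: M_def)
  hence Mpos: "M > 0" by simp
  have "1 / \<delta> \<le> real K" unfolding K_def by linarith
  also have "\<dots> \<le> real_of_int M" using MK by linarith
  finally have dM: "1 \<le> \<delta> * real_of_int M" using \<delta> by (simp add: field_simps)
  define a where "a = nat \<lceil>\<delta> * real_of_int M\<rceil>"
  have a1: "\<delta> * real_of_int M \<le> real a" unfolding a_def by linarith
  have a2: "real a \<le> 2 * \<delta> * real_of_int M" unfolding a_def using dM by linarith
  have "2 * \<delta> * real_of_int M \<le> 1 * real_of_int M" using \<delta> Mpos by (intro mult_right_mono) auto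
  hence "real a \<le> real_of_int M" using a2 by linarith
  hence aM: "int a \<le> M" by linarith
  define A where "A = {0..<int a}"
  have A: "A \<subseteq> {0..<M}" "card A = a" using aM by (auto simp: A_def)
  let ?G = "alg_host M A"
  have hG: "host (\<delta> / real f ^ (r - 1)) ?G fst"
    using host_alg_host[OF Mpos copr A(1), of \<delta>] a1 A(2) \<delta> by simp
  obtain S :: "nat hypergraph" and \<kappa> h where S: "host (\<delta> / real f ^ (r - 1)) S \<kappa>"
    "bij_betw h (verts S) (verts ?G)" "homomorphism S ?G h" and col: "\<forall>w\<in>verts S. fst (h w) = \<kappa> w"
    using host_relabel[OF hG] by (elim exE conjE) (rule that)
  have cls: "card (colour_class S \<kappa> x) = card (colour_class ?G fst x)" for x
    by (rule card_colour_class_bij[OF S(2)]) (use col in blast)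
  have "card (colour_class S \<kappa> x) \<ge> n0" if "x \<in> {1..f}" for x
  proof -
    have "int n0 \<le> int K" by (simp add: K_def)
    hence "int n0 \<le> M" using MK by linarith
    thus ?thesis using card_colour_class_alg_host[OF that, of M A] by (simp add: cls)
  qed
  moreover have "\<exists>k. card (verts H) \<le> r * k \<and>
          real (card (coloured_homs H \<sigma> S \<kappa>)) \<le> (2 * \<delta>) ^ k * colour_box H \<sigma> S \<kappa>"
    if H: "r_graph r H" "homomorphism H F \<sigma>" "\<forall>v\<in>verts H. \<exists>e\<in>edges H. v \<in> e"
    for H :: "'a hypergraph" and \<sigma>
  proof -
    obtain k where k: "card (verts H) \<le> r * k"
      "real (card (coloured_homs H \<sigma> ?G fst)) \<le> (real (card A) / real_of_int M) ^ k * colour_box H \<sigma> ?G fst"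
      using alg_host_sparse[OF Mpos copr A(1) H(1,2)] H(3) by blast
    have "card (coloured_homs H \<sigma> S \<kappa>) \<le> card (coloured_homs H \<sigma> ?G fst)"
      by (rule card_coloured_homs_target[OF H(1) host_finite[OF hG] S(3) bij_betw_imp_inj_on[OF S(2)]])
        (use col in blast)
    hence "real (card (coloured_homs H \<sigma> S \<kappa>)) \<le> (real (card A) / real_of_int M) ^ k * colour_box H \<sigma> ?G fst"
      using k(2) by linarith
    also have "\<dots> \<le> (2 * \<delta>) ^ k * colour_box H \<sigma> ?G fst"
      using a2 A(2) Mpos by (intro mult_right_mono power_mono colour_box_nonneg) (auto simp: field_simps)
    also have "colour_box H \<sigma> ?G fst = colour_box H \<sigma> S \<kappa>" by (simp add: colour_box_def cls)
    finally show ?thesis using k(1) by blast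
  qed
  ultimately show ?thesis using S(1) by blast
qed

text \<open>
Numbering the vertices encodes a coloured graph with at most \<open>L\<close> vertices in a finite set. One representative is
kept for each code, and equal codes give an isomorphism.
\<close>

lemma finitely_many_up_to_iso:
  fixes J0 :: "('a hypergraph \<times> ('a \<Rightarrow> nat)) set"
  assumes "\<forall>(H, \<sigma>)\<in>J0. r_graph r H \<and> homomorphism H F \<sigma> \<and> card (verts H) \<le> L"
  shows "\<exists>J\<subseteq>J0. finite J \<and> (\<forall>(H, \<sigma>)\<in>J0. \<exists>(H', \<sigma>')\<in>J. \<exists>h. bij_betw h (verts H') (verts H) \<and>
           homomorphism H' H h \<and> (\<forall>v\<in>verts H'. \<sigma> (h v) = \<sigma>' v))"
proof -
  have J0: "r_graph r H \<and> homomorphism H F \<sigma> \<and> card (verts H) \<le> L" if "(H, \<sigma>) \<in> J0" for H \<sigma>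
    using assms that by auto
  define g where "g = (\<lambda>p :: 'a hypergraph \<times> ('a \<Rightarrow> nat).
    SOME g. bij_betw g {..<card (verts (fst p))} (verts (fst p)))"
  have g: "bij_betw (g (H, \<sigma>)) {..<card (verts H)} (verts H)" if "(H, \<sigma>) \<in> J0" for H \<sigma>
  proof -
    have "finite (verts H)" using J0[OF that] by (simp add: r_graph_def)
    from ex_bij_betw_nat_finite[OF this] show ?thesis
      unfolding g_def atLeast0LessThan fst_conv by (rule someI_ex)
  qed
  define code where "code = (\<lambda>(H, \<sigma>). (card (verts H), {s. s \<subseteq> {..<card (verts H)} \<and> g (H, \<sigma>) ` s \<in> edges H},
      restrict (\<sigma> \<circ> g (H, \<sigma>)) {..<card (verts H)}))"
  have "code ` J0 \<subseteq> {..L} \<times> Pow (Pow {..<L}) \<times> (\<Union>n\<in>{..L}. {..<n} \<rightarrow>\<^sub>E {1..f})"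
  proof (rule image_subsetI)
    fix p assume p: "p \<in> J0"
    obtain H \<sigma> where H: "p = (H, \<sigma>)" by (cases p)
    have "g (H, \<sigma>) i \<in> verts H" if "i < card (verts H)" for i
      using g[of H \<sigma>] p H that by (auto simp: bij_betw_def)
    hence "\<sigma> (g (H, \<sigma>) i) \<in> {1..f}" if "i < card (verts H)" for i
      using J0[of H \<sigma>] p H that by (auto simp: homomorphism_def verts_F Pi_iff)
    hence r: "restrict (\<sigma> \<circ> g (H, \<sigma>)) {..<card (verts H)} \<in> {..<card (verts H)} \<rightarrow>\<^sub>E {1..f}" by simp
    have le: "card (verts H) \<le> L" using J0[of H \<sigma>] p H by auto
    show "code p \<in> {..L} \<times> Pow (Pow {..<L}) \<times> (\<Union>n\<in>{..L}. {..<n} \<rightarrow>\<^sub>E {1..f})"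
      unfolding code_def H prod.case mem_Times_iff fst_conv snd_conv
    proof (intro conjI)
      show "{s. s \<subseteq> {..<card (verts H)} \<and> g (H, \<sigma>) ` s \<in> edges H} \<in> Pow (Pow {..<L})" using le by auto
      show "restrict (\<sigma> \<circ> g (H, \<sigma>)) {..<card (verts H)} \<in> (\<Union>n\<in>{..L}. {..<n} \<rightarrow>\<^sub>E {1..f})"
        using r le by (intro UN_I[of "card (verts H)"]) simp_all
    qed (use le in simp)
  qed
  hence "finite (code ` J0)" by (rule finite_subset) (auto intro!: finite_PiE)
  then obtain J where J: "J \<subseteq> J0" "finite J" "code ` J0 = code ` J"
    using finite_subset_image[of "code ` J0" code J0] by blast
  have "\<exists>(H', \<sigma>')\<in>J. \<exists>h. bij_betw h (verts H') (verts H) \<and>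
           homomorphism H' H h \<and> (\<forall>v\<in>verts H'. \<sigma> (h v) = \<sigma>' v)" if p: "(H, \<sigma>) \<in> J0" for H \<sigma>
  proof -
    have "code (H, \<sigma>) \<in> code ` J" using p J(3) by blast
    then obtain H' \<sigma>' where H': "(H', \<sigma>') \<in> J" and eq: "code (H, \<sigma>) = code (H', \<sigma>')" by auto
    have p': "(H', \<sigma>') \<in> J0" using H' J(1) by blast
    define n where "n = card (verts H)"
    define a where "a = g (H, \<sigma>)"
    define b where "b = g (H', \<sigma>')"
    have n': "card (verts H') = n" using eq by (simp add: code_def n_def)
    have a: "bij_betw a {..<n} (verts H)" using g[OF p] by (simp add: a_def n_def)
    have b: "bij_betw b {..<n} (verts H')" using g[OF p'] by (simp add: b_def n')
    have ed: "{s. s \<subseteq> {..<n} \<and> a ` s \<in> edges H} = {s. s \<subseteq> {..<n} \<and> b ` s \<in> edges H'}"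
      using eq n' by (simp add: code_def n_def a_def b_def)
    have co: "restrict (\<sigma> \<circ> a) {..<n} = restrict (\<sigma>' \<circ> b) {..<n}"
      using eq n' by (simp add: code_def n_def a_def b_def)
    define bi where "bi = inv_into {..<n} b"
    have bi: "bij_betw bi (verts H') {..<n}" unfolding bi_def by (rule bij_betw_inv_into[OF b])
    have bbi: "b (bi v) = v" "bi v < n" if "v \<in> verts H'" for v
      using that b bi unfolding bi_def by (auto simp: bij_betw_def f_inv_into_f)
    have "bij_betw (a \<circ> bi) (verts H') (verts H)" by (rule bij_betw_trans[OF bi a])
    moreover have "homomorphism H' H (a \<circ> bi)" unfolding homomorphism_def
    proof (intro conjI ballI)
      show "a \<circ> bi \<in> verts H' \<rightarrow> verts H" using bij_betw_trans[OF bi a] by (auto simp: bij_betw_def)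
      fix e assume e: "e \<in> edges H'"
      hence sub: "e \<subseteq> verts H'" using J0[OF p'] by (auto simp: r_graph_def)
      have "b ` bi ` e = e" using sub bbi(1) by (force simp: image_iff)
      moreover have "bi ` e \<subseteq> {..<n}" using sub bbi(2) by auto
      ultimately have "bi ` e \<in> {s. s \<subseteq> {..<n} \<and> b ` s \<in> edges H'}" using e by simp
      hence "a ` bi ` e \<in> edges H" unfolding ed[symmetric] by simp
      thus "(a \<circ> bi) ` e \<in> edges H" by (simp add: image_comp)
    qed
    moreover have "\<sigma> ((a \<circ> bi) v) = \<sigma>' v" if "v \<in> verts H'" for v
      using fun_cong[OF co, of "bi v"] bbi[OF that] by simp
    ultimately show ?thesis using H' by blast
  qed
  thus ?thesis using J(1,2) by blast
qed

text \<open>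
With \<open>t\<close> isomorphism types of small graphs, the host is the product of the bad hosts, each with
parameter \<open>\<eta>\<close>, and of the sparse host with \<open>\<delta> = \<eta> ^ (t + 1)\<close>. The total parameter \<open>\<epsilon>\<close> is of order
\<open>\<eta> ^ (2 t + 1)\<close>, a fixed power of \<open>\<eta>\<close>, so the exponent \<open>D\<close> for the bad hosts can be fixed before \<open>\<eta>\<close>. For the large
graphs, \<open>\<delta> \<le> \<eta> ^ t\<close> makes \<open>\<epsilon>\<close> at least of order \<open>\<delta> ^ 2\<close>, and \<open>\<delta> powr (2 C + 2)\<close> is smaller than
\<open>\<epsilon> powr C\<close> by a factor of order \<open>\<delta> ^ 2\<close>.
\<close>

lemma simultaneously_sparse_hosts:
  fixes \<A> :: "('a hypergraph \<times> ('a \<Rightarrow> nat)) set"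
  assumes coloured: "\<forall>(H, \<sigma>)\<in>\<A>. r_graph r H \<and> homomorphism H F \<sigma> \<and> (\<forall>v\<in>verts H. \<exists>e\<in>edges H. v \<in> e)"
    and c: "c > 0" and C: "C > 0"
    and small: "\<forall>(H, \<sigma>)\<in>\<A>. int (card (verts H)) \<le> \<lfloor>2 * real r * (C + 1)\<rfloor> \<longrightarrow> \<not> abundant r F H \<sigma>"
  shows "\<exists>\<epsilon> \<tau>. 0 < \<epsilon> \<and> \<epsilon> \<le> 1 \<and> 0 \<le> \<tau> \<and> \<tau> < c * (\<epsilon> / real f) powr C \<and>
    (\<forall>n0. \<exists>(G :: nat hypergraph) \<kappa>. host \<epsilon> G \<kappa> \<and> card (verts G) \<ge> n0 \<and>
      (\<forall>(H, \<sigma>)\<in>\<A>. real (card (coloured_homs H \<sigma> G \<kappa>)) \<le> \<tau> * colour_box H \<sigma> G \<kappa>))"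
proof -
  have A: "r_graph r H \<and> homomorphism H F \<sigma> \<and> (\<forall>v\<in>verts H. \<exists>e\<in>edges H. v \<in> e)"
    if "(H, \<sigma>) \<in> \<A>" for H \<sigma> using coloured that by blast
  have na: "\<not> abundant r F H \<sigma>"
    if "(H, \<sigma>) \<in> \<A>" "int (card (verts H)) \<le> \<lfloor>2 * real r * (C + 1)\<rfloor>" for H \<sigma>
    using small that by blast
  define L where "L = \<lfloor>2 * real r * (C + 1)\<rfloor>"
  define J0 where "J0 = {(H, \<sigma>) \<in> \<A>. int (card (verts H)) \<le> L}"
  have "\<forall>(H, \<sigma>)\<in>J0. r_graph r H \<and> homomorphism H F \<sigma> \<and> card (verts H) \<le> nat L"
    using A by (auto simp: J0_def)
  from finitely_many_up_to_iso[OF this] obtain J where J: "J \<subseteq> J0" "finite J"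
    and rep: "\<forall>(H, \<sigma>)\<in>J0. \<exists>(H', \<sigma>')\<in>J. \<exists>h. bij_betw h (verts H') (verts H) \<and>
           homomorphism H' H h \<and> (\<forall>v\<in>verts H'. \<sigma> (h v) = \<sigma>' v)"
    by (elim exE conjE) (rule that)
  define t where "t = card J"
  define D where "D = 2 * (real (2 * t + 2) * C + 1)"
  have D: "D > 0" using C by (simp add: D_def add_pos_pos)
  have Jprop: "r_graph r H \<and> homomorphism H F \<sigma> \<and> \<not> abundant r F H \<sigma>" if "(H, \<sigma>) \<in> J" for H \<sigma>
    using that J(1) A[of H \<sigma>] na[of H \<sigma>] by (auto simp: J0_def L_def)
  have "\<forall>(H, \<sigma>)\<in>J. r_graph r H \<and> homomorphism H F \<sigma> \<and> \<not> abundant r F H \<sigma>"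
    using Jprop by blast
  from simultaneously_bad_host[OF J(2) D this] obtain \<eta>0 where e0: "\<eta>0 > 0" and bad:
    "\<forall>\<eta> S \<kappa>S \<epsilon>S. 0 < \<eta> \<longrightarrow> \<eta> \<le> \<eta>0 \<longrightarrow> host \<epsilon>S S \<kappa>S \<longrightarrow> \<epsilon>S \<ge> 0 \<longrightarrow> has_bad_extension J D \<eta> \<epsilon>S S \<kappa>S"
    by (elim exE conjE) (rule that)
  define Q where "Q = 4 * real f ^ r"
  have fr: "real f ^ r \<ge> 1" using f_pos by (intro one_le_power) auto
  have Qpos: "Q > 0" using fr unfolding Q_def by linarith
  \<comment> \<open>The five bounds: the bad hosts exist, powers of \<open>f\<close> are absorbed, \<open>\<delta> \<le> 1/2\<close>, and the last two beat the constant \<open>c\<close> for small and for large graphs.\<close>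
  define \<eta> where "\<eta> = Min {\<eta>0, 1 / real f ^ r, 1/2, c / 2, c / (8 * Q powr C)}"
  have \<eta>: "\<eta> \<le> \<eta>0" "\<eta> \<le> 1 / real f ^ r" "\<eta> \<le> 1/2" "\<eta> \<le> c / 2" "\<eta> \<le> c / (8 * Q powr C)"
    unfolding \<eta>_def by (auto intro!: Min_le)
  have \<eta>pos: "0 < \<eta>" unfolding \<eta>_def using e0 f_pos c Qpos by (subst Min_gr_iff) auto
  define \<delta> where "\<delta> = \<eta> ^ Suc t"
  have \<delta>: "0 < \<delta>" "\<delta> \<le> \<eta>" "\<delta> \<le> \<eta> ^ t"
  proof -
    show "0 < \<delta>" using \<eta>pos by (simp add: \<delta>_def)
    show "\<delta> \<le> \<eta>" using power_decreasing[of 1 "Suc t" \<eta>] \<eta> \<eta>pos by (simp add: \<delta>_def)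
    show "\<delta> \<le> \<eta> ^ t" unfolding \<delta>_def using \<eta> \<eta>pos by (intro power_decreasing) auto
  qed
  define \<epsilon> where "\<epsilon> = \<eta> ^ t * (\<delta> / real f ^ (r - 1))"
  have ef: "\<epsilon> / real f = \<eta> ^ t * \<delta> / real f ^ r"
    using r_ge_2 f_pos by (simp add: \<epsilon>_def power_eq_if[of _ r])
  have epos: "0 < \<epsilon>" using \<eta>pos \<delta> f_pos by (simp add: \<epsilon>_def)
  have "real f ^ (r - 1) \<ge> 1" using f_pos by (intro one_le_power) auto
  hence "\<delta> / real f ^ (r - 1) \<le> 1" using \<delta> \<eta> by (simp add: divide_le_eq)
  moreover have "\<eta> ^ t \<le> 1" using \<eta> \<eta>pos by (intro power_le_one) auto
  ultimately have e1: "\<epsilon> \<le> 1" unfolding \<epsilon>_def using \<eta>pos \<delta> f_pos by (intro mult_le_one) auto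
  define \<tau>1 where "\<tau>1 = \<eta> powr (D / 2)"
  define \<tau>2 where "\<tau>2 = (2 * \<delta>) powr (2 * C + 2)"
  define X where "X = (\<epsilon> / real f) powr C"
  have Xpos: "X > 0" using epos f_pos by (simp add: X_def)
  have exponent: "2 * t + 2 = t + Suc t + 1" by simp
  have "\<eta> ^ (2 * t + 2) = \<eta> ^ t * \<delta> * \<eta>" by (simp only: exponent \<delta>_def power_add power_one_right)
  also have "\<dots> \<le> \<eta> ^ t * \<delta> * (1 / real f ^ r)" using \<eta> \<eta>pos \<delta> by (intro mult_left_mono) auto
  finally have "\<eta> ^ (2 * t + 2) \<le> \<epsilon> / real f" by (simp add: ef)
  hence "(\<eta> ^ (2 * t + 2)) powr C \<le> X" unfolding X_def using \<eta>pos C by (intro powr_mono2) auto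
  moreover have "(\<eta> ^ (2 * t + 2)) powr C = \<eta> powr (real (2 * t + 2) * C)"
    using \<eta>pos by (simp only: powr_realpow[symmetric] powr_powr)
  ultimately have X1: "\<eta> powr (real (2 * t + 2) * C) \<le> X" by simp
  have "\<tau>1 = \<eta> powr (real (2 * t + 2) * C) * \<eta>"
  proof -
    have "D / 2 = real (2 * t + 2) * C + 1" unfolding D_def by (rule nonzero_mult_div_cancel_left) simp
    thus ?thesis unfolding \<tau>1_def using \<eta>pos by (simp only: powr_add powr_one)
  qed
  also have "\<dots> \<le> X * (c / 2)" using X1 \<eta> \<eta>pos Xpos by (intro mult_mono) auto
  also have "\<dots> < c * X" using c Xpos by simp
  finally have t1: "\<tau>1 < c * X" .
  have "\<delta> * \<delta> \<le> \<eta> ^ t * \<delta>" using \<delta> by (intro mult_right_mono) auto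
  hence "\<delta> * \<delta> / real f ^ r \<le> \<epsilon> / real f" unfolding ef using fr by (intro divide_right_mono) auto
  hence "Q * (\<delta> * \<delta> / real f ^ r) \<le> Q * (\<epsilon> / real f)" using Qpos by (intro mult_left_mono) auto
  moreover have "4 * (\<delta> * \<delta>) = Q * (\<delta> * \<delta> / real f ^ r)" using f_pos by (simp add: Q_def)
  ultimately have "4 * (\<delta> * \<delta>) \<le> Q * (\<epsilon> / real f)" by simp
  hence "(4 * (\<delta> * \<delta>)) powr C \<le> (Q * (\<epsilon> / real f)) powr C" using C \<delta> by (intro powr_mono2) auto
  also have "\<dots> = Q powr C * X" unfolding X_def by (rule powr_mult)
  finally have X2: "(4 * (\<delta> * \<delta>)) powr C \<le> Q powr C * X" .
  have "\<tau>2 = ((2 * \<delta>) powr 2) powr (C + 1)" by (simp add: \<tau>2_def powr_powr algebra_simps)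
  also have "(2 * \<delta>) powr 2 = 4 * (\<delta> * \<delta>)" using \<delta> by (simp add: powr_numeral power2_eq_square)
  also have "(4 * (\<delta> * \<delta>)) powr (C + 1) = (4 * (\<delta> * \<delta>)) powr C * (4 * (\<delta> * \<delta>))"
    using \<delta> by (simp add: powr_add)
  also have "\<dots> \<le> (Q powr C * X) * (4 * (\<eta> * 1))"
    using X2 \<delta> \<eta> \<eta>pos Qpos Xpos by (intro mult_mono) auto
  also have "\<dots> \<le> (Q powr C * X) * (4 * (c / (8 * Q powr C)))"
    using \<eta> Qpos Xpos by (intro mult_left_mono) auto
  also have "\<dots> = c * X / 2" using Qpos by simp
  also have "\<dots> < c * X" using c Xpos by simp
  finally have t2: "\<tau>2 < c * X" .
  define \<tau> where "\<tau> = max \<tau>1 \<tau>2"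
  have t0: "0 \<le> \<tau>" by (simp add: \<tau>_def \<tau>1_def le_max_iff_disj)
  have "\<exists>(G :: nat hypergraph) \<kappa>. host \<epsilon> G \<kappa> \<and> card (verts G) \<ge> n0 \<and>
      (\<forall>(H, \<sigma>)\<in>\<A>. real (card (coloured_homs H \<sigma> G \<kappa>)) \<le> \<tau> * colour_box H \<sigma> G \<kappa>)" for n0
  proof -
    have "\<delta> \<le> 1/2" using \<delta> \<eta> by linarith
    from ex_sparse_host[OF \<delta>(1) this, of n0, where 'a='a] obtain S :: "nat hypergraph" and \<kappa>S where
      S: "host (\<delta> / real f ^ (r - 1)) S \<kappa>S" "\<forall>x\<in>{1..f}. card (colour_class S \<kappa>S x) \<ge> n0"
      "\<forall>(H :: 'a hypergraph) \<sigma>. r_graph r H \<longrightarrow> homomorphism H F \<sigma> \<longrightarrow>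
       (\<forall>v\<in>verts H. \<exists>e\<in>edges H. v \<in> e) \<longrightarrow>
       (\<exists>k. card (verts H) \<le> r * k \<and>
          real (card (coloured_homs H \<sigma> S \<kappa>S)) \<le> (2 * \<delta>) ^ k * colour_box H \<sigma> S \<kappa>S)"
      by (elim exE conjE) (rule that)
    have "\<delta> / real f ^ (r - 1) \<ge> 0" using \<delta> by simp
    from bad[rule_format, OF \<eta>pos \<eta>(1) S(1) this, unfolded has_bad_extension_def, folded t_def \<tau>1_def, folded \<epsilon>_def]
    obtain G :: "nat hypergraph" and \<kappa> where
      G: "host \<epsilon> G \<kappa>" "\<forall>x\<in>{1..f}. card (colour_class G \<kappa> x) \<ge> card (colour_class S \<kappa>S x)"
      "\<forall>(H, \<sigma>)\<in>J. real (card (coloured_homs H \<sigma> G \<kappa>)) \<le> \<tau>1 * colour_box H \<sigma> G \<kappa>"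
      "\<forall>(H :: 'a hypergraph) \<sigma> \<tau>. r_graph r H \<longrightarrow> \<tau> \<ge> 0 \<longrightarrow>
         real (card (coloured_homs H \<sigma> S \<kappa>S)) \<le> \<tau> * colour_box H \<sigma> S \<kappa>S \<longrightarrow>
         real (card (coloured_homs H \<sigma> G \<kappa>)) \<le> \<tau> * colour_box H \<sigma> G \<kappa>"
      by (elim exE conjE) (rule that)
    have finG: "finite (verts G)" by (rule host_finite[OF G(1)])
    have one: "1 \<in> {1..f}" using f_pos by simp
    have "n0 \<le> card (colour_class G \<kappa> 1)" using S(2) G(2) one by (meson order.trans)
    also have "\<dots> \<le> card (verts G)" by (rule card_mono[OF finG]) (auto simp: colour_class_def)
    finally have big: "n0 \<le> card (verts G)" .
    have dens: "real (card (coloured_homs H \<sigma> G \<kappa>)) \<le> \<tau> * colour_box H \<sigma> G \<kappa>" if p: "(H, \<sigma>) \<in> \<A>" for H \<sigma>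
    proof (cases "int (card (verts H)) \<le> L")
      case True
      hence "(H, \<sigma>) \<in> J0" using p by (simp add: J0_def)
      then obtain H' \<sigma>' h where H': "(H', \<sigma>') \<in> J" and h: "bij_betw h (verts H') (verts H)"
           "homomorphism H' H h" and hcol: "\<forall>v\<in>verts H'. \<sigma> (h v) = \<sigma>' v" using rep by blast
      have "r_graph r H'" using Jprop[OF H'] by simp
      note src = card_coloured_homs_source[OF this finG h, of \<sigma> \<sigma>' \<kappa>]
      have "card (coloured_homs H \<sigma> G \<kappa>) \<le> card (coloured_homs H' \<sigma>' G \<kappa>)"
        by (rule src(1)) (use hcol in blast)
      hence "real (card (coloured_homs H \<sigma> G \<kappa>)) \<le> real (card (coloured_homs H' \<sigma>' G \<kappa>))" by simp
      also have "\<dots> \<le> \<tau>1 * colour_box H' \<sigma>' G \<kappa>" using G(3) H' by blast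
      also have "colour_box H' \<sigma>' G \<kappa> = colour_box H \<sigma> G \<kappa>"
        by (rule src(2)[symmetric]) (use hcol in blast)
      also have "\<tau>1 * colour_box H \<sigma> G \<kappa> \<le> \<tau> * colour_box H \<sigma> G \<kappa>"
        by (intro mult_right_mono colour_box_nonneg) (simp add: \<tau>_def)
      finally show ?thesis .
    next
      case False
      have H: "r_graph r H" "homomorphism H F \<sigma>" "\<forall>v\<in>verts H. \<exists>e\<in>edges H. v \<in> e"
        using A[OF p] by auto
      obtain k where k: "card (verts H) \<le> r * k"
          "real (card (coloured_homs H \<sigma> S \<kappa>S)) \<le> (2 * \<delta>) ^ k * colour_box H \<sigma> S \<kappa>S"
        using S(3) H by blast
      have "2 * real r * (C + 1) < real (card (verts H))"
        using False unfolding L_def by linarith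
      also have "\<dots> \<le> real r * real k" using k(1) by (metis of_nat_le_iff of_nat_mult)
      finally have "real r * (2 * (C + 1)) < real r * real k" by (simp add: mult_ac)
      hence kC: "2 * C + 2 \<le> real k" using r_ge_2 by simp
      have "(2 * \<delta>) ^ k = (2 * \<delta>) powr real k" using \<delta> by (simp add: powr_realpow)
      also have "\<dots> \<le> \<tau>2" unfolding \<tau>2_def using kC \<delta> \<eta> by (intro powr_mono') auto
      also have "\<dots> \<le> \<tau>" by (simp add: \<tau>_def)
      finally have "(2 * \<delta>) ^ k \<le> \<tau>" .
      hence "real (card (coloured_homs H \<sigma> S \<kappa>S)) \<le> \<tau> * colour_box H \<sigma> S \<kappa>S"
        using k(2) by (meson colour_box_nonneg mult_right_mono order.trans)
      thus ?thesis using G(4) H(1) t0 by blast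
    qed
    show ?thesis using G(1) big dens by blast
  qed
  thus ?thesis using epos e1 t0 t1 t2 by (intro exI[of _ \<epsilon>] exI[of _ \<tau>]) (simp add: X_def \<tau>_def)
qed

end

section \<open>Selecting an abundant member\<close>

lemma verts_del_isolated: "verts (del_isolated H) = {v \<in> verts H. \<exists>e\<in>edges H. v \<in> e}"
  by (auto simp: del_isolated_def isolated_def)

lemma edges_del_isolated [simp]: "edges (del_isolated H) = edges H"
  by (simp add: del_isolated_def)

lemma r_graph_del_isolated: "r_graph r H \<Longrightarrow> r_graph r (del_isolated H)"
  unfolding r_graph_def verts_del_isolated edges_del_isolated by auto

lemma homomorphism_del_isolated:
  assumes "r_graph r H" "homomorphism H F \<sigma>"
  shows "homomorphism (del_isolated H) F (restrict \<sigma> (verts (del_isolated H)))"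
proof -
  have "restrict \<sigma> (verts (del_isolated H)) ` e = \<sigma> ` e" if "e \<in> edges H" for e
  proof (rule image_cong[OF refl])
    fix v assume "v \<in> e"
    hence "v \<in> verts (del_isolated H)"
      using r_graph_del_isolated[OF assms(1)] that by (auto simp: r_graph_def)
    thus "restrict \<sigma> (verts (del_isolated H)) v = \<sigma> v" by simp
  qed
  thus ?thesis using assms(2) by (auto simp: homomorphism_def verts_del_isolated)
qed

text \<open>
An isolated vertex contributes at most a factor of \<open>card (verts G)\<close>.
\<close>

lemma card_homs_del_isolated:
  assumes "r_graph r H" "finite (verts G)"
  shows "card {\<phi> \<in> extensional (verts H). homomorphism H G \<phi> \<and> (\<forall>v\<in>verts (del_isolated H). \<kappa> (\<phi> v) = \<sigma> v)}
    \<le> card (coloured_homs (del_isolated H) \<sigma> G \<kappa>) * card (verts G) ^ (card (verts H) - card (verts (del_isolated H)))"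
    (is "card ?X \<le> _")
proof -
  define V where "V = verts (del_isolated H)"
  have VH: "V \<subseteq> verts H" by (auto simp: V_def verts_del_isolated)
  have fin: "finite (verts H)" "finite V" using assms VH by (auto simp: r_graph_def intro: finite_subset)
  have sub: "e \<subseteq> V" if "e \<in> edges H" for e
    using that r_graph_del_isolated[OF assms(1)] by (auto simp: r_graph_def V_def)
  let ?h = "\<lambda>\<phi>. (restrict \<phi> V, restrict \<phi> (verts H - V))"
  have "card ?X \<le> card (coloured_homs (del_isolated H) \<sigma> G \<kappa> \<times> ((verts H - V) \<rightarrow>\<^sub>E verts G))"
  proof (rule card_inj_on_le[where f = ?h])
    show "inj_on ?h ?X"
    proof (rule inj_onI)
      fix \<phi> \<psi> assume a: "\<phi> \<in> ?X" "\<psi> \<in> ?X" "?h \<phi> = ?h \<psi>"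
      have 1: "restrict \<phi> V = restrict \<psi> V" "restrict \<phi> (verts H - V) = restrict \<psi> (verts H - V)"
        using a(3) by auto
      have "\<phi> v = \<psi> v" if "v \<in> verts H" for v
        using fun_cong[OF 1(1), of v] fun_cong[OF 1(2), of v] that by (cases "v \<in> V") auto
      thus "\<phi> = \<psi>" using a(1,2) by (auto intro: extensionalityI)
    qed
    show "finite (coloured_homs (del_isolated H) \<sigma> G \<kappa> \<times> ((verts H - V) \<rightarrow>\<^sub>E verts G))"
      using fin assms(2) by (intro finite_cartesian_product finite_coloured_homs finite_PiE) (auto simp: V_def)
    show "?h ` ?X \<subseteq> coloured_homs (del_isolated H) \<sigma> G \<kappa> \<times> ((verts H - V) \<rightarrow>\<^sub>E verts G)"
    proof (rule image_subsetI)
      fix \<phi> assume a: "\<phi> \<in> ?X"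
      have im: "\<phi> v \<in> verts G" if "v \<in> verts H" for v using a that by (auto simp: homomorphism_def)
      have "restrict \<phi> V ` e = \<phi> ` e" if "e \<in> edges H" for e using sub[OF that] by (auto simp: image_iff)
      hence "homomorphism (del_isolated H) G (restrict \<phi> V)"
        using a im VH by (auto simp: homomorphism_def V_def[symmetric])
      moreover have "\<kappa> (restrict \<phi> V v) = \<sigma> v" if "v \<in> V" for v using a that by (simp add: V_def)
      ultimately have "restrict \<phi> V \<in> coloured_homs (del_isolated H) \<sigma> G \<kappa>"
        by (simp add: coloured_homs_def V_def[symmetric])
      moreover have "restrict \<phi> (verts H - V) \<in> (verts H - V) \<rightarrow>\<^sub>E verts G" using im by auto
      ultimately show "?h \<phi> \<in> coloured_homs (del_isolated H) \<sigma> G \<kappa> \<times> ((verts H - V) \<rightarrow>\<^sub>E verts G)" by simp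
    qed
  qed
  also have "\<dots> = card (coloured_homs (del_isolated H) \<sigma> G \<kappa>) * card (verts G) ^ (card (verts H) - card V)"
    using fin VH by (simp add: card_cartesian_product card_PiE card_Diff_subset)
  finally show ?thesis by (simp add: V_def)
qed

lemma card_del_isolated_le:
  assumes "r_graph r H" shows "card (verts (del_isolated H)) \<le> card (verts H)"
  by (rule card_mono) (use assms in \<open>auto simp: r_graph_def verts_del_isolated\<close>)

context pattern begin

text \<open>
The host for which all densities are tiny contradicts the abundance of the family, once isolated vertices are
stripped from the member that the family provides.
\<close>

lemma coloured_selection:
  fixes \<K> :: "('a hypergraph \<times> ('a \<Rightarrow> nat)) set"
  assumes fam: "coloured_family_abundant r F \<K> c C"
    and K: "\<forall>(H, \<sigma>)\<in>\<K>. r_graph r H \<and> homomorphism H F \<sigma>"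
  shows "\<exists>(H, \<sigma>)\<in>\<K>. int (card (verts (del_isolated H))) \<le> \<lfloor>2 * real r * (C + 1)\<rfloor> \<and>
    abundant r F (del_isolated H) (restrict \<sigma> (verts (del_isolated H)))"
proof (rule ccontr)
  assume contra: "\<not> ?thesis"
  have cC: "c > 0" "C > 0" using fam by (auto simp: coloured_family_abundant_def)
  define \<A> where "\<A> = (\<lambda>(H, \<sigma>). (del_isolated H, restrict \<sigma> (verts (del_isolated H)))) ` \<K>"
  have A: "r_graph r H \<and> homomorphism H F \<sigma> \<and> (\<forall>v\<in>verts H. \<exists>e\<in>edges H. v \<in> e)"
    if "(H, \<sigma>) \<in> \<A>" for H \<sigma>
  proof -
    obtain H' \<sigma>' where H': "(H', \<sigma>') \<in> \<K>" "H = del_isolated H'" "\<sigma> = restrict \<sigma>' (verts (del_isolated H'))"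
      using \<open>(H, \<sigma>) \<in> \<A>\<close> by (auto simp: \<A>_def)
    have r: "r_graph r H'" "homomorphism H' F \<sigma>'" using K H'(1) by auto
    have "homomorphism H F \<sigma>" unfolding H'(2,3) by (rule homomorphism_del_isolated[OF r])
    thus ?thesis using r_graph_del_isolated[OF r(1)] by (auto simp: H'(2) verts_del_isolated)
  qed
  have na: "\<not> abundant r F H \<sigma>"
    if "(H, \<sigma>) \<in> \<A>" "int (card (verts H)) \<le> \<lfloor>2 * real r * (C + 1)\<rfloor>" for H \<sigma>
    using contra that by (auto simp: \<A>_def)
  have A': "\<forall>(H, \<sigma>)\<in>\<A>. r_graph r H \<and> homomorphism H F \<sigma> \<and> (\<forall>v\<in>verts H. \<exists>e\<in>edges H. v \<in> e)"
    using A by blast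
  have na': "\<forall>(H, \<sigma>)\<in>\<A>. int (card (verts H)) \<le> \<lfloor>2 * real r * (C + 1)\<rfloor> \<longrightarrow> \<not> abundant r F H \<sigma>"
    using na by blast
  obtain \<epsilon> \<tau> where e: "0 < \<epsilon>" "\<epsilon> \<le> 1" "0 \<le> \<tau>" "\<tau> < c * (\<epsilon> / real f) powr C"
    and ex: "\<forall>n0. \<exists>(G :: nat hypergraph) \<kappa>. host \<epsilon> G \<kappa> \<and> card (verts G) \<ge> n0 \<and>
      (\<forall>(H, \<sigma>)\<in>\<A>. real (card (coloured_homs H \<sigma> G \<kappa>)) \<le> \<tau> * colour_box H \<sigma> G \<kappa>)"
    using simultaneously_sparse_hosts[of \<A>, OF A' cC na'] by (elim exE conjE) (rule that)
  obtain n0 where n0: "\<forall>(G :: nat hypergraph) \<kappa>. r_graph r G \<and> homomorphism G F \<kappa> \<and> card (verts G) \<ge> n0 \<and>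
          uniformly_far_from_free r F \<epsilon> G \<kappa> \<longrightarrow>
            (\<exists>(H, \<sigma>)\<in>\<K>. real (card (coloured_embeddings H \<sigma> G \<kappa>))
                            \<ge> c * \<epsilon> powr C * real (card (verts G)) ^ card (verts H))"
    using fam e unfolding coloured_family_abundant_def by blast
  obtain G :: "nat hypergraph" and \<kappa> where G: "host \<epsilon> G \<kappa>" "card (verts G) \<ge> max 1 n0"
    "\<forall>(H, \<sigma>)\<in>\<A>. real (card (coloured_homs H \<sigma> G \<kappa>)) \<le> \<tau> * colour_box H \<sigma> G \<kappa>"
    using ex[rule_format, of "max 1 n0"] by (elim exE conjE) (rule that)
  have finG: "finite (verts G)" by (rule host_finite[OF G(1)])
  obtain H \<sigma> where H: "(H, \<sigma>) \<in> \<K>"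
    "real (card (coloured_embeddings H \<sigma> G \<kappa>)) \<ge> c * \<epsilon> powr C * real (card (verts G)) ^ card (verts H)"
    using n0[rule_format, of G \<kappa>] G(1,2) unfolding host_def by auto
  have rH: "r_graph r H" using K H(1) by auto
  define H' where "H' = del_isolated H"
  define \<sigma>' where "\<sigma>' = restrict \<sigma> (verts H')"
  let ?n = "real (card (verts G))"
  have inA: "(H', \<sigma>') \<in> \<A>" using H(1) by (force simp: \<A>_def H'_def \<sigma>'_def)
  let ?X = "{\<phi> \<in> extensional (verts H). homomorphism H G \<phi> \<and> (\<forall>v\<in>verts (del_isolated H). \<kappa> (\<phi> v) = \<sigma>' v)}"
  have "coloured_embeddings H \<sigma> G \<kappa> \<subseteq> ?X"
    by (auto simp: coloured_embeddings_def embeddings_def \<sigma>'_def H'_def verts_del_isolated)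
  moreover have "finite ?X"
  proof (rule finite_subset[of _ "\<Pi>\<^sub>E v\<in>verts H. verts G"])
    show "finite (\<Pi>\<^sub>E v\<in>verts H. verts G)" using rH finG by (intro finite_PiE) (auto simp: r_graph_def)
  qed (auto simp: homomorphism_def PiE_def)
  ultimately have "card (coloured_embeddings H \<sigma> G \<kappa>) \<le> card ?X" by (intro card_mono)
  also have "\<dots> \<le> card (coloured_homs H' \<sigma>' G \<kappa>) * card (verts G) ^ (card (verts H) - card (verts H'))"
    unfolding H'_def by (rule card_homs_del_isolated[OF rH finG])
  finally have "real (card (coloured_embeddings H \<sigma> G \<kappa>))
      \<le> real (card (coloured_homs H' \<sigma>' G \<kappa>) * card (verts G) ^ (card (verts H) - card (verts H')))"
    by (rule of_nat_mono)
  also have "\<dots> = real (card (coloured_homs H' \<sigma>' G \<kappa>)) * ?n ^ (card (verts H) - card (verts H'))" by simp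
  also have "\<dots> \<le> \<tau> * colour_box H' \<sigma>' G \<kappa> * ?n ^ (card (verts H) - card (verts H'))"
    using G(3) inA by (intro mult_right_mono) auto
  also have "\<dots> \<le> \<tau> * ?n ^ card (verts H') * ?n ^ (card (verts H) - card (verts H'))"
    using e(3) by (intro mult_right_mono mult_left_mono colour_box_le_power finG) auto
  also have "\<dots> = \<tau> * ?n ^ card (verts H)"
    using card_del_isolated_le[OF rH] by (simp add: mult.assoc power_add[symmetric] H'_def)
  also have "\<dots> < c * \<epsilon> powr C * ?n ^ card (verts H)"
  proof (rule mult_strict_right_mono)
    have "(\<epsilon> / real f) powr C \<le> \<epsilon> powr C"
      using e cC f_pos by (intro powr_mono2) (auto simp: divide_le_eq mult_le_cancel_left1)
    hence "c * (\<epsilon> / real f) powr C \<le> c * \<epsilon> powr C" using cC by simp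
    thus "\<tau> < c * \<epsilon> powr C" using e(4) by linarith
    show "0 < ?n ^ card (verts H)" using G(2) by (intro zero_less_power) linarith
  qed
  finally show False using H(2) by linarith
qed

text \<open>
An embedding of \<open>H\<close> into an \<open>F\<close>-partite host induces an \<open>F\<close>-colouring of \<open>H\<close>. The boxes of all
colourings of the non-isolated vertices add up to a power of the number of vertices of the host, so a uniform bound on the coloured densities
bounds the number of all embeddings without loss.
\<close>

lemma uncoloured_selection:
  fixes \<H> :: "'a hypergraph set"
  assumes fam: "family_abundant r F \<H> c C" and K: "\<forall>H\<in>\<H>. r_graph r H"
  shows "\<exists>H\<in>\<H>. \<exists>\<sigma>. homomorphism (del_isolated H) F \<sigma> \<and>
    int (card (verts (del_isolated H))) \<le> \<lfloor>2 * real r * (C + 1)\<rfloor> \<and> abundant r F (del_isolated H) \<sigma>"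
proof (rule ccontr)
  assume contra: "\<not> ?thesis"
  have cC: "c > 0" "C > 0" using fam by (auto simp: family_abundant_def)
  define \<A> where "\<A> = {(del_isolated H, \<sigma>) |H \<sigma>. H \<in> \<H> \<and> homomorphism (del_isolated H) F \<sigma>}"
  have A: "r_graph r H \<and> homomorphism H F \<sigma> \<and> (\<forall>v\<in>verts H. \<exists>e\<in>edges H. v \<in> e)"
    if "(H, \<sigma>) \<in> \<A>" for H \<sigma>
    using that K r_graph_del_isolated by (auto simp: \<A>_def verts_del_isolated)
  have na: "\<not> abundant r F H \<sigma>"
    if "(H, \<sigma>) \<in> \<A>" "int (card (verts H)) \<le> \<lfloor>2 * real r * (C + 1)\<rfloor>" for H \<sigma>
    using contra that by (auto simp: \<A>_def)
  have A': "\<forall>(H, \<sigma>)\<in>\<A>. r_graph r H \<and> homomorphism H F \<sigma> \<and> (\<forall>v\<in>verts H. \<exists>e\<in>edges H. v \<in> e)"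
    using A by blast
  have na': "\<forall>(H, \<sigma>)\<in>\<A>. int (card (verts H)) \<le> \<lfloor>2 * real r * (C + 1)\<rfloor> \<longrightarrow> \<not> abundant r F H \<sigma>"
    using na by blast
  obtain \<epsilon> \<tau> where e: "0 < \<epsilon>" "\<epsilon> \<le> 1" "0 \<le> \<tau>" "\<tau> < c * (\<epsilon> / real f) powr C"
    and ex: "\<forall>n0. \<exists>(G :: nat hypergraph) \<kappa>. host \<epsilon> G \<kappa> \<and> card (verts G) \<ge> n0 \<and>
      (\<forall>(H, \<sigma>)\<in>\<A>. real (card (coloured_homs H \<sigma> G \<kappa>)) \<le> \<tau> * colour_box H \<sigma> G \<kappa>)"
    using simultaneously_sparse_hosts[of \<A>, OF A' cC na'] by (elim exE conjE) (rule that)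
  have ef: "0 < \<epsilon> / real f" "\<epsilon> / real f \<le> 1" using e f_pos by (auto simp: divide_le_eq)
  obtain n0 where n0: "\<forall>G :: nat hypergraph. r_graph r G \<and> card (verts G) \<ge> n0 \<and>
          far_from_free r F (\<epsilon> / real f) G \<longrightarrow>
            (\<exists>H\<in>\<H>. real (card (embeddings H G))
                            \<ge> c * (\<epsilon> / real f) powr C * real (card (verts G)) ^ card (verts H))"
    using fam ef unfolding family_abundant_def by blast
  obtain G :: "nat hypergraph" and \<kappa> where G: "host \<epsilon> G \<kappa>" "card (verts G) \<ge> max 1 n0"
    "\<forall>(H, \<sigma>)\<in>\<A>. real (card (coloured_homs H \<sigma> G \<kappa>)) \<le> \<tau> * colour_box H \<sigma> G \<kappa>"
    using ex[rule_format, of "max 1 n0"] by (elim exE conjE) (rule that)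
  have finG: "finite (verts G)" by (rule host_finite[OF G(1)])
  have homG: "\<kappa> \<in> verts G \<rightarrow> verts F" "\<forall>e\<in>edges G. \<kappa> ` e \<in> edges F"
    using G(1) by (auto simp: host_def homomorphism_def)
  obtain H where H: "H \<in> \<H>"
    "real (card (embeddings H G)) \<ge> c * (\<epsilon> / real f) powr C * real (card (verts G)) ^ card (verts H)"
    using n0[rule_format, of G] G(1,2) host_far_from_free[OF G(1)] unfolding host_def by auto
  have rH: "r_graph r H" using K H(1) by auto
  define H' where "H' = del_isolated H"
  define d where "d = card (verts H) - card (verts H')"
  let ?n = "real (card (verts G))"
  let ?X = "\<lambda>\<sigma>. {\<phi> \<in> extensional (verts H). homomorphism H G \<phi> \<and> (\<forall>v\<in>verts (del_isolated H). \<kappa> (\<phi> v) = \<sigma> v)}"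
  define \<Sigma> where "\<Sigma> = verts H' \<rightarrow>\<^sub>E {1..f}"
  have finH': "finite (verts H')" using r_graph_del_isolated[OF rH] by (simp add: H'_def r_graph_def)
  have fin\<Sigma>: "finite \<Sigma>" unfolding \<Sigma>_def by (intro finite_PiE finH') simp
  have finX: "finite (?X \<sigma>)" for \<sigma>
  proof (rule finite_subset[of _ "\<Pi>\<^sub>E v\<in>verts H. verts G"])
    show "finite (\<Pi>\<^sub>E v\<in>verts H. verts G)" using rH finG by (intro finite_PiE) (auto simp: r_graph_def)
  qed (auto simp: homomorphism_def PiE_def)
  have "embeddings H G \<subseteq> (\<Union>\<sigma>\<in>\<Sigma>. ?X \<sigma>)"
  proof
    fix \<phi> assume p: "\<phi> \<in> embeddings H G"
    have "\<kappa> (\<phi> v) \<in> {1..f}" if "v \<in> verts H'" for v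
    proof -
      have "v \<in> verts H" using that by (simp add: H'_def verts_del_isolated)
      hence "\<phi> v \<in> verts G" using p by (auto simp: embeddings_def homomorphism_def)
      thus ?thesis using homG(1) by (auto simp: verts_F Pi_iff)
    qed
    hence "restrict (\<kappa> \<circ> \<phi>) (verts H') \<in> \<Sigma>" by (simp add: \<Sigma>_def)
    moreover have "\<phi> \<in> ?X (restrict (\<kappa> \<circ> \<phi>) (verts H'))" using p by (simp add: embeddings_def H'_def)
    ultimately show "\<phi> \<in> (\<Union>\<sigma>\<in>\<Sigma>. ?X \<sigma>)" by blast
  qed
  hence "card (embeddings H G) \<le> card (\<Union>\<sigma>\<in>\<Sigma>. ?X \<sigma>)"
    by (rule card_mono[rotated]) (use fin\<Sigma> finX in blast)
  also have "\<dots> \<le> (\<Sum>\<sigma>\<in>\<Sigma>. card (?X \<sigma>))" by (rule card_UN_le[OF fin\<Sigma>])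
  finally have "real (card (embeddings H G)) \<le> (\<Sum>\<sigma>\<in>\<Sigma>. real (card (?X \<sigma>)))"
    unfolding of_nat_sum[symmetric] of_nat_le_iff .
  also have "\<dots> \<le> (\<Sum>\<sigma>\<in>\<Sigma>. \<tau> * colour_box H' \<sigma> G \<kappa> * ?n ^ d)"
  proof (rule sum_mono)
    fix \<sigma> assume "\<sigma> \<in> \<Sigma>"
    have "real (card (?X \<sigma>)) \<le> real (card (coloured_homs H' \<sigma> G \<kappa>) * card (verts G) ^ d)"
      unfolding H'_def d_def of_nat_le_iff by (rule card_homs_del_isolated[OF rH finG])
    also have "\<dots> = real (card (coloured_homs H' \<sigma> G \<kappa>)) * ?n ^ d" by simp
    also have "\<dots> \<le> \<tau> * colour_box H' \<sigma> G \<kappa> * ?n ^ d"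
    proof (rule mult_right_mono)
      show "real (card (coloured_homs H' \<sigma> G \<kappa>)) \<le> \<tau> * colour_box H' \<sigma> G \<kappa>"
      proof (cases "homomorphism H' F \<sigma>")
        case True
        hence "(H', \<sigma>) \<in> \<A>" using H(1) by (auto simp: \<A>_def H'_def)
        thus ?thesis using G(3) by blast
      next
        case False
        have "coloured_homs H' \<sigma> G \<kappa> = {}"
        proof (rule ccontr)
          assume "coloured_homs H' \<sigma> G \<kappa> \<noteq> {}"
          then obtain \<phi> where p: "\<phi> \<in> verts H' \<rightarrow> verts G" "\<forall>e\<in>edges H'. \<phi> ` e \<in> edges G"
              "\<forall>v\<in>verts H'. \<kappa> (\<phi> v) = \<sigma> v"
            by (auto simp: coloured_homs_def homomorphism_def)
          have "\<sigma> ` e = \<kappa> ` \<phi> ` e" if "e \<in> edges H'" for e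
          proof -
            have "e \<subseteq> verts H'" using that r_graph_del_isolated[OF rH] by (auto simp: r_graph_def H'_def)
            thus ?thesis using p(3) by (force simp: image_iff)
          qed
          hence "\<forall>e\<in>edges H'. \<sigma> ` e \<in> edges F" using p(2) homG(2) by simp
          moreover have "\<sigma> v \<in> verts F" if "v \<in> verts H'" for v
            using Pi_mem[OF homG(1) Pi_mem[OF p(1) that]] p(3) that by simp
          ultimately have "homomorphism H' F \<sigma>" by (simp add: homomorphism_def)
          thus False using False by simp
        qed
        thus ?thesis using e(3) by (simp add: colour_box_nonneg)
      qed
    qed simp
    finally show "real (card (?X \<sigma>)) \<le> \<tau> * colour_box H' \<sigma> G \<kappa> * ?n ^ d" .
  qed
  also have "\<dots> = \<tau> * (\<Sum>\<sigma>\<in>\<Sigma>. colour_box H' \<sigma> G \<kappa>) * ?n ^ d"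
    by (simp add: sum_distrib_left sum_distrib_right)
  also have "(\<Sum>\<sigma>\<in>\<Sigma>. colour_box H' \<sigma> G \<kappa>) = (\<Prod>v\<in>verts H'. \<Sum>x\<in>{1..f}. real (card (colour_class G \<kappa> x)))"
    unfolding \<Sigma>_def colour_box_def by (rule prod_sum_PiE[symmetric]) (use finH' in auto)
  also have "\<dots> = ?n ^ card (verts H')" by (simp add: card_verts_host[OF G(1)])
  also have "\<tau> * ?n ^ card (verts H') * ?n ^ d = \<tau> * ?n ^ card (verts H)"
    using card_del_isolated_le[OF rH] by (simp add: mult.assoc power_add[symmetric] H'_def d_def)
  also have "\<dots> < c * (\<epsilon> / real f) powr C * ?n ^ card (verts H)"
    using e(4) G(2) by (intro mult_strict_right_mono zero_less_power) auto
  finally show False using H(2) by linarith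
qed

end

section \<open>The image of the divided difference map\<close>

lemma sum_fun_at: "(\<Sum>u\<in>A. g u) e = (\<Sum>u\<in>A. g u e)"
  by (induction A rule: infinite_finite_induct) auto

lemma common_denominator:
  fixes X :: "rat set"
  assumes "finite X"
  shows "\<exists>d::int. d \<noteq> 0 \<and> (\<forall>x\<in>X. \<exists>z::int. of_int d * x = of_int z)"
  using assms
proof (induction X rule: finite_induct)
  case empty
  show ?case by (intro exI[of _ 1]) simp
next
  case (insert x X)
  then obtain d where d: "d \<noteq> 0" "\<forall>x\<in>X. \<exists>z::int. of_int d * x = of_int z" by blast
  obtain a b where ab: "quotient_of x = (a, b)" by force
  have b: "b > 0" "x = of_int a / of_int b"
    using quotient_of_denom_pos[OF ab] quotient_of_div[OF ab] by auto
  have "\<exists>z::int. of_int (d * b) * y = of_int z" if "y \<in> insert x X" for y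
  proof (cases "y = x")
    case True
    have "of_int (d * b) * y = (of_int (d * a) :: rat)" using b True by simp
    thus ?thesis by blast
  next
    case False
    then obtain z :: int where "of_int d * y = of_int z" using d \<open>y \<in> insert x X\<close> by blast
    hence "of_int (d * b) * y = (of_int (z * b) :: rat)" by (simp add: mult_ac)
    thus ?thesis by blast
  qed
  thus ?case using d b by (intro exI[of _ "d * b"]) auto
qed

context interpolation begin

definition column :: "'a hypergraph \<Rightarrow> ('a \<Rightarrow> nat) \<Rightarrow> 'a \<Rightarrow> 'a set \<Rightarrow> rat" where
  "column H \<sigma> u = assoc_map \<theta> H \<sigma> (\<lambda>v. if v = u then 1 else 0)"

lemma prod_nodes_image:
  assumes "r_graph r H" "homomorphism H F \<sigma>" "e \<in> edges H" "u \<in> e"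
  shows "(\<Prod>v\<in>e - {u}. of_int (\<theta> (\<sigma> u) - \<theta> (\<sigma> v)) :: rat)
       = (\<Prod>b\<in>\<sigma> ` e - {\<sigma> u}. of_int (\<theta> (\<sigma> u) - \<theta> b))"
proof -
  note ie = colouring_inj_on_edge[OF assms(1-3)]
  have "\<sigma> ` e - {\<sigma> u} = \<sigma> ` (e - {u})" using ie(1) assms(4) by (auto simp: inj_on_def)
  moreover have "inj_on \<sigma> (e - {u})" using ie(1) by (rule inj_on_subset) auto
  ultimately show ?thesis by (simp only: prod.reindex o_def)
qed

lemma assoc_map_weight:
  assumes "r_graph r H" "homomorphism H F \<sigma>" "e \<in> edges H"
  shows "of_int \<Delta> * assoc_map \<theta> H \<sigma> y e = (\<Sum>u\<in>e. of_int (weight (\<sigma> ` e) (\<sigma> u)) * y u)"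
proof -
  have "of_int \<Delta> * assoc_map \<theta> H \<sigma> y e
      = (\<Sum>u\<in>e. of_int \<Delta> * (y u / (\<Prod>v\<in>e - {u}. of_int (\<theta> (\<sigma> u) - \<theta> (\<sigma> v)))))"
    using assms(3) by (simp add: assoc_map_def sum_distrib_left)
  also have "\<dots> = (\<Sum>u\<in>e. of_int (weight (\<sigma> ` e) (\<sigma> u)) * y u)"
  proof (rule sum.cong[OF refl])
    fix u assume u: "u \<in> e"
    have "of_int (weight (\<sigma> ` e) (\<sigma> u)) = of_int \<Delta> / (\<Prod>b\<in>\<sigma> ` e - {\<sigma> u}. of_int (\<theta> (\<sigma> u) - \<theta> b) :: rat)"
      by (rule rat_weight) (use edge_F[OF colouring_inj_on_edge(2)[OF assms]] u in auto)
    thus "of_int \<Delta> * (y u / (\<Prod>v\<in>e - {u}. of_int (\<theta> (\<sigma> u) - \<theta> (\<sigma> v)))) = of_int (weight (\<sigma> ` e) (\<sigma> u)) * y u"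
      unfolding prod_nodes_image[OF assms u] by simp
  qed
  finally show ?thesis .
qed

lemma assoc_map_form:
  assumes "r_graph r H" "homomorphism H F \<sigma>" "e \<in> edges H"
  shows "of_int (form \<sigma> e y) = of_int \<Delta> * assoc_map \<theta> H \<sigma> (\<lambda>u. of_int (y u)) e"
  unfolding assoc_map_weight[OF assms] by (simp add: form_def)

lemma assoc_map_columns:
  assumes "r_graph r H"
  shows "assoc_map \<theta> H \<sigma> y = (\<Sum>u\<in>verts H. scale_rat_fun (y u) (column H \<sigma> u))"
proof
  fix e
  show "assoc_map \<theta> H \<sigma> y e = (\<Sum>u\<in>verts H. scale_rat_fun (y u) (column H \<sigma> u)) e"
  proof (cases "e \<in> edges H")
    case True
    let ?D = "\<lambda>u. \<Prod>v\<in>e - {u}. of_int (\<theta> (\<sigma> u) - \<theta> (\<sigma> v)) :: rat"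
    have sub: "e \<subseteq> verts H" "finite (verts H)" "finite e"
      using True assms by (auto simp: r_graph_def intro: finite_subset)
    have col: "column H \<sigma> u e = (if u \<in> e then 1 / ?D u else 0)" for u
    proof -
      have "column H \<sigma> u e = (\<Sum>w\<in>e. if w = u then 1 / ?D u else 0)"
        using True by (auto simp: column_def assoc_map_def intro!: sum.cong)
      thus ?thesis using sub by simp
    qed
    have "(\<Sum>u\<in>verts H. scale_rat_fun (y u) (column H \<sigma> u)) e = (\<Sum>u\<in>verts H. if u \<in> e then y u / ?D u else 0)"
      unfolding sum_fun_at scale_rat_fun_def col by (rule sum.cong) auto
    also have "\<dots> = (\<Sum>u\<in>e. y u / ?D u)"
      using sub by (simp add: sum.If_cases Int_absorb1)
    finally show ?thesis using True by (simp add: assoc_map_def)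
  qed (simp add: sum_fun_at scale_rat_fun_def column_def assoc_map_def)
qed

lemma assoc_space_span:
  assumes "r_graph r H"
  shows "assoc_space \<theta> H \<sigma> = rat_fun.span (column H \<sigma> ` verts H)"
proof
  show "assoc_space \<theta> H \<sigma> \<subseteq> rat_fun.span (column H \<sigma> ` verts H)"
    unfolding assoc_space_def assoc_map_columns[OF assms]
    by (intro image_subsetI rat_fun.span_sum rat_fun.span_scale rat_fun.span_base imageI)
  have add: "assoc_map \<theta> H \<sigma> (\<lambda>u. y u + z u) = assoc_map \<theta> H \<sigma> y + assoc_map \<theta> H \<sigma> z" for y z
    by (rule ext) (simp add: assoc_map_def sum.distrib add_divide_distrib)
  have scale: "assoc_map \<theta> H \<sigma> (\<lambda>u. a * y u) = scale_rat_fun a (assoc_map \<theta> H \<sigma> y)" for a y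
    by (rule ext) (simp add: assoc_map_def sum_distrib_left scale_rat_fun_def)
  show "rat_fun.span (column H \<sigma> ` verts H) \<subseteq> assoc_space \<theta> H \<sigma>"
  proof (rule rat_fun.span_minimal)
    show "column H \<sigma> ` verts H \<subseteq> assoc_space \<theta> H \<sigma>"
      by (auto simp: column_def assoc_space_def rat_vectors_def)
    show "rat_fun.subspace (assoc_space \<theta> H \<sigma>)"
    proof (rule rat_fun.subspaceI)
      have "assoc_map \<theta> H \<sigma> (\<lambda>u. 0) = 0" by (rule ext) (simp add: assoc_map_def)
      thus "0 \<in> assoc_space \<theta> H \<sigma>"
        unfolding assoc_space_def by (intro image_eqI[of _ _ "\<lambda>u. 0"]) (auto simp: rat_vectors_def)
      fix x y assume "x \<in> assoc_space \<theta> H \<sigma>" "y \<in> assoc_space \<theta> H \<sigma>"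
      then obtain a b where ab: "x = assoc_map \<theta> H \<sigma> a" "a \<in> rat_vectors (verts H)"
        "y = assoc_map \<theta> H \<sigma> b" "b \<in> rat_vectors (verts H)" by (auto simp: assoc_space_def)
      show "x + y \<in> assoc_space \<theta> H \<sigma>" unfolding assoc_space_def ab add[symmetric]
        by (rule imageI) (use ab in \<open>auto simp: rat_vectors_def\<close>)
    next
      fix c x assume "x \<in> assoc_space \<theta> H \<sigma>"
      then obtain a where a: "x = assoc_map \<theta> H \<sigma> a" "a \<in> rat_vectors (verts H)" by (auto simp: assoc_space_def)
      show "scale_rat_fun c x \<in> assoc_space \<theta> H \<sigma>" unfolding assoc_space_def a scale[symmetric]
        by (rule imageI) (use a in \<open>auto simp: rat_vectors_def\<close>)
    qed
  qed
qed

lemma assoc_dim_le_spanning: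
  assumes "r_graph r H" "W \<subseteq> verts H" "column H \<sigma> ` verts H \<subseteq> rat_fun.span (column H \<sigma> ` W)"
  shows "assoc_dim \<theta> H \<sigma> \<le> card W"
proof -
  have fin: "finite W" using assms by (auto simp: r_graph_def intro: finite_subset)
  have "assoc_dim \<theta> H \<sigma> = rat_fun.dim (column H \<sigma> ` verts H)"
    unfolding assoc_dim_def assoc_space_span[OF assms(1)] by (rule rat_fun.dim_span)
  also have "\<dots> \<le> card (column H \<sigma> ` W)" by (rule rat_fun.dim_le_card[OF assms(3)]) (use fin in simp)
  also have "\<dots> \<le> card W" by (rule card_image_le[OF fin])
  finally show ?thesis .
qed

lemma column_basis:
  assumes "r_graph r H"
  shows "\<exists>U\<subseteq>verts H. inj_on (column H \<sigma>) U \<and> rat_fun.independent (column H \<sigma> ` U) \<and> card U = assoc_dim \<theta> H \<sigma>"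
proof -
  obtain B where B: "B \<subseteq> column H \<sigma> ` verts H" "rat_fun.independent B"
    "card B = rat_fun.dim (column H \<sigma> ` verts H)"
    using rat_fun.basis_exists by metis
  obtain U where U: "U \<subseteq> verts H" "inj_on (column H \<sigma>) U" "B = column H \<sigma> ` U"
    using B(1) by (metis subset_image_inj)
  have "card U = assoc_dim \<theta> H \<sigma>"
    unfolding assoc_dim_def assoc_space_span[OF assms] rat_fun.dim_span
    using B(3) U(2,3) by (simp add: card_image)
  thus ?thesis using U B(2) by blast
qed

text \<open>
Let the columns at \<open>U\<close> be a basis of the image of \<open>D\<close>. Dual functionals to these columns recover the coordinates
at \<open>U\<close> of a vector supported on \<open>U\<close> from its image under \<open>D\<close>. After clearing denominators by \<open>d\<close> this
is an identity of integers, which can be read modulo every \<open>M\<close> prime to \<open>d\<close> and \<open>\<Delta>\<close>. Thus fibres of \<open>D\<close> modulo \<open>M\<close>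
are not larger than its kernel over the rationals suggests.
\<close>

lemma kernel_mod_free_coordinates:
  assumes H: "r_graph r H" "homomorphism H F \<sigma>"
  shows "\<exists>U\<subseteq>verts H. card U = assoc_dim \<theta> H \<sigma> \<and> (\<exists>d::int. d \<noteq> 0 \<and>
    (\<forall>M z. coprime M (d * \<Delta>) \<longrightarrow> (\<forall>e\<in>edges H. M dvd form \<sigma> e z) \<longrightarrow>
       (\<forall>v\<in>verts H - U. z v = 0) \<longrightarrow> (\<forall>u\<in>U. M dvd z u)))"
proof -
  have fin: "finite (verts H)" "finite (edges H)" using H r_graph_finite_edges by (auto simp: r_graph_def)
  obtain U where U: "U \<subseteq> verts H" "inj_on (column H \<sigma>) U" "rat_fun.independent (column H \<sigma> ` U)"
    "card U = assoc_dim \<theta> H \<sigma>" using column_basis[OF H(1)] by blast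
  have finU: "finite U" using U(1) fin(1) finite_subset by blast
  \<comment> \<open>The dual functionals are coordinates with respect to a basis of the whole space that extends the chosen columns.\<close>
  define BB where "BB = rat_fun.extend_basis (column H \<sigma> ` U)"
  have BB: "column H \<sigma> ` U \<subseteq> BB" "rat_fun.independent BB" "rat_fun.span BB = UNIV"
    unfolding BB_def using rat_fun.extend_basis_superset[OF U(3)] rat_fun.independent_extend_basis[OF U(3)]
      rat_fun.span_extend_basis[OF U(3)] by auto
  define unit :: "'a set \<Rightarrow> 'a set \<Rightarrow> rat" where "unit = (\<lambda>e e'. if e' = e then 1 else 0)"
  define \<phi> where "\<phi> = (\<lambda>u e. rat_fun.representation BB (unit e) (column H \<sigma> u))"
  have dual: "(\<Sum>e\<in>edges H. column H \<sigma> u' e * \<phi> u e) = (if u' = u then 1 else 0)"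
    if u: "u \<in> U" "u' \<in> U" for u u'
  proof -
    have "column H \<sigma> u' = (\<Sum>e\<in>edges H. scale_rat_fun (column H \<sigma> u' e) (unit e))"
    proof
      fix e
      have "(\<Sum>e'\<in>edges H. scale_rat_fun (column H \<sigma> u' e') (unit e')) e
          = (\<Sum>e'\<in>edges H. if e = e' then column H \<sigma> u' e' else 0)"
        by (simp add: sum_fun_at scale_rat_fun_def unit_def if_distrib cong: if_cong)
      also have "\<dots> = column H \<sigma> u' e" using fin by (simp add: column_def assoc_map_def)
      finally show "column H \<sigma> u' e = (\<Sum>e'\<in>edges H. scale_rat_fun (column H \<sigma> u' e') (unit e')) e" by simp
    qed
    hence "rat_fun.representation BB (column H \<sigma> u') (column H \<sigma> u)
        = rat_fun.representation BB (\<Sum>e\<in>edges H. scale_rat_fun (column H \<sigma> u' e) (unit e)) (column H \<sigma> u)" by simp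
    also have "\<dots> = (\<Sum>e\<in>edges H. column H \<sigma> u' e * \<phi> u e)"
      by (simp add: rat_fun.representation_sum[OF BB(2)] rat_fun.representation_scale[OF BB(2)] BB(3) \<phi>_def)
    finally have "(\<Sum>e\<in>edges H. column H \<sigma> u' e * \<phi> u e)
        = rat_fun.representation BB (column H \<sigma> u') (column H \<sigma> u)" by simp
    also have "\<dots> = (if column H \<sigma> u = column H \<sigma> u' then 1 else 0)"
      using rat_fun.representation_basis[OF BB(2), of "column H \<sigma> u'"] BB(1) u by auto
    also have "column H \<sigma> u = column H \<sigma> u' \<longleftrightarrow> u' = u" using u U(2) by (auto simp: inj_on_def)
    finally show ?thesis .
  qed
  have "finite ((\<lambda>(u, e). \<phi> u e) ` (U \<times> edges H))" using finU fin by simp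
  from common_denominator[OF this] obtain d :: int where d: "d \<noteq> 0"
    "\<forall>x\<in>(\<lambda>(u, e). \<phi> u e) ` (U \<times> edges H). \<exists>z::int. of_int d * x = of_int z"
    by (elim exE conjE) (rule that)
  define \<psi> where "\<psi> = (\<lambda>u e. \<lfloor>of_int d * \<phi> u e\<rfloor>)"
  have psi: "of_int (\<psi> u e) = of_int d * \<phi> u e" if "u \<in> U" "e \<in> edges H" for u e
  proof -
    have "\<phi> u e \<in> (\<lambda>(u, e). \<phi> u e) ` (U \<times> edges H)" using that by force
    with d(2) obtain z :: int where "of_int d * \<phi> u e = of_int z" by blast
    thus ?thesis by (simp add: \<psi>_def)
  qed
  have "M dvd z u" if M: "coprime M (d * \<Delta>)" and dv: "\<forall>e\<in>edges H. M dvd form \<sigma> e z"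
    and z: "\<forall>v\<in>verts H - U. z v = 0" and u: "u \<in> U" for M z u
  proof -
    have fz: "of_int (form \<sigma> e z) = of_int \<Delta> * (\<Sum>v\<in>U. of_int (z v) * column H \<sigma> v e)" if e: "e \<in> edges H" for e
    proof -
      have "assoc_map \<theta> H \<sigma> (\<lambda>u. of_int (z u)) e = (\<Sum>v\<in>verts H. of_int (z v) * column H \<sigma> v e)"
        unfolding assoc_map_columns[OF H(1)] by (simp add: sum_fun_at scale_rat_fun_def)
      also have "\<dots> = (\<Sum>v\<in>U. of_int (z v) * column H \<sigma> v e)"
        by (rule sum.mono_neutral_right) (use fin U(1) z in auto)
      finally show ?thesis unfolding assoc_map_form[OF H e] by simp
    qed
    have "of_int (\<Sum>e\<in>edges H. \<psi> u e * form \<sigma> e z)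
        = (\<Sum>e\<in>edges H. (of_int d * \<phi> u e) * (of_int \<Delta> * (\<Sum>v\<in>U. of_int (z v) * column H \<sigma> v e)) :: rat)"
      unfolding of_int_sum of_int_mult by (rule sum.cong[OF refl]) (simp add: psi[OF u] fz)
    also have "\<dots> = (\<Sum>e\<in>edges H. \<Sum>v\<in>U. of_int (d * \<Delta>) * of_int (z v) * (column H \<sigma> v e * \<phi> u e))"
      by (simp add: sum_distrib_left mult_ac)
    also have "\<dots> = (\<Sum>v\<in>U. of_int (d * \<Delta>) * of_int (z v) * (\<Sum>e\<in>edges H. column H \<sigma> v e * \<phi> u e))"
      by (subst sum.swap) (simp add: sum_distrib_left)
    also have "\<dots> = (\<Sum>v\<in>U. of_int (d * \<Delta>) * of_int (z v) * (if v = u then 1 else 0))"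
      by (rule sum.cong[OF refl]) (simp add: dual[OF u])
    also have "\<dots> = of_int (d * \<Delta> * z u)" using finU u by (simp add: if_distrib cong: if_cong)
    finally have "(\<Sum>e\<in>edges H. \<psi> u e * form \<sigma> e z) = d * \<Delta> * z u" unfolding of_int_eq_iff .
    moreover have "M dvd (\<Sum>e\<in>edges H. \<psi> u e * form \<sigma> e z)" by (intro dvd_sum dvd_mult) (use dv in blast)
    ultimately show "M dvd z u" using M coprime_dvd_mult_right_iff by metis
  qed
  thus ?thesis using U(1,4) d(1) by blast
qed

lemma matrix_annihilates_forms:
  assumes H: "r_graph r H" "homomorphism H F \<sigma>"
    and B: "associated_matrix \<theta> H \<sigma> B" and i: "i < card (edges H) - assoc_dim \<theta> H \<sigma>"
  shows "(\<Sum>e\<in>edges H. B i e * form \<sigma> e y) = 0"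
proof -
  define y' where "y' = (\<lambda>u. if u \<in> verts H then of_int (y u) else 0 :: rat)"
  have "assoc_map \<theta> H \<sigma> y' \<in> rat_kernel (assoc_rows \<theta> H \<sigma>) (edges H) B"
    using B by (auto simp: associated_matrix_def assoc_space_def rat_vectors_def y'_def)
  hence 0: "(\<Sum>e\<in>edges H. of_int (B i e) * assoc_map \<theta> H \<sigma> y' e) = 0"
    using i by (simp add: rat_kernel_def assoc_rows_def)
  have "of_int (\<Sum>e\<in>edges H. B i e * form \<sigma> e y) = (\<Sum>e\<in>edges H. of_int \<Delta> * (of_int (B i e) * assoc_map \<theta> H \<sigma> y' e))"
    unfolding of_int_sum
  proof (rule sum.cong[OF refl])
    fix e assume e: "e \<in> edges H"
    have "assoc_map \<theta> H \<sigma> (\<lambda>u. of_int (y u)) e = assoc_map \<theta> H \<sigma> y' e"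
      using e H(1) by (auto simp: assoc_map_def y'_def r_graph_def subset_iff intro!: sum.cong)
    thus "of_int (B i e * form \<sigma> e y) = of_int \<Delta> * (of_int (B i e) * assoc_map \<theta> H \<sigma> y' e)"
      using assoc_map_form[OF H e, of y] by simp
  qed
  also have "\<dots> = of_int 0" by (simp only: sum_distrib_left[symmetric] 0 mult_zero_right of_int_0)
  finally show ?thesis unfolding of_int_eq_iff .
qed

text \<open>
The divided difference of order \<open>r - 1\<close> of the power \<open>r - 1\<close> is 1, so the all-one vector is in the image of \<open>D\<close>.
\<close>

lemma translation_invariant:
  assumes H: "r_graph r H" "homomorphism H F \<sigma>"
    and B: "associated_matrix \<theta> H \<sigma> B" and i: "i < card (edges H) - assoc_dim \<theta> H \<sigma>"
  shows "(\<Sum>e\<in>edges H. B i e) = 0"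
proof -
  have "form \<sigma> e (\<lambda>u. \<theta> (\<sigma> u) ^ (r - 1)) = \<Delta>" if e: "e \<in> edges H" for e
  proof -
    note ie = colouring_inj_on_edge[OF H e]
    have "form \<sigma> e (\<lambda>u. \<theta> (\<sigma> u) ^ (r - 1)) = (\<Sum>a\<in>\<sigma> ` e. weight (\<sigma> ` e) a * \<theta> a ^ (r - 1))"
      unfolding form_def sum.reindex[OF ie(1)] by simp
    also have "\<dots> = \<Delta>" using weighted_power_sum[of "\<sigma> ` e" "r - 1"] edge_F[OF ie(2)] r_ge_2 by simp
    finally show ?thesis .
  qed
  hence "(\<Sum>e\<in>edges H. B i e) * \<Delta> = 0"
    using matrix_annihilates_forms[OF H B i, of "\<lambda>u. \<theta> (\<sigma> u) ^ (r - 1)"] by (simp add: sum_distrib_right)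
  thus ?thesis using Delta_nonzero by simp
qed

end

section \<open>Components and the rank of the system\<close>

lemma same_component_successively:
  "same_component H x y \<longleftrightarrow> x = y \<or> (\<exists>es. es \<noteq> [] \<and> set es \<subseteq> edges H \<and> x \<in> hd es \<and> y \<in> last es \<and>
     successively (\<lambda>a b. a \<inter> b \<noteq> {}) es)"
  by (simp add: same_component_def successively_conv_nth)

lemma same_component_sym: "same_component H x y \<Longrightarrow> same_component H y x"
proof -
  assume "same_component H x y"
  then consider "x = y" | es where "es \<noteq> []" "set es \<subseteq> edges H" "x \<in> hd es" "y \<in> last es"
    "successively (\<lambda>a b. a \<inter> b \<noteq> {}) es" unfolding same_component_successively by blast
  thus ?thesis
  proof cases
    case 2
    have "successively (\<lambda>a b. a \<inter> b \<noteq> {}) (rev es)"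
      using 2(5) by (simp add: Int_commute)
    thus ?thesis unfolding same_component_successively using 2
      by (intro disjI2 exI[of _ "rev es"]) (simp add: hd_rev last_rev)
  qed (simp add: same_component_def)
qed

lemma same_component_trans: "same_component H x y \<Longrightarrow> same_component H y z \<Longrightarrow> same_component H x z"
proof -
  assume xy: "same_component H x y" and yz: "same_component H y z"
  show ?thesis
  proof (cases "x = y \<or> y = z")
    case False
    obtain es where es: "es \<noteq> []" "set es \<subseteq> edges H" "x \<in> hd es" "y \<in> last es"
      "successively (\<lambda>a b. a \<inter> b \<noteq> {}) es"
      using xy False unfolding same_component_successively by blast
    obtain es' where es': "es' \<noteq> []" "set es' \<subseteq> edges H" "y \<in> hd es'" "z \<in> last es'"
      "successively (\<lambda>a b. a \<inter> b \<noteq> {}) es'"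
      using yz False unfolding same_component_successively by blast
    have "successively (\<lambda>a b. a \<inter> b \<noteq> {}) (es @ es')"
      using es es' by (auto simp: successively_append_iff)
    thus ?thesis unfolding same_component_successively using es es'
      by (intro disjI2 exI[of _ "es @ es'"]) simp
  qed (use xy yz in auto)
qed

lemma same_component_edge: "e \<in> edges H \<Longrightarrow> x \<in> e \<Longrightarrow> y \<in> e \<Longrightarrow> same_component H x y"
  unfolding same_component_def by (intro disjI2 exI[of _ "[e]"]) simp

context interpolation begin

lemma rat_polynomial_sum_zero:
  assumes "T \<subseteq> {1..f}" "Suc (degree p) < card T"
  shows "(\<Sum>a\<in>T. poly p (of_int (\<theta> a)) / (\<Prod>b\<in>T - {a}. of_int (\<theta> a - \<theta> b))) = (0::rat)"
proof -
  let ?D = "\<lambda>a. \<Prod>b\<in>T - {a}. of_int (\<theta> a - \<theta> b) :: rat"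
  have "(\<Sum>a\<in>T. poly p (of_int (\<theta> a)) / ?D a) = (\<Sum>a\<in>T. \<Sum>i\<le>degree p. coeff p i * (of_int (\<theta> a) ^ i / ?D a))"
    by (simp add: poly_altdef sum_divide_distrib)
  also have "\<dots> = (\<Sum>i\<le>degree p. coeff p i * (\<Sum>a\<in>T. of_int (\<theta> a) ^ i / ?D a))"
    by (subst sum.swap) (simp add: sum_distrib_left)
  also have "\<dots> = (\<Sum>i\<le>degree p. 0)"
  proof (rule sum.cong[OF refl])
    fix i assume "i \<in> {..degree p}"
    hence "i < card T" "Suc i \<noteq> card T" using assms(2) by auto
    thus "coeff p i * (\<Sum>a\<in>T. of_int (\<theta> a) ^ i / ?D a) = 0" by (simp only: rat_power_sum[OF assms(1)] if_False mult_zero_right)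
  qed
  finally show ?thesis by simp
qed

text \<open>
In each component fix \<open>r - 1\<close> vertices of one edge. Their nodes are distinct, so for each of them there is a polynomial
of degree \<open>r - 2\<close> that vanishes at the others but not at it. Divided differences of order \<open>r - 1\<close> kill this polynomial on all edges of the
component, which expresses the column of that vertex by the columns of the vertices that were not fixed.
\<close>

lemma assoc_dim_le_components:
  assumes H: "r_graph r H" "homomorphism H F \<sigma>" and cover: "\<forall>v\<in>verts H. \<exists>e\<in>edges H. v \<in> e"
  shows "assoc_dim \<theta> H \<sigma> + num_components H * (r - 1) \<le> card (verts H)"
proof -
  define V where "V = verts H"
  define R where "R = {(x, y). x \<in> V \<and> y \<in> V \<and> same_component H x y}"
  have finV: "finite V" using H by (simp add: V_def r_graph_def)
  have eV: "e \<subseteq> V" if "e \<in> edges H" for e using that H by (auto simp: r_graph_def V_def)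
  have equiv: "equiv V R"
    by (rule equivI) (auto simp: R_def refl_on_def sym_def trans_def same_component_def[of H x x for x]
        intro: same_component_sym same_component_trans)
  have num: "num_components H = card (V // R)" by (simp add: num_components_def V_def R_def)
  have finQ: "finite (V // R)" by (rule finite_quotient[OF finV]) (auto simp: R_def)
  have QV: "Q \<subseteq> V" if "Q \<in> V // R" for Q using that by (auto simp: quotient_def R_def)
  have closed: "y \<in> Q" if Q: "Q \<in> V // R" and x: "x \<in> Q" and e: "e \<in> edges H" "x \<in> e" "y \<in> e" for Q x y e
  proof -
    have "(x, y) \<in> R" using eV[OF e(1)] e same_component_edge[OF e] by (auto simp: R_def)
    thus ?thesis using in_quotient_imp_closed[OF equiv Q x] by blast
  qed
  have "\<exists>e w. e \<in> edges H \<and> e \<subseteq> Q \<and> w \<subseteq> e \<and> card w = r - 1" if Q: "Q \<in> V // R" for Q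
  proof -
    obtain x where x: "x \<in> Q" using in_quotient_imp_non_empty[OF equiv Q] by blast
    obtain e where e: "e \<in> edges H" "x \<in> e" using x QV[OF Q] cover by (auto simp: V_def)
    have "e \<subseteq> Q" using closed[OF Q x e] by blast
    moreover obtain w where "w \<subseteq> e" "card w = r - 1"
      using obtain_subset_with_card_n[of "r - 1" e] colouring_inj_on_edge(4)[OF H e(1)] by auto
    ultimately show ?thesis using e(1) by blast
  qed
  hence "\<forall>Q\<in>V // R. \<exists>e w. e \<in> edges H \<and> e \<subseteq> Q \<and> w \<subseteq> e \<and> card w = r - 1" by blast
  then obtain E w where Ew: "\<And>Q. Q \<in> V // R \<Longrightarrow> E Q \<in> edges H \<and> E Q \<subseteq> Q \<and> w Q \<subseteq> E Q \<and> card (w Q) = r - 1"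
    by metis
  define W where "W = (\<Union>Q\<in>V // R. w Q)"
  have wQ: "w Q \<subseteq> Q" "finite (w Q)" if "Q \<in> V // R" for Q
    using Ew[OF that] QV[OF that] finV by (auto intro: finite_subset)
  have WV: "W \<subseteq> V" unfolding W_def using wQ(1) QV by blast
  have disj: "Q \<inter> Q' = {}" if "Q \<in> V // R" "Q' \<in> V // R" "Q \<noteq> Q'" for Q Q'
    using quotient_disj[OF equiv that(1,2)] that(3) by auto
  have "card W = (\<Sum>Q\<in>V // R. card (w Q))"
    unfolding W_def
  proof (rule card_UN_disjoint[OF finQ])
    show "\<forall>Q\<in>V // R. finite (w Q)" using wQ by blast
    show "\<forall>Q\<in>V // R. \<forall>Q'\<in>V // R. Q \<noteq> Q' \<longrightarrow> w Q \<inter> w Q' = {}" using wQ(1) disj by blast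
  qed
  also have "\<dots> = num_components H * (r - 1)" using Ew by (simp add: num)
  finally have cW: "card W = num_components H * (r - 1)" .
  have "column H \<sigma> x \<in> rat_fun.span (column H \<sigma> ` (V - W))" if x: "x \<in> V" for x
  proof (cases "x \<in> W")
    case False
    thus ?thesis using x by (intro rat_fun.span_base) auto
  next
    case True
    then obtain Q where Q: "Q \<in> V // R" "x \<in> w Q" by (auto simp: W_def)
    define t where "t = (\<lambda>u. of_int (\<theta> (\<sigma> u)) :: rat)"
    \<comment> \<open>It vanishes at all fixed vertices of the component except \<open>x\<close>.\<close>
    define p where "p = (\<Prod>b\<in>w Q - {x}. [:- t b, 1:])"
    define y where "y = (\<lambda>u. if u \<in> Q then poly p (t u) else 0)"
    note Qe = Ew[OF Q(1)]
    have degp: "Suc (degree p) < r"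
    proof -
      have "degree p = card (w Q - {x})" unfolding p_def by (subst degree_prod_sum_eq) auto
      also have "\<dots> = r - 2" using Q(2) wQ(2)[OF Q(1)] Qe by (simp add: card_Diff_singleton)
      finally show ?thesis using r_ge_2 by linarith
    qed
    have poly_p: "poly p z = (\<Prod>b\<in>w Q - {x}. z - t b)" for z by (simp add: p_def poly_prod)
    have "assoc_map \<theta> H \<sigma> y = 0"
    proof
      fix e
      show "assoc_map \<theta> H \<sigma> y e = 0 e"
      proof (cases "e \<in> edges H")
        case e: True
        note ie = colouring_inj_on_edge[OF H e]
        show ?thesis
        proof (cases "e \<inter> Q = {}")
          case True
          hence "y u = 0" if "u \<in> e" for u using that by (auto simp: y_def)
          thus ?thesis by (simp add: assoc_map_def)
        next
          case False
          then obtain z where z: "z \<in> e" "z \<in> Q" by blast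
          have eQ: "e \<subseteq> Q" using closed[OF Q(1) z(2) e z(1)] by blast
          have "assoc_map \<theta> H \<sigma> y e = (\<Sum>u\<in>e. poly p (t u) / (\<Prod>v\<in>e - {u}. of_int (\<theta> (\<sigma> u) - \<theta> (\<sigma> v))))"
            using e eQ by (auto simp: assoc_map_def y_def intro!: sum.cong)
          also have "\<dots> = (\<Sum>u\<in>e. poly p (of_int (\<theta> (\<sigma> u))) / (\<Prod>b\<in>\<sigma> ` e - {\<sigma> u}. of_int (\<theta> (\<sigma> u) - \<theta> b)))"
            by (rule sum.cong[OF refl]) (simp only: prod_nodes_image[OF H e] t_def)
          also have "\<dots> = (\<Sum>a\<in>\<sigma> ` e. poly p (of_int (\<theta> a)) / (\<Prod>b\<in>\<sigma> ` e - {a}. of_int (\<theta> a - \<theta> b)))"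
            by (simp only: sum.reindex[OF ie(1)] o_def)
          also have "\<dots> = 0" using rat_polynomial_sum_zero[of "\<sigma> ` e" p] edge_F[OF ie(2)] degp by simp
          finally show ?thesis by simp
        qed
      qed (simp add: assoc_map_def)
    qed
    hence "0 = (\<Sum>u\<in>V. scale_rat_fun (y u) (column H \<sigma> u))"
      using assoc_map_columns[OF H(1), of \<sigma> y] by (simp add: V_def)
    also have "\<dots> = scale_rat_fun (y x) (column H \<sigma> x) + (\<Sum>u\<in>V - {x}. scale_rat_fun (y u) (column H \<sigma> u))"
      by (rule sum.remove[OF finV x])
    also have "(\<Sum>u\<in>V - {x}. scale_rat_fun (y u) (column H \<sigma> u)) = (\<Sum>u\<in>V - W. scale_rat_fun (y u) (column H \<sigma> u))"
    proof (rule sum.mono_neutral_right)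
      show "V - W \<subseteq> V - {x}" using True by auto
      show "\<forall>u\<in>V - {x} - (V - W). scale_rat_fun (y u) (column H \<sigma> u) = 0"
      proof
        fix u assume u: "u \<in> V - {x} - (V - W)"
        then obtain Q' where Q': "Q' \<in> V // R" "u \<in> w Q'" by (auto simp: W_def)
        have "y u = 0"
        proof (cases "Q' = Q")
          case True
          hence "t u \<in> t ` (w Q - {x})" "u \<in> w Q - {x}" using Q' u by auto
          thus ?thesis using wQ(2)[OF Q(1)] by (auto simp: y_def poly_p prod_zero_iff)
        next
          case False
          thus ?thesis using disj[OF Q'(1) Q(1)] wQ(1)[OF Q'(1)] Q'(2) by (auto simp: y_def)
        qed
        thus "scale_rat_fun (y u) (column H \<sigma> u) = 0" by (simp add: scale_rat_fun_def fun_eq_iff)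
      qed
    qed (use finV in simp)
    finally have "scale_rat_fun (y x) (column H \<sigma> x) + (\<Sum>u\<in>V - W. scale_rat_fun (y u) (column H \<sigma> u)) = 0"
      by (rule sym)
    hence eq: "scale_rat_fun (y x) (column H \<sigma> x) = - (\<Sum>u\<in>V - W. scale_rat_fun (y u) (column H \<sigma> u))"
      by (simp only: eq_neg_iff_add_eq_0)
    have "\<dots> \<in> rat_fun.span (column H \<sigma> ` (V - W))"
      by (intro rat_fun.span_neg rat_fun.span_sum rat_fun.span_scale rat_fun.span_base imageI)
    hence "scale_rat_fun (1 / y x) (scale_rat_fun (y x) (column H \<sigma> x)) \<in> rat_fun.span (column H \<sigma> ` (V - W))"
      unfolding eq by (rule rat_fun.span_scale)
    moreover have "y x \<noteq> 0"
    proof -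
      note ie = colouring_inj_on_edge[OF H conjunct1[OF Qe]]
      have "t x \<noteq> t b" if "b \<in> w Q - {x}" for b
      proof -
        have "b \<in> E Q" "x \<in> E Q" "b \<noteq> x" using that Q(2) Qe by auto
        hence "\<sigma> b \<noteq> \<sigma> x" "\<sigma> b \<in> {1..f}" "\<sigma> x \<in> {1..f}"
          using inj_on_eq_iff[OF ie(1)] edge_F[OF ie(2)] by blast+
        hence "\<theta> (\<sigma> x) \<noteq> \<theta> (\<sigma> b)" using inj_on_eq_iff[OF inj_theta] by metis
        thus ?thesis by (simp add: t_def)
      qed
      moreover have "x \<in> Q" using Q(2) wQ(1)[OF Q(1)] by blast
      ultimately show ?thesis using wQ(2)[OF Q(1)] by (simp add: y_def poly_p prod_zero_iff)
    qed
    ultimately show ?thesis by (simp add: scale_rat_fun_def)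
  qed
  hence "assoc_dim \<theta> H \<sigma> \<le> card (V - W)"
    by (intro assoc_dim_le_spanning[OF H(1)]) (auto simp: V_def)
  also have "\<dots> = card V - card W" using WV finV by (simp add: card_Diff_subset finite_subset)
  finally show ?thesis using cW card_mono[OF finV WV] by (simp add: V_def)
qed

text \<open>
A zero matrix has rank 0, but the rank is the number of rows.
\<close>

lemma matrix_has_nonzero_row:
  assumes "associated_matrix \<theta> H \<sigma> B" "0 < card (edges H) - assoc_dim \<theta> H \<sigma>"
  shows "\<exists>i<card (edges H) - assoc_dim \<theta> H \<sigma>. \<exists>e\<in>edges H. B i e \<noteq> 0"
proof (rule ccontr)
  assume "\<not> ?thesis"
  hence "(\<lambda>i j. if j \<in> edges H then of_int (B i j) else 0) ` {..<assoc_rows \<theta> H \<sigma>} \<subseteq> {0 :: 'a set \<Rightarrow> rat}"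
    by (auto simp: assoc_rows_def fun_eq_iff)
  hence "rat_fun.dim ((\<lambda>i j. if j \<in> edges H then of_int (B i j) else 0) ` {..<assoc_rows \<theta> H \<sigma>} :: ('a set \<Rightarrow> rat) set) \<le> card ({} :: ('a set \<Rightarrow> rat) set)"
    by (intro rat_fun.dim_le_card) auto
  thus False using assms by (simp add: associated_matrix_def mat_rank_def assoc_rows_def)
qed

end

section \<open>Counting solutions\<close>

definition solutions_modulo :: "int \<Rightarrow> nat \<Rightarrow> 'i set \<Rightarrow> (nat \<Rightarrow> 'i \<Rightarrow> int) \<Rightarrow> int set \<Rightarrow> ('i \<Rightarrow> int) set" where
  "solutions_modulo M k I B A = {x \<in> I \<rightarrow>\<^sub>E A. \<forall>i<k. M dvd (\<Sum>j\<in>I. B i j * x j)}"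

lemma mod_solutions_eq: "mod_solutions p k I B A = solutions_modulo (int p) k I B A"
proof -
  have "(\<Sum>j\<in>I. (B i j mod int p) * x j) mod int p = 0 \<longleftrightarrow> int p dvd (\<Sum>j\<in>I. B i j * x j)" for i x
  proof -
    have "[(\<Sum>j\<in>I. (B i j mod int p) * x j) = (\<Sum>j\<in>I. B i j * x j)] (mod int p)"
      by (intro cong_sum cong_mult cong_refl) (simp add: cong_def)
    thus ?thesis by (simp add: cong_def dvd_eq_mod_eq_0)
  qed
  thus ?thesis by (simp add: mod_solutions_def solutions_modulo_def)
qed

context pattern begin

text \<open>
The polynomial hosts have pairs as vertices, and the counting arguments for them bound all homomorphisms, injective or
not; this is abundance in the form that applies to them.
\<close>

lemma abundance_for_homs:
  fixes H :: "'a hypergraph"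
  assumes "abundance_witness r F H \<sigma> c' C'" "r_graph r H" "0 < \<epsilon>" "\<epsilon> \<le> 1"
  shows "\<exists>n0. \<forall>(G :: 'b hypergraph) \<kappa>. host \<epsilon> G \<kappa> \<longrightarrow> card (verts G) \<ge> n0 \<longrightarrow>
    c' * \<epsilon> powr C' * real (card (verts G)) ^ card (verts H) \<le> real (card (coloured_homs H \<sigma> G \<kappa>))"
proof -
  obtain n0 where n0: "\<forall>(G :: nat hypergraph) \<kappa>.
          r_graph r G \<and> homomorphism G F \<kappa> \<and> card (verts G) \<ge> n0 \<and>
          uniformly_far_from_free r F \<epsilon> G \<kappa> \<longrightarrow>
            real (card (coloured_embeddings H \<sigma> G \<kappa>))
              \<ge> c' * \<epsilon> powr C' * real (card (verts G)) ^ card (verts H)"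
    using assms(1,3,4) unfolding abundance_witness_def by blast
  have finH: "finite (verts H)" using assms(2) by (simp add: r_graph_def)
  have "c' * \<epsilon> powr C' * real (card (verts G)) ^ card (verts H) \<le> real (card (coloured_homs H \<sigma> G \<kappa>))"
    if G: "host \<epsilon> G \<kappa>" "card (verts G) \<ge> n0" for G :: "'b hypergraph" and \<kappa>
  proof -
    obtain G' :: "nat hypergraph" and \<kappa>' h where G': "host \<epsilon> G' \<kappa>'"
      "bij_betw h (verts G') (verts G)" "homomorphism G' G h" and col: "\<forall>w\<in>verts G'. \<kappa> (h w) = \<kappa>' w"
      using host_relabel[OF G(1)] by (elim exE conjE) (rule that)
    have cG: "card (verts G') = card (verts G)" by (rule bij_betw_same_card[OF G'(2)])
    have "c' * \<epsilon> powr C' * real (card (verts G)) ^ card (verts H) \<le> real (card (coloured_embeddings H \<sigma> G' \<kappa>'))"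
      using n0[rule_format, of G' \<kappa>'] G'(1) G(2) cG by (simp add: host_def)
    also have "\<dots> \<le> real (card (coloured_homs H \<sigma> G' \<kappa>'))"
      unfolding of_nat_le_iff
      by (rule card_mono[OF finite_coloured_homs[OF finH host_finite[OF G'(1)]] coloured_embeddings_subset_homs])
    also have "\<dots> \<le> real (card (coloured_homs H \<sigma> G \<kappa>))"
      unfolding of_nat_le_iff
      by (rule card_coloured_homs_target[OF assms(2) host_finite[OF G(1)] G'(3) bij_betw_imp_inj_on[OF G'(2)]])
        (use col in blast)
    finally show ?thesis .
  qed
  thus ?thesis by blast
qed

end

context interpolation begin

text \<open>
A homomorphism is recovered from its heights, which solve the system because \<open>B\<close> kills the image of \<open>D\<close>, together with
its coordinates outside \<open>U\<close>.
\<close>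

lemma card_proper_homs:
  fixes H :: "'a hypergraph"
  assumes H: "r_graph r H" "homomorphism H F \<sigma>" and B: "associated_matrix \<theta> H \<sigma> B"
    and M: "M > 0" "coprime M (d * \<Delta>)" and A: "A \<subseteq> {0..<M}"
    and U: "U \<subseteq> verts H" "card U = assoc_dim \<theta> H \<sigma>"
    and ker: "\<forall>M z. coprime M (d * \<Delta>) \<longrightarrow> (\<forall>e\<in>edges H. M dvd form \<sigma> e z) \<longrightarrow>
       (\<forall>v\<in>verts H - U. z v = 0) \<longrightarrow> (\<forall>u\<in>U. M dvd z u)"
  defines "k \<equiv> card (edges H) - assoc_dim \<theta> H \<sigma>"
  shows "card {\<phi> \<in> coloured_homs H \<sigma> (alg_host M A) fst. inj_on (height M A \<sigma> \<phi>) (edges H)}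
    \<le> card {x \<in> solutions_modulo M k (edges H) B A. inj_on x (edges H)} * nat M ^ (card (verts H) - assoc_dim \<theta> H \<sigma>)"
proof -
  define V where "V = verts H"
  define I where "I = edges H"
  have fin: "finite V" "finite I" "finite A"
    using H r_graph_finite_edges A by (auto simp: V_def I_def r_graph_def intro: finite_subset)
  have copr: "coprime M \<Delta>" using M(2) by simp
  let ?X = "{\<phi> \<in> coloured_homs H \<sigma> (alg_host M A) fst. inj_on (height M A \<sigma> \<phi>) (edges H)}"
  let ?S = "{x \<in> solutions_modulo M k I B A. inj_on x I}"
  define h where "h = (\<lambda>\<phi>. (restrict (height M A \<sigma> \<phi>) I, restrict (\<lambda>v. snd (\<phi> v)) (V - U)))"
  have "card ?X \<le> card (?S \<times> ((V - U) \<rightarrow>\<^sub>E {0..<M}))"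
  proof (rule card_inj_on_le[where f = h])
    have "finite (I \<rightarrow>\<^sub>E A)" using fin by (intro finite_PiE) auto
    hence "finite ?S" by (rule finite_subset[rotated]) (auto simp: solutions_modulo_def)
    thus "finite (?S \<times> ((V - U) \<rightarrow>\<^sub>E {0..<M}))" using fin by (intro finite_cartesian_product finite_PiE) auto
    show "h ` ?X \<subseteq> ?S \<times> ((V - U) \<rightarrow>\<^sub>E {0..<M})"
    proof (rule image_subsetI)
      fix \<phi> assume p: "\<phi> \<in> ?X"
      hence p': "\<phi> \<in> coloured_homs H \<sigma> (alg_host M A) fst" by simp
      let ?x = "height M A \<sigma> \<phi>"
      note hh = alg_hom[OF H p']
      have "M dvd (\<Sum>e\<in>I. B i e * restrict ?x I e)" if i: "i < k" for i
      proof -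
        have "M dvd (\<Sum>e\<in>I. B i e * (form \<sigma> e (snd \<circ> \<phi>) - \<Delta> * ?x e))"
          by (intro dvd_sum dvd_mult) (use hh(2) in \<open>simp add: I_def\<close>)
        also have "(\<Sum>e\<in>I. B i e * (form \<sigma> e (snd \<circ> \<phi>) - \<Delta> * ?x e)) = 0 - \<Delta> * (\<Sum>e\<in>I. B i e * ?x e)"
          using matrix_annihilates_forms[OF H B i[unfolded k_def], of "snd \<circ> \<phi>"]
          by (simp add: I_def right_diff_distrib sum_subtractf sum_distrib_left mult_ac)
        finally have "M dvd \<Delta> * (\<Sum>e\<in>I. B i e * ?x e)" by simp
        hence "M dvd (\<Sum>e\<in>I. B i e * ?x e)" using copr coprime_dvd_mult_right_iff by blast
        thus ?thesis by simp
      qed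
      moreover have "?x e \<in> A" if "e \<in> I" for e using hh(2) that by (simp add: I_def)
      moreover have "snd (\<phi> v) \<in> {0..<M}" if "v \<in> V" for v using hh(1) that by (simp add: V_def)
      moreover have "inj_on (restrict ?x I) I" using p by (simp add: I_def inj_on_def)
      ultimately show "h \<phi> \<in> ?S \<times> ((V - U) \<rightarrow>\<^sub>E {0..<M})" by (simp add: h_def solutions_modulo_def)
    qed
    show "inj_on h ?X"
    proof (rule inj_onI)
      fix \<phi> \<phi>' assume a: "\<phi> \<in> ?X" "\<phi>' \<in> ?X" "h \<phi> = h \<phi>'"
      have p: "\<phi> \<in> coloured_homs H \<sigma> (alg_host M A) fst" "\<phi>' \<in> coloured_homs H \<sigma> (alg_host M A) fst"
        using a by auto
      have eqA: "height M A \<sigma> \<phi> e = height M A \<sigma> \<phi>' e" if "e \<in> edges H" for e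
        using fun_cong[OF arg_cong[OF a(3), of fst], of e] that by (simp add: h_def I_def)
      have eqV: "snd (\<phi> v) = snd (\<phi>' v)" if "v \<in> V - U" for v
        using fun_cong[OF arg_cong[OF a(3), of snd], of v] that by (simp add: h_def)
      define z where "z = (\<lambda>v. snd (\<phi> v) - snd (\<phi>' v))"
      have "M dvd form \<sigma> e z" if e: "e \<in> edges H" for e
      proof -
        have "M dvd (form \<sigma> e (snd \<circ> \<phi>) - \<Delta> * height M A \<sigma> \<phi> e) - (form \<sigma> e (snd \<circ> \<phi>') - \<Delta> * height M A \<sigma> \<phi>' e)"
          by (rule dvd_diff[OF conjunct2[OF alg_hom(2)[OF H p(1) e]] conjunct2[OF alg_hom(2)[OF H p(2) e]]])
        moreover have "form \<sigma> e z = form \<sigma> e (snd \<circ> \<phi>) - form \<sigma> e (snd \<circ> \<phi>')"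
          by (simp add: form_def z_def right_diff_distrib sum_subtractf)
        ultimately show ?thesis using eqA[OF e] by simp
      qed
      moreover have "\<forall>v\<in>verts H - U. z v = 0" using eqV by (simp add: z_def V_def)
      ultimately have dU: "\<forall>u\<in>U. M dvd z u" using ker M(2) by blast
      show "\<phi> = \<phi>'"
      proof (rule alg_hom_eqI[OF H p])
        fix v assume v: "v \<in> verts H"
        show "snd (\<phi> v) = snd (\<phi>' v)"
        proof (cases "v \<in> U")
          case True
          hence "M dvd 1 * (snd (\<phi> v) - snd (\<phi>' v))" using dU by (simp add: z_def)
          thus ?thesis
            using mod_eq_cancel[of M 1 "snd (\<phi> v)" "snd (\<phi>' v)"] alg_hom(1)[OF H p(1) v] alg_hom(1)[OF H p(2) v]
            by simp
        next
          case False
          thus ?thesis using eqV v by (simp add: V_def)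
        qed
      qed
    qed
  qed
  also have "\<dots> = card ?S * nat M ^ (card V - assoc_dim \<theta> H \<sigma>)"
    using fin U by (simp add: card_cartesian_product card_PiE card_Diff_subset finite_subset V_def)
  finally show ?thesis by (simp add: V_def I_def)
qed

text \<open>
Two distinct edges differ in a vertex \<open>u\<close>. If their heights agree, the value at \<open>u\<close> is determined by the other values.
\<close>

lemma card_improper_homs:
  fixes H :: "'a hypergraph"
  assumes H: "r_graph r H" "homomorphism H F \<sigma>"
    and M: "M > 0" "coprime M \<Delta>" and A: "A \<subseteq> {0..<M}"
  shows "card {\<phi> \<in> coloured_homs H \<sigma> (alg_host M A) fst. \<not> inj_on (height M A \<sigma> \<phi>) (edges H)}
    \<le> card (edges H) ^ 2 * nat M ^ (card (verts H) - 1)"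
proof -
  define V where "V = verts H"
  define CH where "CH = coloured_homs H \<sigma> (alg_host M A) fst"
  define P where "P = {(e, e') \<in> edges H \<times> edges H. e \<noteq> e'}"
  define X where "X = (\<lambda>(e, e'). {\<phi> \<in> CH. height M A \<sigma> \<phi> e = height M A \<sigma> \<phi> e'})"
  have fin: "finite V" "finite (edges H)"
    using H r_graph_finite_edges by (auto simp: V_def r_graph_def)
  have finP: "finite P" unfolding P_def by (rule finite_subset[of _ "edges H \<times> edges H"]) (use fin in auto)
  have finCH: "finite CH" unfolding CH_def using H
    by (intro finite_coloured_homs) (auto simp: r_graph_def alg_host_def)
  have eV: "e \<subseteq> V" if "e \<in> edges H" for e using that H by (auto simp: r_graph_def V_def)
  have cX: "card (X q) \<le> nat M ^ (card V - 1)" if q0: "q \<in> P" for q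
  proof -
    obtain e e' where q: "q = (e, e')" "e \<in> edges H" "e' \<in> edges H" "e \<noteq> e'" using q0 by (auto simp: P_def)
    have "\<not> e \<subseteq> e'"
      using colouring_inj_on_edge(3,4)[OF H q(2)] colouring_inj_on_edge(3,4)[OF H q(3)] q(4) card_subset_eq by metis
    then obtain u where u: "u \<in> e" "u \<notin> e'" by blast
    have uV: "u \<in> V" using u eV q by auto
    have "card (X q) \<le> card ((V - {u}) \<rightarrow>\<^sub>E {0..<M})"
    proof (rule card_inj_on_le[where f = "\<lambda>\<phi>. restrict (\<lambda>v. snd (\<phi> v)) (V - {u})"])
      show "finite ((V - {u}) \<rightarrow>\<^sub>E {0..<M})" using fin by (intro finite_PiE) auto
      show "(\<lambda>\<phi>. restrict (\<lambda>v. snd (\<phi> v)) (V - {u})) ` X q \<subseteq> (V - {u}) \<rightarrow>\<^sub>E {0..<M}"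
      proof (rule image_subsetI)
        fix \<phi> assume "\<phi> \<in> X q"
        hence "\<phi> \<in> coloured_homs H \<sigma> (alg_host M A) fst" by (simp add: X_def q CH_def)
        from alg_hom(1)[OF H this] show "restrict (\<lambda>v. snd (\<phi> v)) (V - {u}) \<in> (V - {u}) \<rightarrow>\<^sub>E {0..<M}"
          by (simp add: V_def)
      qed
      show "inj_on (\<lambda>\<phi>. restrict (\<lambda>v. snd (\<phi> v)) (V - {u})) (X q)"
      proof (rule inj_onI)
        fix \<phi> \<phi>' assume a: "\<phi> \<in> X q" "\<phi>' \<in> X q"
          "restrict (\<lambda>v. snd (\<phi> v)) (V - {u}) = restrict (\<lambda>v. snd (\<phi>' v)) (V - {u})"
        have p: "\<phi> \<in> coloured_homs H \<sigma> (alg_host M A) fst" "\<phi>' \<in> coloured_homs H \<sigma> (alg_host M A) fst"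
          and same: "height M A \<sigma> \<phi> e = height M A \<sigma> \<phi> e'" "height M A \<sigma> \<phi>' e = height M A \<sigma> \<phi>' e'"
          using a(1,2) by (auto simp: X_def q CH_def)
        have eqV: "snd (\<phi> v) = snd (\<phi>' v)" if "v \<in> V" "v \<noteq> u" for v
          using fun_cong[OF a(3), of v] that by simp
        have both: "M dvd form \<sigma> e (snd \<circ> \<chi>) - form \<sigma> e' (snd \<circ> \<chi>)"
          if c: "\<chi> \<in> coloured_homs H \<sigma> (alg_host M A) fst" "height M A \<sigma> \<chi> e = height M A \<sigma> \<chi> e'" for \<chi>
        proof -
          have "M dvd (form \<sigma> e (snd \<circ> \<chi>) - \<Delta> * height M A \<sigma> \<chi> e) - (form \<sigma> e' (snd \<circ> \<chi>) - \<Delta> * height M A \<sigma> \<chi> e')"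
            by (rule dvd_diff[OF conjunct2[OF alg_hom(2)[OF H c(1) q(2)]] conjunct2[OF alg_hom(2)[OF H c(1) q(3)]]])
          thus ?thesis using c(2) by simp
        qed
        have "form \<sigma> e' (snd \<circ> \<phi>) = form \<sigma> e' (snd \<circ> \<phi>')"
          unfolding form_def
        proof (rule sum.cong[OF refl])
          fix v assume "v \<in> e'"
          hence "snd (\<phi> v) = snd (\<phi>' v)" using u(2) eV[OF q(3)] eqV[of v] by blast
          thus "weight (\<sigma> ` e') (\<sigma> v) * (snd \<circ> \<phi>) v = weight (\<sigma> ` e') (\<sigma> v) * (snd \<circ> \<phi>') v" by simp
        qed
        hence dv: "M dvd form \<sigma> e (snd \<circ> \<phi>) - form \<sigma> e (snd \<circ> \<phi>')"
          using dvd_diff[OF both[OF p(1) same(1)] both[OF p(2) same(2)]] by simp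
        have "(snd \<circ> \<phi>) u = (snd \<circ> \<phi>') u"
        proof (rule form_eq_imp_eq[OF M(2) H q(2) u(1) dv])
          show "(snd \<circ> \<phi>) v = (snd \<circ> \<phi>') v" if "v \<in> e" "v \<noteq> u" for v
            using eqV[of v] that eV[OF q(2)] by auto
          show "(snd \<circ> \<phi>) u \<in> {0..<M}" "(snd \<circ> \<phi>') u \<in> {0..<M}"
            using alg_hom(1)[OF H p(1)] alg_hom(1)[OF H p(2)] uV by (simp_all add: V_def)
        qed
        thus "\<phi> = \<phi>'"
          by (intro alg_hom_eqI[OF H p]) (metis V_def comp_apply eqV)
      qed
    qed
    also have "\<dots> = nat M ^ (card V - 1)" using fin uV by (simp add: card_PiE card_Diff_singleton)
    finally show ?thesis .
  qed
  have "{\<phi> \<in> CH. \<not> inj_on (height M A \<sigma> \<phi>) (edges H)} \<subseteq> (\<Union>q\<in>P. X q)"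
  proof
    fix \<phi> assume p: "\<phi> \<in> {\<phi> \<in> CH. \<not> inj_on (height M A \<sigma> \<phi>) (edges H)}"
    then obtain e e' where "e \<in> edges H" "e' \<in> edges H" "e \<noteq> e'" "height M A \<sigma> \<phi> e = height M A \<sigma> \<phi> e'"
      unfolding inj_on_def by blast
    thus "\<phi> \<in> (\<Union>q\<in>P. X q)" using p by (intro UN_I[of "(e, e')"]) (simp_all add: P_def X_def)
  qed
  hence "card {\<phi> \<in> CH. \<not> inj_on (height M A \<sigma> \<phi>) (edges H)} \<le> card (\<Union>q\<in>P. X q)"
    by (rule card_mono[rotated]) (use finP finCH in \<open>simp add: X_def split_def\<close>)
  also have "\<dots> \<le> (\<Sum>q\<in>P. card (X q))" by (rule card_UN_le[OF finP])
  also have "\<dots> \<le> (\<Sum>q\<in>P. nat M ^ (card V - 1))" by (rule sum_mono[OF cX])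
  also have "\<dots> = card P * nat M ^ (card V - 1)" by simp
  also have "\<dots> \<le> card (edges H) ^ 2 * nat M ^ (card V - 1)"
  proof (rule mult_right_mono)
    have "card P \<le> card (edges H \<times> edges H)" by (rule card_mono) (use fin in \<open>auto simp: P_def\<close>)
    thus "card P \<le> card (edges H) ^ 2" by (simp add: power2_eq_square card_cartesian_product)
  qed simp
  finally show ?thesis by (simp add: V_def CH_def)
qed

text \<open>
The number of homomorphisms is at least of order \<open>M ^ v\<close> by abundance. The improper ones, of order
\<open>M ^ (v - 1)\<close>, are at most half of this for large \<open>M\<close>, and each proper solution accounts for at most
\<open>M ^ (v - s)\<close> of the rest.
\<close>

lemma many_proper_solutions:
  fixes H :: "'a hypergraph"
  assumes H: "r_graph r H" "homomorphism H F \<sigma>" and B: "associated_matrix \<theta> H \<sigma> B"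
    and w: "abundance_witness r F H \<sigma> c' C'"
  defines "k \<equiv> card (edges H) - assoc_dim \<theta> H \<sigma>"
  shows "\<exists>K::int. K \<noteq> 0 \<and> (\<forall>\<delta>. 0 < \<delta> \<longrightarrow> \<delta> \<le> 1 \<longrightarrow> (\<exists>M0. \<forall>M A. M \<ge> M0 \<longrightarrow> coprime M K \<longrightarrow>
    A \<subseteq> {0..<M} \<longrightarrow> real (card A) \<ge> \<delta> * real_of_int M \<longrightarrow>
    c' / 2 * (\<delta> / real f ^ (r - 1)) powr C' * real_of_int M ^ assoc_dim \<theta> H \<sigma>
      \<le> real (card {x \<in> solutions_modulo M k (edges H) B A. inj_on x (edges H)})))"
proof -
  obtain U d where U: "U \<subseteq> verts H" "card U = assoc_dim \<theta> H \<sigma>" and d: "d \<noteq> (0::int)"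
    and ker: "\<forall>M z. coprime M (d * \<Delta>) \<longrightarrow> (\<forall>e\<in>edges H. M dvd form \<sigma> e z) \<longrightarrow>
       (\<forall>v\<in>verts H - U. z v = 0) \<longrightarrow> (\<forall>u\<in>U. M dvd z u)"
    using kernel_mod_free_coordinates[OF H] by (elim exE conjE) (rule that)
  define v where "v = card (verts H)"
  define s where "s = assoc_dim \<theta> H \<sigma>"
  define m where "m = card (edges H)"
  have c': "c' > 0" using w by (simp add: abundance_witness_def)
  have finH: "finite (verts H)" "finite (edges H)" using H r_graph_finite_edges by (auto simp: r_graph_def)
  have sv: "s \<le> v" using card_mono[OF finH(1) U(1)] U(2) by (simp add: s_def v_def)
  have "\<exists>M0. \<forall>M A. M \<ge> M0 \<longrightarrow> coprime M (d * \<Delta>) \<longrightarrow> A \<subseteq> {0..<M} \<longrightarrow> real (card A) \<ge> \<delta> * real_of_int M \<longrightarrow>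
    c' / 2 * (\<delta> / real f ^ (r - 1)) powr C' * real_of_int M ^ s
      \<le> real (card {x \<in> solutions_modulo M k (edges H) B A. inj_on x (edges H)})"
    if \<delta>: "0 < \<delta>" "\<delta> \<le> 1" for \<delta>
  proof -
    define \<epsilon> where "\<epsilon> = \<delta> / real f ^ (r - 1)"
    have fr: "real f ^ (r - 1) \<ge> 1" using f_pos by (intro one_le_power) auto
    have "\<delta> \<le> real f ^ (r - 1)" using \<delta> fr by linarith
    hence e: "0 < \<epsilon>" "\<epsilon> \<le> 1" using \<delta> f_pos by (auto simp: \<epsilon>_def divide_le_eq)
    obtain n0 where n0: "\<forall>(G :: (nat \<times> int) hypergraph) \<kappa>. host \<epsilon> G \<kappa> \<longrightarrow> card (verts G) \<ge> n0 \<longrightarrow>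
      c' * \<epsilon> powr C' * real (card (verts G)) ^ v \<le> real (card (coloured_homs H \<sigma> G \<kappa>))"
      using abundance_for_homs[OF w H(1) e] unfolding v_def by blast
    define a where "a = c' * \<epsilon> powr C'"
    have apos: "a > 0" using c' e by (simp add: a_def)
    define M0 where "M0 = max 1 (max (int n0) \<lceil>2 * real m ^ 2 / a\<rceil>)"
    have "a / 2 * real_of_int M ^ s
      \<le> real (card {x \<in> solutions_modulo M k (edges H) B A. inj_on x (edges H)})"
      if M: "M \<ge> M0" "coprime M (d * \<Delta>)" and A: "A \<subseteq> {0..<M}" "real (card A) \<ge> \<delta> * real_of_int M" for M A
    proof -
      have Mpos: "M > 0" using M(1) by (simp add: M0_def)
      have copr: "coprime M \<Delta>" using M(2) by simp
      define n where "n = real_of_int M"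
      have n1: "n \<ge> 1" using Mpos by (simp add: n_def)
      have natM: "real (nat M) = n" using Mpos by (simp add: n_def)
      have "2 * real m ^ 2 / a \<le> real_of_int M0" unfolding M0_def by linarith
      also have "\<dots> \<le> n" using M(1) by (simp add: n_def)
      finally have big: "real m ^ 2 \<le> a / 2 * n" using apos by (simp add: field_simps)
      let ?CH = "coloured_homs H \<sigma> (alg_host M A) fst"
      let ?X = "{\<phi> \<in> ?CH. inj_on (height M A \<sigma> \<phi>) (edges H)}"
      let ?Y = "{\<phi> \<in> ?CH. \<not> inj_on (height M A \<sigma> \<phi>) (edges H)}"
      let ?S = "{x \<in> solutions_modulo M k (edges H) B A. inj_on x (edges H)}"
      have hostG: "host \<epsilon> (alg_host M A) fst"
        unfolding \<epsilon>_def by (rule host_alg_host[OF Mpos copr A]) (use \<delta> in simp)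
      have cV: "card (verts (alg_host M A)) = f * nat M" using Mpos by (simp add: card_verts_alg_host)
      have "int n0 \<le> M" using M(1) by (simp add: M0_def)
      hence "n0 \<le> nat M" by linarith
      also have "\<dots> \<le> f * nat M" using f_pos by simp
      finally have n0le: "n0 \<le> f * nat M" .
      have "a * n ^ v \<le> a * real (f * nat M) ^ v"
        using apos f_pos n1 by (intro mult_left_mono power_mono) (auto simp: natM mult_le_cancel_right1)
      also have "\<dots> \<le> real (card ?CH)" using n0[rule_format, OF hostG] n0le by (simp add: cV a_def)
      also have "card ?CH \<le> card ?X + card ?Y"
        using card_Un_le[of ?X ?Y] by (rule order.trans[rotated]) (rule eq_imp_le, rule arg_cong[of _ _ card], auto)
      also have "card ?X \<le> card ?S * nat M ^ (v - s)"
        using card_proper_homs[OF H B Mpos M(2) A(1) U ker] unfolding v_def s_def k_def .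
      also have "card ?Y \<le> m ^ 2 * nat M ^ (v - 1)"
        using card_improper_homs[OF H Mpos copr A(1)] unfolding v_def m_def .
      finally have main: "a * n ^ v \<le> real (card ?S) * n ^ (v - s) + real m ^ 2 * n ^ (v - 1)"
        by (simp add: natM)
      have "real m ^ 2 * n ^ (v - 1) \<le> a / 2 * n ^ v"
      proof (cases "v = 0")
        case True
        hence "verts H = {}" using finH by (simp add: v_def)
        hence "edges H = {}" using H(1) r_ge_2 by (auto simp: r_graph_def)
        thus ?thesis using apos n1 by (simp add: m_def)
      next
        case False
        have "real m ^ 2 * n ^ (v - 1) \<le> a / 2 * n * n ^ (v - 1)" using big n1 by (intro mult_right_mono) auto
        thus ?thesis using False by (simp add: power_eq_if)
      qed
      hence "a / 2 * n ^ v \<le> real (card ?S) * n ^ (v - s)" using main by linarith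
      moreover have "n ^ v = n ^ s * n ^ (v - s)" using sv by (simp add: power_add[symmetric])
      ultimately have "(a / 2 * n ^ s) * n ^ (v - s) \<le> real (card ?S) * n ^ (v - s)" by simp
      thus ?thesis using n1 by (subst (asm) mult_le_cancel_right_pos) (auto simp: n_def)
    qed
    thus ?thesis by (intro exI[of _ M0]) (simp add: a_def \<epsilon>_def)
  qed
  thus ?thesis using d Delta_nonzero by (intro exI[of _ "d * \<Delta>"]) (simp add: s_def)
qed

end

section \<open>Solutions in dense sets of residues and integers\<close>

context interpolation begin

text \<open>
A large prime is a valid modulus as it stands. For subsets of \<open>{1..N}\<close> the modulus \<open>L * N + 1\<close>, with \<open>L\<close> a multiple of
\<open>K\<close>, is prime to \<open>K\<close> and exceeds every value of a row of \<open>B\<close> on the box, so congruence to 0 implies equality; the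
density drops by the constant factor \<open>Q = L + 1\<close>, which enters \<open>c0\<close>.
\<close>

lemma solutions_in_dense_sets:
  fixes H :: "'a hypergraph"
  assumes H: "r_graph r H" "homomorphism H F \<sigma>" and B: "associated_matrix \<theta> H \<sigma> B"
    and w: "abundance_witness r F H \<sigma> c' C'"
  defines "I \<equiv> edges H" and "s \<equiv> assoc_dim \<theta> H \<sigma>" and "k \<equiv> card (edges H) - assoc_dim \<theta> H \<sigma>"
  shows "\<exists>c0>0. \<forall>\<delta>>0.
    (\<exists>p0. \<forall>p\<ge>p0. prime p \<longrightarrow> (\<forall>A \<subseteq> {0..<int p}. real (card A) \<ge> \<delta> * real p \<longrightarrow>
        real (card {x \<in> mod_solutions p k I B A. proper_solution I x}) \<ge> c0 * \<delta> powr C' * real p ^ s)) \<and>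
    (\<exists>N0. \<forall>N\<ge>N0. (\<forall>A \<subseteq> {1..int N}. real (card A) \<ge> \<delta> * real N \<longrightarrow>
        real (card {x \<in> int_solutions k I B A. proper_solution I x}) \<ge> c0 * \<delta> powr C' * real N ^ s))"
    (is "\<exists>c0>0. \<forall>\<delta>>0. ?P c0 \<delta> \<and> ?Q c0 \<delta>")
proof -
  obtain K :: int where K: "K \<noteq> 0" and many: "\<forall>\<delta>. 0 < \<delta> \<longrightarrow> \<delta> \<le> 1 \<longrightarrow> (\<exists>M0. \<forall>M A. M \<ge> M0 \<longrightarrow> coprime M K \<longrightarrow>
    A \<subseteq> {0..<M} \<longrightarrow> real (card A) \<ge> \<delta> * real_of_int M \<longrightarrow>
    c' / 2 * (\<delta> / real f ^ (r - 1)) powr C' * real_of_int M ^ s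
      \<le> real (card {x \<in> solutions_modulo M k I B A. inj_on x I}))"
    using many_proper_solutions[OF H B w, folded k_def, folded I_def s_def] by (elim exE conjE) (rule that)
  have c': "c' > 0" "C' > 0" using w by (auto simp: abundance_witness_def)
  have finI: "finite I" using H r_graph_finite_edges by (auto simp: I_def)
  define b where "b = (\<Sum>i<k. \<Sum>e\<in>I. \<bar>B i e\<bar>)"
  have b0: "b \<ge> 0" by (simp add: b_def sum_nonneg)
  define L where "L = \<bar>K\<bar> * (b + 1)"
  have "1 * (b + 1) \<le> L" unfolding L_def using K b0 by (intro mult_right_mono) auto
  hence Lb: "L \<ge> b + 1" by simp
  hence L1: "L \<ge> 1" using b0 by linarith
  define Q where "Q = real_of_int (L + 1)"
  have Q: "Q \<ge> 1" using L1 by (simp add: Q_def)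
  have fr: "real f ^ (r - 1) > 0" using f_pos by simp
  define c0 where "c0 = c' / 2 * (1 / (Q * real f ^ (r - 1))) powr C'"
  have "1 / (Q * real f ^ (r - 1)) > 0" using Q fr by (intro divide_pos_pos mult_pos_pos) auto
  hence "(1 / (Q * real f ^ (r - 1))) powr C' > 0" unfolding powr_gt_zero by linarith
  hence c0: "c0 > 0" unfolding c0_def using c' by (intro mult_pos_pos) simp_all
  have scale: "c0 * \<delta> powr C' = c' / 2 * (\<delta> / Q / real f ^ (r - 1)) powr C'" for \<delta>
  proof -
    have "\<delta> / Q / real f ^ (r - 1) = 1 / (Q * real f ^ (r - 1)) * \<delta>" by simp
    thus ?thesis unfolding c0_def by (simp only: powr_mult mult.assoc)
  qed
  have "?P c0 \<delta> \<and> ?Q c0 \<delta>"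
    if \<delta>: "\<delta> > 0" for \<delta>
  proof (cases "\<delta> \<le> 1")
    case False
    have prime_case: "\<not> \<delta> * real p \<le> real (card A)" if "A \<subseteq> {0..<int p}" "prime p" for p A
    proof -
      have "card A \<le> p" using card_mono[OF _ that(1)] by simp
      moreover have "1 * real p < \<delta> * real p"
        using False prime_gt_0_nat[OF that(2)] by (intro mult_strict_right_mono) auto
      ultimately show ?thesis by simp
    qed
    have int_case: "\<not> \<delta> * real N \<le> real (card A)" if "A \<subseteq> {1..int N}" "N \<ge> 1" for N A
    proof -
      have "card A \<le> N" using card_mono[OF _ that(1)] by simp
      moreover have "1 * real N < \<delta> * real N"
        using False that(2) by (intro mult_strict_right_mono) auto
      ultimately show ?thesis by simp
    qed
    show ?thesis
    proof (intro conjI exI[of _ 1] allI impI)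
      show "real (card {x \<in> mod_solutions p k I B A. proper_solution I x}) \<ge> c0 * \<delta> powr C' * real p ^ s"
        if "prime p" "A \<subseteq> {0..<int p}" "\<delta> * real p \<le> real (card A)" for p A
        using prime_case[OF that(2,1)] that(3) by blast
      show "real (card {x \<in> int_solutions k I B A. proper_solution I x}) \<ge> c0 * \<delta> powr C' * real N ^ s"
        if "N \<ge> 1" "A \<subseteq> {1..int N}" "\<delta> * real N \<le> real (card A)" for N A
        using int_case[OF that(2,1)] that(3) by blast
    qed
  next
    case True
    define \<delta>' where "\<delta>' = \<delta> / Q"
    have "\<delta> \<le> Q" using True Q by linarith
    hence \<delta>': "0 < \<delta>'" "\<delta>' \<le> 1" using \<delta> Q by (auto simp: \<delta>'_def divide_le_eq)
    have \<delta>le: "\<delta>' \<le> \<delta>" using \<delta> Q by (simp add: \<delta>'_def divide_le_eq mult_le_cancel_left1)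
    obtain M0 where M0: "\<forall>M A. M \<ge> M0 \<longrightarrow> coprime M K \<longrightarrow>
      A \<subseteq> {0..<M} \<longrightarrow> real (card A) \<ge> \<delta>' * real_of_int M \<longrightarrow>
      c' / 2 * (\<delta>' / real f ^ (r - 1)) powr C' * real_of_int M ^ s
        \<le> real (card {x \<in> solutions_modulo M k I B A. inj_on x I})"
      using many[rule_format, OF \<delta>'] by (elim exE) (rule that)
    show ?thesis
    proof (intro conjI)
      show "?P c0 \<delta>"
      proof (intro exI[of _ "max (nat M0) (nat \<bar>K\<bar> + 1)"] allI impI)
        fix p A assume p: "max (nat M0) (nat \<bar>K\<bar> + 1) \<le> p" "prime p" "A \<subseteq> {0..<int p}" "\<delta> * real p \<le> real (card A)"
        have "\<not> int p dvd K"
        proof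
          assume "int p dvd K"
          hence "\<bar>int p\<bar> \<le> \<bar>K\<bar>" by (rule dvd_imp_le_int[OF K])
          thus False using p(1) by linarith
        qed
        moreover have "prime (int p)" using p(2) by simp
        ultimately have "coprime (int p) K" by (rule prime_imp_coprime[rotated])
        moreover have "int p \<ge> M0" using p(1) by linarith
        moreover have "\<delta>' * real p \<le> \<delta> * real p" using \<delta>le by (intro mult_right_mono) auto
        ultimately have "c0 * \<delta> powr C' * real p ^ s \<le> real (card {x \<in> solutions_modulo (int p) k I B A. inj_on x I})"
          using M0[rule_format, of "int p" A] p(3,4) unfolding scale \<delta>'_def[symmetric] by simp
        thus "real (card {x \<in> mod_solutions p k I B A. proper_solution I x}) \<ge> c0 * \<delta> powr C' * real p ^ s"
          by (simp add: mod_solutions_eq proper_solution_def)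
      qed
      show "?Q c0 \<delta>"
      proof (intro exI[of _ "max (nat M0) 1"] allI impI)
        fix N A assume N: "max (nat M0) 1 \<le> N" "A \<subseteq> {1..int N}" "\<delta> * real N \<le> real (card A)"
        define M where "M = L * int N + 1"
        have "1 * int N \<le> L * int N" using L1 by (intro mult_right_mono) auto
        hence MN: "int N < M" by (simp add: M_def)
        have "M0 \<le> int N" using N(1) by linarith
        hence "M0 \<le> M" using MN by linarith
        moreover have "coprime M K"
        proof (rule coprimeI)
          fix q assume q: "q dvd M" "q dvd K"
          hence "q dvd L * int N" by (simp add: L_def)
          with q(1) have "q dvd M - L * int N" by (rule dvd_diff)
          thus "is_unit q" by (simp add: M_def)
        qed
        moreover have "A \<subseteq> {0..<M}" using N(2) MN by auto
        moreover have "\<delta>' * real_of_int M \<le> real (card A)"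
        proof -
          have "real_of_int M \<le> Q * real N" using N(1) by (simp add: M_def Q_def algebra_simps)
          hence "\<delta>' * real_of_int M \<le> \<delta>' * (Q * real N)" using \<delta>' by (intro mult_left_mono) auto
          also have "\<dots> = \<delta> * real N" using Q by (simp add: \<delta>'_def)
          finally show ?thesis using N(3) by linarith
        qed
        ultimately have "c0 * \<delta> powr C' * real_of_int M ^ s
            \<le> real (card {x \<in> solutions_modulo M k I B A. inj_on x I})"
          using M0[rule_format, of M A] unfolding scale \<delta>'_def[symmetric] by simp
        moreover have "c0 * \<delta> powr C' * real N ^ s \<le> c0 * \<delta> powr C' * real_of_int M ^ s"
          using MN c0 by (intro mult_left_mono power_mono) auto
        moreover have "card {x \<in> solutions_modulo M k I B A. inj_on x I}
            \<le> card {x \<in> int_solutions k I B A. proper_solution I x}"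
        proof (rule card_mono)
          have "finite A" using N(2) finite_subset by blast
          hence "finite (I \<rightarrow>\<^sub>E A)" using finI by (intro finite_PiE) auto
          thus "finite {x \<in> int_solutions k I B A. proper_solution I x}"
            by (rule finite_subset[rotated]) (auto simp: int_solutions_def)
          have "(\<Sum>j\<in>I. B i j * x j) = 0" if x: "x \<in> I \<rightarrow>\<^sub>E A" and i: "i < k" and dv: "M dvd (\<Sum>j\<in>I. B i j * x j)" for x i
          proof -
            have "\<bar>\<Sum>j\<in>I. B i j * x j\<bar> \<le> (\<Sum>j\<in>I. \<bar>B i j * x j\<bar>)" by (rule sum_abs)
            also have "\<dots> \<le> (\<Sum>j\<in>I. \<bar>B i j\<bar> * int N)"
            proof (rule sum_mono)
              fix j assume "j \<in> I"
              hence "x j \<in> {1..int N}" using PiE_mem[OF x] N(2) by blast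
              thus "\<bar>B i j * x j\<bar> \<le> \<bar>B i j\<bar> * int N" by (simp add: abs_mult mult_left_mono)
            qed
            also have "\<dots> = (\<Sum>j\<in>I. \<bar>B i j\<bar>) * int N" by (simp add: sum_distrib_right)
            also have "\<dots> \<le> b * int N"
            proof (rule mult_right_mono)
              show "(\<Sum>j\<in>I. \<bar>B i j\<bar>) \<le> b" unfolding b_def
                by (rule member_le_sum) (use i in \<open>auto simp: sum_nonneg\<close>)
            qed simp
            also have "\<dots> \<le> L * int N" using Lb by (intro mult_right_mono) auto
            also have "\<dots> < M" by (simp add: M_def)
            finally show ?thesis using dv dvd_imp_le_int[of "\<Sum>j\<in>I. B i j * x j" M] by linarith
          qed
          thus "{x \<in> solutions_modulo M k I B A. inj_on x I} \<subseteq> {x \<in> int_solutions k I B A. proper_solution I x}"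
            by (auto simp: solutions_modulo_def int_solutions_def proper_solution_def)
        qed
        ultimately show "real (card {x \<in> int_solutions k I B A. proper_solution I x}) \<ge> c0 * \<delta> powr C' * real N ^ s"
          by linarith
      qed
    qed
  qed
  thus ?thesis using c0 by blast
qed

lemma finite_solution_sets:
  assumes "finite I"
  shows "A \<subseteq> {0..<int p} \<Longrightarrow> finite (mod_solutions p k I B A)" "A \<subseteq> {1..int N} \<Longrightarrow> finite (int_solutions k I B A)"
proof -
  have *: "finite (I \<rightarrow>\<^sub>E A)" if "finite A" using that assms by (intro finite_PiE) auto
  show "finite (mod_solutions p k I B A)" if "A \<subseteq> {0..<int p}"
    by (rule finite_subset[OF _ *]) (use that in \<open>auto simp: mod_solutions_def intro: finite_subset\<close>)
  show "finite (int_solutions k I B A)" if "A \<subseteq> {1..int N}"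
    by (rule finite_subset[OF _ *]) (use that in \<open>auto simp: int_solutions_def intro: finite_subset\<close>)
qed

lemma associated_system:
  fixes H :: "'a hypergraph"
  assumes H: "r_graph r H" "homomorphism H F \<sigma>" and cover: "\<forall>v\<in>verts H. \<exists>e\<in>edges H. v \<in> e"
    and B: "associated_matrix \<theta> H \<sigma> B"
  shows "let I = edges H; m = card I; s = assoc_dim \<theta> H \<sigma>; k = m - s in
        (\<forall>i<k. (\<Sum>e\<in>I. B i e) = 0) \<and>
        (\<forall>c' C'. abundance_witness r F H \<sigma> c' C' \<longrightarrow>
          (\<exists>c0>0. \<forall>\<delta>>0.
            (\<exists>p0. \<forall>p\<ge>p0. prime p \<longrightarrow>
              (\<forall>A \<subseteq> {0..<int p}. real (card A) \<ge> \<delta> * real p \<longrightarrow>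
                real (card (mod_solutions p k I B A)) \<ge> c0 * \<delta> powr C' * real p ^ s \<and>
                (m \<ge> 2 \<longrightarrow>
                  real (card {x \<in> mod_solutions p k I B A. proper_solution I x})
                    \<ge> c0 * \<delta> powr C' * real p ^ s))) \<and>
            (\<exists>N0. \<forall>N\<ge>N0.
              (\<forall>A \<subseteq> {1..int N}. real (card A) \<ge> \<delta> * real N \<longrightarrow>
                real (card (int_solutions k I B A)) \<ge> c0 * \<delta> powr C' * real N ^ s \<and>
                (m \<ge> 2 \<longrightarrow>
                  real (card {x \<in> int_solutions k I B A. proper_solution I x})
                    \<ge> c0 * \<delta> powr C' * real N ^ s))))) \<and>
        (int (card (edges H)) \<ge> int (card (verts H)) - int (num_components H) * (int r - 1) + 1 \<longrightarrow>
          (\<exists>i<k. \<exists>e\<in>I. B i e \<noteq> 0))"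
  unfolding Let_def
proof (intro conjI allI impI, goal_cases)
  case (1 i)
  thus ?case by (rule translation_invariant[OF H B])
next
  case (2 c' C')
  let ?k = "card (edges H) - assoc_dim \<theta> H \<sigma>"
  have finI: "finite (edges H)" using H r_graph_finite_edges by auto
  obtain c0 where c0: "c0 > 0" and count: "\<forall>\<delta>>0.
      (\<exists>p0. \<forall>p\<ge>p0. prime p \<longrightarrow> (\<forall>A \<subseteq> {0..<int p}. real (card A) \<ge> \<delta> * real p \<longrightarrow>
        real (card {x \<in> mod_solutions p ?k (edges H) B A. proper_solution (edges H) x})
          \<ge> c0 * \<delta> powr C' * real p ^ assoc_dim \<theta> H \<sigma>)) \<and>
      (\<exists>N0. \<forall>N\<ge>N0. (\<forall>A \<subseteq> {1..int N}. real (card A) \<ge> \<delta> * real N \<longrightarrow>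
        real (card {x \<in> int_solutions ?k (edges H) B A. proper_solution (edges H) x})
          \<ge> c0 * \<delta> powr C' * real N ^ assoc_dim \<theta> H \<sigma>))"
    using solutions_in_dense_sets[OF H B 2] by (elim exE conjE) (rule that)
  have proper_le: "real (card {x \<in> S. proper_solution (edges H) x}) \<le> real (card S)"
    if "finite S" for S :: "('a set \<Rightarrow> int) set"
    unfolding of_nat_le_iff by (rule card_mono[OF that]) auto
  note le = order.trans[OF _ proper_le[OF finite_solution_sets(1)[OF finI]]]
    order.trans[OF _ proper_le[OF finite_solution_sets(2)[OF finI]]]
  show ?case
  proof (intro exI[of _ c0] conjI c0 allI impI, goal_cases)
    case (1 \<delta>)
    from count[rule_format, OF 1, THEN conjunct1] show ?case by (elim exE, intro exI) (blast intro: le)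
  next
    case (2 \<delta>)
    from count[rule_format, OF 2, THEN conjunct2] show ?case by (elim exE, intro exI) (blast intro: le)
  qed
next
  case 3
  have "assoc_dim \<theta> H \<sigma> + num_components H * (r - 1) \<le> card (verts H)"
    by (rule assoc_dim_le_components[OF H cover])
  hence "int (assoc_dim \<theta> H \<sigma>) + int (num_components H) * int (r - 1) \<le> int (card (verts H))"
    by (metis of_nat_add of_nat_le_iff of_nat_mult)
  moreover have "int (r - 1) = int r - 1" using r_ge_2 by simp
  ultimately have "0 < card (edges H) - assoc_dim \<theta> H \<sigma>" using 3 by simp
  thus ?case by (rule matrix_has_nonzero_row[OF B])
qed

end

lemma card_edges_le_choose:
  assumes "r_graph r H" "card (verts H) \<le> n"
  shows "card (edges H) \<le> n choose r"
proof -
  have fin: "finite (verts H)" using assms(1) by (simp add: r_graph_def)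
  have "card (edges H) \<le> card {e. e \<subseteq> verts H \<and> card e = r}"
    by (rule card_mono) (use assms(1) fin in \<open>auto simp: r_graph_def\<close>)
  also have "\<dots> = card (verts H) choose r" by (rule n_subsets[OF fin])
  also have "\<dots> \<le> n choose r" by (rule binomial_right_mono[OF assms(2)])
  finally show ?thesis .
qed

theorem corollary4p3:
  fixes r f :: nat and F :: "nat hypergraph"
    and is_coloured :: bool
    and \<K> :: "('a hypergraph \<times> ('a \<Rightarrow> nat)) set"
    and \<H> :: "'a hypergraph set"
    and c C :: real
  assumes "r \<ge> 2"
    and "r_graph r F" and "verts F = {1..f}" and "edges F \<noteq> {}" and "\<not> (\<exists>v. isolated F v)"
    and "c > 0" and "C > 0"
    and "if is_coloured
         then (\<forall>(H, \<sigma>)\<in>\<K>. r_graph r H \<and> homomorphism H F \<sigma>) \<and> coloured_family_abundant r F \<K> c C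
         else (\<forall>H\<in>\<H>. r_graph r H) \<and> family_abundant r F \<H> c C"
  shows "\<exists>H0 H \<sigma>0.
    (if is_coloured
     then (\<exists>\<sigma>. (H0, \<sigma>) \<in> \<K> \<and> \<sigma>0 = restrict \<sigma> (verts (del_isolated H0)))
     else H0 \<in> \<H>) \<and>
    H = del_isolated H0 \<and> homomorphism H F \<sigma>0 \<and>
    int (card (verts H)) \<le> \<lfloor>2 * real r * (C + 1)\<rfloor> \<and> abundant r F H \<sigma>0 \<and>
    card (edges H) \<le> nat \<lfloor>2 * real r * (C + 1)\<rfloor> choose r \<and>
    (\<forall>\<theta> B. inj_on \<theta> {1..f} \<and> associated_matrix \<theta> H \<sigma>0 B \<longrightarrow>
      (let I = edges H; m = card I; s = assoc_dim \<theta> H \<sigma>0; k = m - s in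
        (\<forall>i<k. (\<Sum>e\<in>I. B i e) = 0) \<and>
        (\<forall>c' C'. abundance_witness r F H \<sigma>0 c' C' \<longrightarrow>
          (\<exists>c0>0. \<forall>\<delta>>0.
            (\<exists>p0. \<forall>p\<ge>p0. prime p \<longrightarrow>
              (\<forall>A \<subseteq> {0..<int p}. real (card A) \<ge> \<delta> * real p \<longrightarrow>
                real (card (mod_solutions p k I B A)) \<ge> c0 * \<delta> powr C' * real p ^ s \<and>
                (m \<ge> 2 \<longrightarrow>
                  real (card {x \<in> mod_solutions p k I B A. proper_solution I x})
                    \<ge> c0 * \<delta> powr C' * real p ^ s))) \<and>
            (\<exists>N0. \<forall>N\<ge>N0.
              (\<forall>A \<subseteq> {1..int N}. real (card A) \<ge> \<delta> * real N \<longrightarrow>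
                real (card (int_solutions k I B A)) \<ge> c0 * \<delta> powr C' * real N ^ s \<and>
                (m \<ge> 2 \<longrightarrow>
                  real (card {x \<in> int_solutions k I B A. proper_solution I x})
                    \<ge> c0 * \<delta> powr C' * real N ^ s))))) \<and>
        (int (card (edges H)) \<ge> int (card (verts H)) - int (num_components H) * (int r - 1) + 1 \<longrightarrow>
          (\<exists>i<k. \<exists>e\<in>I. B i e \<noteq> 0))))"
proof -
  interpret pattern r f F by unfold_locales (use assms in auto)
  have "\<exists>H0 \<sigma>0. (if is_coloured
     then (\<exists>\<sigma>. (H0, \<sigma>) \<in> \<K> \<and> \<sigma>0 = restrict \<sigma> (verts (del_isolated H0)))
     else H0 \<in> \<H>) \<and> r_graph r H0 \<and> homomorphism (del_isolated H0) F \<sigma>0 \<and>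
     int (card (verts (del_isolated H0))) \<le> \<lfloor>2 * real r * (C + 1)\<rfloor> \<and> abundant r F (del_isolated H0) \<sigma>0"
  proof (cases is_coloured)
    case True
    hence K: "\<forall>(H, \<sigma>)\<in>\<K>. r_graph r H \<and> homomorphism H F \<sigma>" "coloured_family_abundant r F \<K> c C"
      using assms(8) by auto
    from coloured_selection[OF K(2,1)] obtain H0 \<sigma> where H0: "(H0, \<sigma>) \<in> \<K>"
      "int (card (verts (del_isolated H0))) \<le> \<lfloor>2 * real r * (C + 1)\<rfloor>"
      "abundant r F (del_isolated H0) (restrict \<sigma> (verts (del_isolated H0)))" by blast
    have rH: "r_graph r H0" "homomorphism H0 F \<sigma>" using K(1) H0(1) by auto
    have "homomorphism (del_isolated H0) F (restrict \<sigma> (verts (del_isolated H0)))"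
      by (rule homomorphism_del_isolated[OF rH])
    thus ?thesis using True H0 rH(1)
      by (intro exI[of _ H0] exI[of _ "restrict \<sigma> (verts (del_isolated H0))"]) auto
  next
    case False
    hence K: "\<forall>H\<in>\<H>. r_graph r H" "family_abundant r F \<H> c C" using assms(8) by auto
    from uncoloured_selection[OF K(2,1)] obtain H0 \<sigma> where "H0 \<in> \<H>" "homomorphism (del_isolated H0) F \<sigma>"
      "int (card (verts (del_isolated H0))) \<le> \<lfloor>2 * real r * (C + 1)\<rfloor>" "abundant r F (del_isolated H0) \<sigma>" by blast
    thus ?thesis using False K(1) by (intro exI[of _ H0] exI[of _ \<sigma>]) auto
  qed
  then obtain H0 \<sigma>0 where H0: "if is_coloured
     then (\<exists>\<sigma>. (H0, \<sigma>) \<in> \<K> \<and> \<sigma>0 = restrict \<sigma> (verts (del_isolated H0)))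
     else H0 \<in> \<H>" "r_graph r H0" "homomorphism (del_isolated H0) F \<sigma>0"
     "int (card (verts (del_isolated H0))) \<le> \<lfloor>2 * real r * (C + 1)\<rfloor>" "abundant r F (del_isolated H0) \<sigma>0"
    by (elim exE conjE) (rule that)
  have rH: "r_graph r (del_isolated H0)" by (rule r_graph_del_isolated[OF H0(2)])
  have cover: "\<forall>v\<in>verts (del_isolated H0). \<exists>e\<in>edges (del_isolated H0). v \<in> e"
    by (simp add: verts_del_isolated)
  have edges: "card (edges (del_isolated H0)) \<le> nat \<lfloor>2 * real r * (C + 1)\<rfloor> choose r"
    by (rule card_edges_le_choose[OF rH]) (use H0(4) in linarith)
  show ?thesis
  proof (rule exI[of _ H0], rule exI[of _ "del_isolated H0"], rule exI[of _ \<sigma>0],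
      intro conjI H0(1) refl H0(3-5) edges allI impI, goal_cases)
    case (1 \<theta> B)
    interpret interpolation r f F \<theta> by unfold_locales (use 1 in simp)
    show ?case by (rule associated_system[OF rH H0(3) cover conjunct2[OF 1]])
  qed
qed

end
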